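(* Let $\lambda,\beta,\mu>0$ and $\delta\in(1,2)$, and let $G:[0,\infty)\to\mathbb{R}$ satisfy $G'\in C^2_{\mathrm b}([0,\infty))$. Let $K_h$ ($h>0$) be the clamped ULA kernel and $\pi$ the target measure defined in the context. Assume: (M) there exist $M<\infty$ and $h_0>0$ such that the Markov chain $(u_n)$ with kernel $K_h$ satisfies $\sup_{h\le h_0}\limsup_{n\to\infty}\mathbb{E}[u_n^2]\le M$ for all initial conditions $u_0\ge 0$; (E) there exist $c>0$, $C<\infty$, $h_0>0$ such that for all $h\in(0,h_0]$ the kernel $K_h$ has a unique stationary distribution $\pi_h$ and $\|K_h^n(x,\cdot)-\pi_h\|_V\le C\,V(x)(1-ch)^n$ for all $x\in[0,\infty)$, $n\ge 0$, where $V(x)=1+x^2$ and $\|\nu\|_V=\int V\,d|\nu|$. Then, for every bounded measurable $\eta:[0,\infty)\to\mathbb{R}$, as $h\downarrow 0$, $$\pi_h(\eta)-\pi(\eta)=K_\star\,\hat\eta(0)\,h|\log h|+O\bigl(h\,\|\eta\|_\infty\bigr),\qquad \hat\eta(0):=\eta(0)-\pi(\eta),$$ where the constant in $O(\cdot)$ does not depend on $\eta$ or on $h\in(0,h_1]$ (for some $h_1>0$), and where $$K_\star=\tfrac12(\delta-1)\,\beta\,G'(0)^2\,\pi(\{0\}).$$ Equivalently, $\pi_h=\pi+K_\star\,h|\log h|\,(\delta_0-\pi)+O(h)$ in total variation.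
   Context: $C^k_{\mathrm b}([0,\infty))$: $k$-times continuously differentiable functions on $[0,\infty)$ with bounded derivatives of orders $0,\dots,k$. $\delta_0$ is the Dirac mass at $0$ (not to be confused with the parameter $\delta$). For a measure $\nu$, $\nu(\eta)=\int\eta\,d\nu$. Target measure: $\pi(dx)=Z^{-1}\bigl[\tfrac{e^{-\beta G(0)}}{\mu}\delta_0(dx)+\beta x^{\delta-1}e^{-\lambda\beta x^2/2-\beta G(x)}\,dx\bigr]$ on $[0,\infty)$, $Z$ the normalising constant. Zero-potential resolvent kernel. For $h>0$ put $\alpha=1/h$, $a=\alpha/(2\lambda)$, $b=\delta/2$, $z_x=\lambda\beta x^2/2$, $m'(x)=\beta x^{\delta-1}e^{-\lambda\beta x^2/2}$. $M(a,b,z)={}_1F_1(a;b;z)$ and $U(a,b,z)$ are Kummer's confluent hypergeometric functions of the first and second kind. Put $U_0=U(a,b,0)=\Gamma(1-b)/\Gamma(1+a-b)$, $|\mathcal W|=\lambda\beta\,\frac{\Gamma(b)}{\Gamma(a)}(\lambda\beta/2)^{-b}$, $c_\mu=-\alpha/(\mu|\mathcal W|+\alpha U_0)$, $f_0^{\rm sticky}(x)=M(a,b,z_x)+c_\mu U(a,b,z_x)$, $G^{\rm sticky}_\alpha(x,y)=f_0^{\rm sticky}(x\wedge y)\,U(a,b,z_{x\vee y})/|\mathcal W|$. The Markov kernel $$R_h(s,dy)=\alpha\,G^{\rm sticky}_\alpha(s,y)\,m'(y)\,dy-c_\mu\,U(a,b,z_s)\,\delta_0(dy),\qquad s\ge0,$$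 on $[0,\infty)$ is the law, at an independent $\mathrm{Exp}(\alpha)$ time, of the sticky CIR process with zero potential started at $s$ (the diffusion on $[0,\infty)$ with drift $\frac{\delta-1}{\beta x}-\lambda x$, diffusion coefficient $\sqrt{2/\beta}$, speed measure $m(dx)=m'(x)dx+\mu^{-1}\delta_0(dx)$). Clamped ULA kernel: $K_h(x,\cdot)=R_h(\phi_h(x),\cdot)$, where, with $L_h=h\|G'\|_\infty$, $\phi_h(x)=\chi_h(x)\,\max(x-hG'(x),0)$ and $\chi_h\in C^1([0,\infty))$ is a cutoff with values in $[0,1]$, $\chi_h\equiv1$ on $[L_h,\infty)$ and $\chi_h(0)=0$ (e.g. $\chi_h(x)=\sin^2(\pi x/(2L_h))$ on $[0,L_h]$). Thus $\phi_h(0)=0$ and $\phi_h(x)=x-hG'(x)$ for $x\ge L_h$. If $G'\equiv0$, take $\phi_h(x)=x$. *)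

theory Defs
  imports "HOL-Probability.Probability"
begin

section \<open>Functions on the half line\<close>

text \<open>Derivatives at \<open>0\<close> are one-sided: values of \<open>f\<close> on the negative axis never matter.\<close>

definition derivs_upto :: "nat \<Rightarrow> (real \<Rightarrow> real) \<Rightarrow> (nat \<Rightarrow> real \<Rightarrow> real) \<Rightarrow> bool" where
  "derivs_upto k f D \<longleftrightarrow> D 0 = f \<and>
     (\<forall>i<k. \<forall>x\<ge>0. (D i has_real_derivative D (Suc i) x) (at x within {0..})) \<and>
     (\<forall>i\<le>k. continuous_on {0..} (D i))"

definition Ck :: "nat \<Rightarrow> (real \<Rightarrow> real) \<Rightarrow> bool" where
  "Ck k f \<longleftrightarrow> (\<exists>D. derivs_upto k f D)"

definition Ckb :: "nat \<Rightarrow> (real \<Rightarrow> real) \<Rightarrow> bool" where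
  "Ckb k f \<longleftrightarrow> (\<exists>D. derivs_upto k f D \<and> (\<forall>i\<le>k. bounded (D i ` {0..})))"

definition sup_norm :: "(real \<Rightarrow> real) \<Rightarrow> real" where
  "sup_norm f = (SUP x\<in>{0..}. \<bar>f x\<bar>)"


section \<open>Measures on the half line\<close>

definition half_line :: "real measure" where
  "half_line = restrict_space borel {0..}"

lemma space_half_line [simp]: "space half_line = {0..}"
  by (simp add: half_line_def space_restrict_space)

lemma sets_half_lineD: "A \<in> sets half_line \<Longrightarrow> A \<in> sets borel \<and> A \<subseteq> {0..}"
  by (auto simp: half_line_def sets_restrict_space)

text \<open>The measure \<open>w \<delta>\<^sub>0(dx) + f(x) dx\<close> on the half line, for \<open>w \<ge> 0\<close> and \<open>f \<ge> 0\<close>.\<close>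

definition atom_plus_density :: "real \<Rightarrow> (real \<Rightarrow> real) \<Rightarrow> real measure" where
  "atom_plus_density w f = measure_of {0..} (sets half_line)
     (\<lambda>A. ennreal w * indicator A 0 + (\<integral>\<^sup>+x\<in>A. ennreal (f x) \<partial>lborel))"

lemma space_atom_plus_density [simp]: "space (atom_plus_density w f) = {0..}"
  unfolding atom_plus_density_def
  by (rule space_measure_of) (use sets.space_closed[of half_line] in simp)

lemma sets_atom_plus_density [simp]: "sets (atom_plus_density w f) = sets half_line"
  unfolding atom_plus_density_def
  using sets.sets_measure_of_eq[of half_line] by simp

lemma emeasure_atom_plus_density:
  assumes f: "f \<in> borel_measurable half_line" and A: "A \<in> sets half_line"
  shows "emeasure (atom_plus_density w f) A =
    ennreal w * indicator A 0 + (\<integral>\<^sup>+x\<in>A. ennreal (f x) \<partial>lborel)"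
proof -
  let ?g = "\<lambda>x. ennreal (f x) * indicator {0..} x"
  have "(\<lambda>x. ennreal (f x)) \<in> borel_measurable (restrict_space borel {0..})"
    using f by (auto simp: half_line_def)
  then have g: "?g \<in> borel_measurable borel"
    by (subst (asm) borel_measurable_restrict_space_iff_ennreal) auto
  let ?m = "\<lambda>A. ennreal w * emeasure (return borel 0) A + emeasure (density lborel ?g) A"
  have eq: "ennreal w * indicator B 0 + (\<integral>\<^sup>+x\<in>B. ennreal (f x) \<partial>lborel) = ?m B"
    if "B \<in> sets half_line" for B
  proof -
    have B: "B \<in> sets borel" "B \<subseteq> {0..}" using sets_half_lineD[OF that] by auto
    have "emeasure (density lborel ?g) B = (\<integral>\<^sup>+x\<in>B. ?g x \<partial>lborel)"
      using B g by (subst emeasure_density) auto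
    also have "\<dots> = (\<integral>\<^sup>+x\<in>B. ennreal (f x) \<partial>lborel)"
      using B by (intro nn_integral_cong) (auto simp: indicator_def)
    finally show ?thesis using B by simp
  qed
  show ?thesis
  proof (rule emeasure_measure_of[OF atom_plus_density_def])
    show "sets half_line \<subseteq> Pow {0..}" using sets.space_closed[of half_line] by simp
    show "A \<in> sets (atom_plus_density w f)" using A by simp
    show "positive (sets (atom_plus_density w f))
       (\<lambda>A. ennreal w * indicator A 0 + (\<integral>\<^sup>+x\<in>A. ennreal (f x) \<partial>lborel))"
      by (simp add: positive_def)
    show "countably_additive (sets (atom_plus_density w f))
       (\<lambda>A. ennreal w * indicator A 0 + (\<integral>\<^sup>+x\<in>A. ennreal (f x) \<partial>lborel))"
    proof (rule countably_additiveI, goal_cases)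
      case (1 B)
      then have B: "\<And>i. B i \<in> sets half_line" "disjoint_family B" "(\<Union>i. B i) \<in> sets half_line"
        by auto
      have r: "range B \<subseteq> sets borel" using B(1) sets_half_lineD by auto
      have "(\<Sum>i. ?m (B i)) = ennreal w * (\<Sum>i. emeasure (return borel 0) (B i))
          + (\<Sum>i. emeasure (density lborel ?g) (B i))"
        by (simp only: suminf_add[symmetric] ennreal_suminf_cmult summableI)
      also have "\<dots> = ?m (\<Union>i. B i)"
        using r B(2) by (simp only: suminf_emeasure sets_return sets_density sets_lborel)
      finally show ?case by (simp only: eq[OF B(1)] eq[OF B(3)])
    qed
  qed
qed

text \<open>Total variation measure \<open>\<bar>\<sigma>\<bar>\<close> of a finite signed measure on the half line, the latter
  given as a real-valued set function \<open>\<sigma>\<close>, and the norm \<open>\<integral> V d\<bar>\<sigma>\<bar>\<close>. No factor \<open>1/2\<close>.\<close>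

definition variation :: "(real set \<Rightarrow> real) \<Rightarrow> real set \<Rightarrow> ennreal" where
  "variation \<sigma> A =
     (SUP F \<in> {F. finite F \<and> F \<subseteq> sets half_line \<and> disjoint F \<and> \<Union>F = A}.
        \<Sum>B\<in>F. ennreal \<bar>\<sigma> B\<bar>)"

definition variation_measure :: "(real set \<Rightarrow> real) \<Rightarrow> real measure" where
  "variation_measure \<sigma> = measure_of {0..} (sets half_line) (variation \<sigma>)"

definition weighted_norm :: "(real \<Rightarrow> real) \<Rightarrow> (real set \<Rightarrow> real) \<Rightarrow> ennreal" where
  "weighted_norm V \<sigma> = (\<integral>\<^sup>+x. ennreal (V x) \<partial>variation_measure \<sigma>)"


section \<open>Markov kernels on the half line\<close>

primrec kernel_pow :: "(real \<Rightarrow> real measure) \<Rightarrow> nat \<Rightarrow> real \<Rightarrow> real measure" where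
  "kernel_pow K 0 x = return half_line x"
| "kernel_pow K (Suc n) x = kernel_pow K n x \<bind> K"

definition stationary :: "(real \<Rightarrow> real measure) \<Rightarrow> real measure \<Rightarrow> bool" where
  "stationary K \<nu> \<longleftrightarrow> \<nu> \<in> space (prob_algebra half_line) \<and> \<nu> \<bind> K = \<nu>"


section \<open>Kummer functions\<close>

definition kummer_M :: "real \<Rightarrow> real \<Rightarrow> real \<Rightarrow> real" where
  "kummer_M a b z = eval_fps (fps_hypergeo [a] [b] 1) z"

lemma kummer_M_series:
  "kummer_M a b z = (\<Sum>n. pochhammer a n / (pochhammer b n * fact n) * z ^ n)"
  by (simp add: kummer_M_def eval_fps_def)

text \<open>The connection formula defines \<open>U\<close> for \<open>z \<ge> 0\<close> and non-integer \<open>b\<close>;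
  below \<open>b = \<delta>/2\<close> lies in \<open>(1/2, 1)\<close>. At \<open>z = 0\<close> the second term vanishes, because
  \<open>0 powr _ = 0\<close> and \<open>1 - b > 0\<close>.\<close>

definition kummer_U :: "real \<Rightarrow> real \<Rightarrow> real \<Rightarrow> real" where
  "kummer_U a b z =
     Gamma (1 - b) / Gamma (1 + a - b) * kummer_M a b z
     + Gamma (b - 1) / Gamma a * z powr (1 - b) * kummer_M (1 + a - b) (2 - b) z"

lemma kummer_U_0: "kummer_U a b 0 = Gamma (1 - b) / Gamma (1 + a - b)"
  by (simp add: kummer_U_def kummer_M_def eval_fps_at_0)


section \<open>Target measure\<close>

definition speed_density :: "real \<Rightarrow> real \<Rightarrow> real \<Rightarrow> real \<Rightarrow> real" where
  "speed_density lam \<beta> \<delta> x = \<beta> * x powr (\<delta> - 1) * exp (- lam * \<beta> * x\<^sup>2 / 2)"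

definition target_unnormalised ::
  "real \<Rightarrow> real \<Rightarrow> real \<Rightarrow> real \<Rightarrow> (real \<Rightarrow> real) \<Rightarrow> real measure" where
  "target_unnormalised lam \<beta> \<mu> \<delta> G =
     atom_plus_density (exp (- \<beta> * G 0) / \<mu>)
       (\<lambda>x. \<beta> * x powr (\<delta> - 1) * exp (- lam * \<beta> * x\<^sup>2 / 2 - \<beta> * G x))"

definition target ::
  "real \<Rightarrow> real \<Rightarrow> real \<Rightarrow> real \<Rightarrow> (real \<Rightarrow> real) \<Rightarrow> real measure" where
  "target lam \<beta> \<mu> \<delta> G =
     (let N = target_unnormalised lam \<beta> \<mu> \<delta> G
      in scale_measure (ennreal (1 / measure N {0..})) N)"


section \<open>Zero-potential resolvent kernel and clamped ULA kernel\<close>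

text \<open>Throughout, \<open>\<alpha> = 1/h\<close>, \<open>a = \<alpha>/(2\<lambda>)\<close> and \<open>b = \<delta>/2\<close>.\<close>

definition zvar :: "real \<Rightarrow> real \<Rightarrow> real \<Rightarrow> real" where
  "zvar lam \<beta> x = lam * \<beta> * x\<^sup>2 / 2"

definition abs_wronskian :: "real \<Rightarrow> real \<Rightarrow> real \<Rightarrow> real \<Rightarrow> real" where
  "abs_wronskian lam \<beta> \<delta> \<alpha> =
     (let a = \<alpha> / (2 * lam); b = \<delta> / 2
      in lam * \<beta> * (Gamma b / Gamma a) * (lam * \<beta> / 2) powr (- b))"

definition c_sticky :: "real \<Rightarrow> real \<Rightarrow> real \<Rightarrow> real \<Rightarrow> real \<Rightarrow> real" where
  "c_sticky lam \<beta> \<mu> \<delta> \<alpha> =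
     - \<alpha> / (\<mu> * abs_wronskian lam \<beta> \<delta> \<alpha> + \<alpha> * kummer_U (\<alpha> / (2 * lam)) (\<delta> / 2) 0)"

definition f0_sticky :: "real \<Rightarrow> real \<Rightarrow> real \<Rightarrow> real \<Rightarrow> real \<Rightarrow> real \<Rightarrow> real" where
  "f0_sticky lam \<beta> \<mu> \<delta> \<alpha> x =
     (let a = \<alpha> / (2 * lam); b = \<delta> / 2; z = zvar lam \<beta> x
      in kummer_M a b z + c_sticky lam \<beta> \<mu> \<delta> \<alpha> * kummer_U a b z)"

definition G_sticky :: "real \<Rightarrow> real \<Rightarrow> real \<Rightarrow> real \<Rightarrow> real \<Rightarrow> real \<Rightarrow> real \<Rightarrow> real" where
  "G_sticky lam \<beta> \<mu> \<delta> \<alpha> x y =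
     f0_sticky lam \<beta> \<mu> \<delta> \<alpha> (min x y)
     * kummer_U (\<alpha> / (2 * lam)) (\<delta> / 2) (zvar lam \<beta> (max x y))
     / abs_wronskian lam \<beta> \<delta> \<alpha>"

definition resolvent_kernel ::
  "real \<Rightarrow> real \<Rightarrow> real \<Rightarrow> real \<Rightarrow> real \<Rightarrow> real \<Rightarrow> real measure" where
  "resolvent_kernel lam \<beta> \<mu> \<delta> h s =
     (let \<alpha> = 1 / h
      in atom_plus_density
           (- c_sticky lam \<beta> \<mu> \<delta> \<alpha> * kummer_U (\<alpha> / (2 * lam)) (\<delta> / 2) (zvar lam \<beta> s))
           (\<lambda>y. \<alpha> * G_sticky lam \<beta> \<mu> \<delta> \<alpha> s y * speed_density lam \<beta> \<delta> y))"

definition cutoff :: "real \<Rightarrow> (real \<Rightarrow> real) \<Rightarrow> bool" where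
  "cutoff L \<kappa> \<longleftrightarrow> Ck 1 \<kappa> \<and> (\<forall>x\<ge>0. 0 \<le> \<kappa> x \<and> \<kappa> x \<le> 1) \<and> (\<forall>x\<ge>L. \<kappa> x = 1) \<and> \<kappa> 0 = 0"

text \<open>\<open>G'\<close> is the derivative of the potential and \<open>\<kappa>\<close> the cutoff for the step size \<open>h\<close>;
  the cutoff is not used if \<open>G'\<close> vanishes identically.\<close>

definition clamp ::
  "(real \<Rightarrow> real) \<Rightarrow> (real \<Rightarrow> real) \<Rightarrow> real \<Rightarrow> real \<Rightarrow> real" where
  "clamp G' \<kappa> h x =
     (if \<forall>y\<ge>0. G' y = 0 then x else \<kappa> x * max (x - h * G' x) 0)"

definition clamped_ULA ::
  "real \<Rightarrow> real \<Rightarrow> real \<Rightarrow> real \<Rightarrow> (real \<Rightarrow> real) \<Rightarrow> (real \<Rightarrow> real \<Rightarrow> real)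
    \<Rightarrow> real \<Rightarrow> real \<Rightarrow> real measure" where
  "clamped_ULA lam \<beta> \<mu> \<delta> G' \<kappa> h x =
     resolvent_kernel lam \<beta> \<mu> \<delta> h (clamp G' (\<kappa> h) h x)"

definition K_star ::
  "real \<Rightarrow> real \<Rightarrow> real \<Rightarrow> real \<Rightarrow> (real \<Rightarrow> real) \<Rightarrow> (real \<Rightarrow> real) \<Rightarrow> real" where
  "K_star lam \<beta> \<mu> \<delta> G G' =
     1 / 2 * (\<delta> - 1) * \<beta> * (G' 0)\<^sup>2 * measure (target lam \<beta> \<mu> \<delta> G) {0}"

end

theory Submission
  imports Defs "HOL-Real_Asymp.Real_Asymp"
begin

text \<open>Write \<open>g = R\<^sub>h f\<close>, so that \<open>f = g - h L g\<close> with the generator \<open>L\<close> of the sticky process, and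
  \<open>K\<^sub>h f = g \<circ> \<phi>\<^sub>h\<close>. Take for \<open>f\<close> the partial sums of \<open>\<Sum>\<^sub>n K\<^sub>h\<^sup>n \<eta> - \<pi>\<^sub>h(\<eta>)\<close>, so that \<open>f - g \<circ> \<phi>\<^sub>h\<close> tends
  to \<open>\<eta> - \<pi>\<^sub>h(\<eta>)\<close>, while (E) gives \<open>f = O((1 + x\<^sup>2)/h)\<close>. Since \<open>\<pi>(L g - G' g') = 0\<close>, integrating
  \<open>f - g \<circ> \<phi>\<^sub>h\<close> against \<open>\<pi>\<close> leaves only the remainder of the Taylor expansion of
  \<open>g \<circ> \<phi>\<^sub>h\<close> about \<open>g - h G' g'\<close>. Its quadratic term is \<open>h\<^sup>2 G'\<^sup>2 g'' / 2\<close>. Near \<open>0\<close> the flux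
  \<open>F = x\<^bsup>\<delta>-1\<^esup> g'\<close> has a limit, given by the stickiness condition and hence by \<open>\<eta>(0) - \<pi>\<^sub>h(\<eta>)\<close>;
  so \<open>g''\<close> behaves like \<open>-(\<delta>-1) F(0) x\<^bsup>-\<delta>\<^esup>\<close>, which against the density \<open>x\<^bsup>\<delta>-1\<^esup>\<close> is \<open>1/x\<close>, and
  integrating from \<open>x \<approx> h\<close> produces the logarithm. The other contributions are controlled by
  \<open>|g'| = O(x\<^bsup>1-\<delta>\<^esup> + x\<^sup>2)/h\<close>, proved by interpolating between \<open>g\<close> and \<open>L g\<close> and absorbing. Only continuous
  \<open>\<eta>\<close> are treated this way; they determine the total variation norm.

  The resolvent equation comes from the Wronskian of the Kummer functions, and positivity and decay of
  \<open>U\<close> from its Laplace-type integral.\<close>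

section \<open>Kummer functions\<close>

text \<open>Partial sums are used because the resolvent equation wants a bounded continuous
  \<open>f\<close>, while the full series is only known to be O(1 + x^2). For a finite sum,
  \<open>f - g \<circ> \<phi>\<close> telescopes exactly and stays below 2, uniformly in the number
  of terms. As \<open>f\<close> is of order 1/h, a remainder h^2 g'' is of order h at best, and g''
  is not integrable against \<pi> at 0. Hence the cut at a multiple of h. The gradient bound is
  circular at first: \<open>h * L g\<close> is an increment of \<open>g\<close> over a step O(h) up
  to a bounded term, so L g is controlled by g', and g' by interpolation between \<open>g\<close>
  and L g. A short interpolation length makes the loop contract. The expansion first appears with
  \<pi>_h(\<eta>) in the coefficient of the logarithm. Exchanging it for \<pi>(\<eta>) costs (h |log
  h|)^2, which is O(h). With k = K_star h |log h| at most 1, \<pi> + k (\<delta>_0 - \<pi>) is a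
  positive measure, so the total variation in question is that of a difference of two finite
  measures and Hahn decomposition applies.\<close>

lemma fps_conv_radius_hypergeo:
  fixes a b :: real
  assumes "a > 0" "b > 0"
  shows "fps_conv_radius (fps_hypergeo [a] [b] 1) = \<infinity>"
proof -
  define f where "f = fps_nth (fps_hypergeo [a] [b] (1::real))"
  have pos: "f n > 0" for n
    using assms unfolding f_def by (auto simp: intro!: divide_pos_pos mult_pos_pos pochhammer_pos)
  have rec: "f (Suc n) = (a + n) / ((b + n) * (Suc n)) * f n" for n
    unfolding f_def by (subst fps_hypergeo_rec) (simp add: mult.commute)
  have "norm (f n) / norm (f (Suc n)) = (b + n) * (Suc n) / (a + n)" for n
    using pos[of n] pos[of "Suc n"] unfolding rec using assms by (simp add: abs_mult divide_simps)
  moreover have "filterlim (\<lambda>n. (b + real n) * (Suc n) / (a + n)) at_top sequentially"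
    by real_asymp
  ultimately have "(\<lambda>n. ereal (norm (f n) / norm (f (Suc n)))) \<longlonglongrightarrow> \<infinity>"
    by (simp add: tendsto_PInfty_eq_at_top)
  then have "conv_radius f = \<infinity>"
    by (intro conv_radius_ratio_limit_ereal_nonzero) auto
  then show ?thesis by (simp add: fps_conv_radius_def f_def[abs_def])
qed

definition kummer_M' :: "real \<Rightarrow> real \<Rightarrow> real \<Rightarrow> real" where
  "kummer_M' a b = eval_fps (fps_deriv (fps_hypergeo [a] [b] 1))"

lemma kummer_M_deriv:
  assumes "a > 0" "b > 0"
  shows "(kummer_M a b has_real_derivative kummer_M' a b z) (at z within A)"
  unfolding kummer_M_def[abs_def] kummer_M'_def
  by (rule has_field_derivative_eval_fps) (simp add: fps_conv_radius_hypergeo[OF assms])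

text \<open>Kummer's equation at the level of formal power series: comparing coefficients reduces it
  to the two-term recurrence of the hypergeometric series.\<close>

lemma fps_hypergeo_ode:
  fixes a b :: real
  assumes "b > 0"
  defines "f \<equiv> fps_hypergeo [a] [b] 1"
  shows "fps_X * fps_deriv (fps_deriv f) = fps_const a * f + (fps_X - fps_const b) * fps_deriv f"
proof (rule fps_ext)
  fix n
  have rec: "fps_nth f (Suc n) = (a + n) / ((b + n) * (Suc n)) * fps_nth f n" for n
    unfolding f_def by (subst fps_hypergeo_rec) (simp add: mult.commute)
  show "fps_nth (fps_X * fps_deriv (fps_deriv f)) n =
    fps_nth (fps_const a * f + (fps_X - fps_const b) * fps_deriv f) n"
  proof (cases n)
    case 0
    then show ?thesis using rec[of 0] assms by (simp add: left_diff_distrib)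
  next
    case (Suc m)
    have "(b + n) * (Suc n) * fps_nth f (Suc n) = (a + n) * fps_nth f n"
      using assms(1) by (simp add: rec[of n] del: of_nat_Suc fps_hypergeo_nth)
    then show ?thesis using Suc
      by (simp add: left_diff_distrib algebra_simps)
  qed
qed

text \<open>The second derivative stays existential and multiplied by \<open>z\<close>, so that the
  singular point z = 0 of the equation needs no separate treatment.\<close>

lemma kummer_M'_deriv:
  assumes "a > 0" "b > 0"
  shows "\<exists>D. (kummer_M' a b has_real_derivative D) (at z within A) \<and>
           z * D = a * kummer_M a b z + (z - b) * kummer_M' a b z"
proof -
  let ?f = "fps_hypergeo [a] [b] (1::real)"
  have r: "fps_conv_radius ?f = \<infinity>" using assms by (rule fps_conv_radius_hypergeo)
  have r1: "fps_conv_radius (fps_deriv ?f) = \<infinity>"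
    using fps_conv_radius_deriv[of ?f] r by (metis ereal_infty_less_eq(1))
  have r2: "fps_conv_radius (fps_deriv (fps_deriv ?f)) = \<infinity>"
    using fps_conv_radius_deriv[of "fps_deriv ?f"] r1 by (metis ereal_infty_less_eq(1))
  have r3: "fps_conv_radius (fps_X - fps_const b) = \<infinity>"
    using fps_conv_radius_diff[of "fps_X" "fps_const b"] by simp
  have r4: "fps_conv_radius (fps_const a * ?f) = \<infinity>"
    using fps_conv_radius_mult[of "fps_const a" ?f] r by simp
  have r5: "fps_conv_radius ((fps_X - fps_const b) * fps_deriv ?f) = \<infinity>"
    using fps_conv_radius_mult[of "(fps_X - fps_const b)" "fps_deriv ?f"] r1 r3 by simp
  have "eval_fps (fps_X * fps_deriv (fps_deriv ?f)) z
     = eval_fps (fps_const a * ?f + (fps_X - fps_const b) * fps_deriv ?f) z"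
    using fps_hypergeo_ode[OF assms(2), of a] by simp
  then have "z * eval_fps (fps_deriv (fps_deriv ?f)) z = a * kummer_M a b z + (z - b) * kummer_M' a b z"
    using r r1 r2 r3 r4 r5
    by (simp add: eval_fps_mult eval_fps_add eval_fps_diff kummer_M_def kummer_M'_def)
  moreover have "(kummer_M' a b has_real_derivative eval_fps (fps_deriv (fps_deriv ?f)) z) (at z within A)"
    unfolding kummer_M'_def by (rule has_field_derivative_eval_fps) (simp add: r1)
  ultimately show ?thesis by blast
qed

lemma kummer_M_0 [simp]: "kummer_M a b 0 = 1"
  by (simp add: kummer_M_def eval_fps_at_0)

lemma kummer_M'_nonneg:
  assumes "a > 0" "b > 0" "z \<ge> 0"
  shows "kummer_M' a b z \<ge> 0"
  unfolding kummer_M'_def eval_fps_def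
proof (rule suminf_nonneg)
  have "fps_conv_radius (fps_deriv (fps_hypergeo [a] [b] (1::real))) = \<infinity>"
    using fps_conv_radius_deriv[of "fps_hypergeo [a] [b] (1::real)"] fps_conv_radius_hypergeo[OF assms(1,2)]
    by (metis ereal_infty_less_eq(1))
  then show "summable (\<lambda>n. fps_nth (fps_deriv (fps_hypergeo [a] [b] (1::real))) n * z ^ n)"
    by (intro summable_fps) auto
  show "0 \<le> fps_nth (fps_deriv (fps_hypergeo [a] [b] (1::real))) n * z ^ n" for n
    using assms by (auto intro!: mult_nonneg_nonneg divide_nonneg_nonneg less_imp_le[OF pochhammer_pos])
qed

lemma kummer_M_mono:
  assumes "a > 0" "b > 0" "0 \<le> x" "x \<le> y"
  shows "kummer_M a b x \<le> kummer_M a b y"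
  by (rule DERIV_nonneg_imp_nondecreasing[OF assms(4)])
     (use assms kummer_M_deriv[of a b] kummer_M'_nonneg[of a b] in \<open>metis order_trans\<close>)

lemma kummer_M_ge_1:
  assumes "a > 0" "b > 0" "0 \<le> x"
  shows "kummer_M a b x \<ge> 1"
  using kummer_M_mono[OF assms(1,2) _ assms(3)] by simp

text \<open>Kummer's equation \<open>z w'' + (b - z) w' = a w\<close> on the positive half line, as a first-order
  system for \<open>w\<close> and the flux \<open>z\<^sup>b w'\<close>, which stays continuous at \<open>0\<close>.\<close>

definition kummer_system :: "real \<Rightarrow> real \<Rightarrow> (real \<Rightarrow> real) \<Rightarrow> (real \<Rightarrow> real) \<Rightarrow> bool" where
  "kummer_system a b w \<Phi> \<longleftrightarrow> (\<forall>z>0. (w has_real_derivative z powr (- b) * \<Phi> z) (at z) \<and>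
     (\<Phi> has_real_derivative \<Phi> z + a * z powr (b - 1) * w z) (at z))"

lemma kummer_system_linear:
  assumes "kummer_system a b w \<Phi>" "kummer_system a b v \<Psi>"
  shows "kummer_system a b (\<lambda>z. s * w z + t * v z) (\<lambda>z. s * \<Phi> z + t * \<Psi> z)"
  using assms unfolding kummer_system_def
  by (auto intro!: derivative_eq_intros simp: algebra_simps)

text \<open>Abel's identity. When the two products are differentiated, the terms in w v and in
  \<Phi> \<Psi> cancel by symmetry; what is left is the expression itself, and the factor exp(-z)
  removes it.\<close>

lemma kummer_wronskian_constant:
  assumes "kummer_system a b w \<Phi>" "kummer_system a b v \<Psi>"
  shows "\<exists>C. \<forall>z>0. exp (- z) * (\<Phi> z * v z - \<Psi> z * w z) = C"
proof -
  have "((\<lambda>z. exp (- z) * (\<Phi> z * v z - \<Psi> z * w z)) has_real_derivative 0) (at z within {0<..})"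
    if "z > 0" for z
    by (rule has_field_derivative_at_within)
       (use assms that in \<open>auto simp: kummer_system_def algebra_simps intro!: derivative_eq_intros\<close>)
  then show ?thesis
    using has_field_derivative_zero_constant[of "{0<..}" "\<lambda>z. exp (- z) * (\<Phi> z * v z - \<Psi> z * w z)"]
    by auto
qed

lemma powr_Suc_exponent: "(z::real) > 0 \<Longrightarrow> z powr b = z * z powr (b - 1)"
  by (simp add: powr_diff)

lemma kummer_system_M:
  assumes "a > 0" "b > 0"
  shows "kummer_system a b (kummer_M a b) (\<lambda>z. z powr b * kummer_M' a b z)"
  unfolding kummer_system_def
proof (intro allI impI conjI)
  fix z :: real assume z: "z > 0"
  show "(kummer_M a b has_real_derivative z powr - b * (z powr b * kummer_M' a b z)) (at z)"
    using kummer_M_deriv[OF assms, of z UNIV] z by (simp add: mult.assoc[symmetric] powr_add[symmetric])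
  obtain D where D: "(kummer_M' a b has_real_derivative D) (at z)"
    "z * D = a * kummer_M a b z + (z - b) * kummer_M' a b z"
    using kummer_M'_deriv[OF assms, of z UNIV] by auto
  have "((\<lambda>z. z powr b * kummer_M' a b z) has_real_derivative
     z powr b * D + b * z powr (b - 1) * kummer_M' a b z) (at z)"
    using z D(1) by (auto intro!: derivative_eq_intros)
  also have "z powr b * D = z powr (b - 1) * (z * D)"
    using z powr_Suc_exponent[of z b] by simp
  also have "\<dots> + b * z powr (b - 1) * kummer_M' a b z
     = z powr b * kummer_M' a b z + a * z powr (b - 1) * kummer_M a b z"
    unfolding D(2) using powr_Suc_exponent[OF z, of b] by (simp add: algebra_simps)
  finally show "((\<lambda>z. z powr b * kummer_M' a b z) has_real_derivative
     z powr b * kummer_M' a b z + a * z powr (b - 1) * kummer_M a b z) (at z)" .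
qed

text \<open>The second solution at 0, with exponent 1 - b. Its flux tends to 1 - b and not to 0;
  through it U carries a nonzero flux at the origin, which the boundary condition of the sticky
  process relies on.\<close>

lemma kummer_system_M_conjugate:
  assumes "1 + a - b > 0" "b < 1"
  shows "kummer_system a b (\<lambda>z. z powr (1 - b) * kummer_M (1 + a - b) (2 - b) z)
    (\<lambda>z. (1 - b) * kummer_M (1 + a - b) (2 - b) z + z * kummer_M' (1 + a - b) (2 - b) z)"
    (is "kummer_system a b ?w ?\<Phi>")
  unfolding kummer_system_def
proof (intro allI impI conjI)
  fix z :: real assume z: "z > 0"
  let ?M = "kummer_M (1 + a - b) (2 - b)" and ?M' = "kummer_M' (1 + a - b) (2 - b)"
  have p: "1 + a - b > 0" "2 - b > 0" using assms by auto
  note DM = kummer_M_deriv[OF p, of z UNIV]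
  have "(?w has_real_derivative z powr (1 - b) * ?M' z + (1 - b) * z powr (- b) * ?M z) (at z)"
    using z DM by (auto intro!: derivative_eq_intros)
  then show "(?w has_real_derivative z powr (- b) * ?\<Phi> z) (at z)"
    using powr_Suc_exponent[OF z, of "1 - b"] by (simp add: algebra_simps)
  obtain D where D: "(?M' has_real_derivative D) (at z)"
    "z * D = (1 + a - b) * ?M z + (z - (2 - b)) * ?M' z"
    using kummer_M'_deriv[OF p, of z UNIV] by auto
  have "(?\<Phi> has_real_derivative (1 - b) * ?M' z + ?M' z + z * D) (at z)"
    using z D(1) DM by (auto intro!: derivative_eq_intros)
  also have "(1 - b) * ?M' z + ?M' z + z * D = ?\<Phi> z + a * ?M z"
    unfolding D(2) by (simp add: algebra_simps)
  also have "a * ?M z = a * z powr (b - 1) * ?w z"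
    using z by (simp add: mult.assoc[symmetric] powr_add[symmetric])
  finally show "(?\<Phi> has_real_derivative ?\<Phi> z + a * z powr (b - 1) * ?w z) (at z)" .
qed

section \<open>The Laplace-type integral for U\<close>

lemma FTC_positive_half_line:
  fixes f F :: "real \<Rightarrow> real"
  assumes F: "\<And>x. x > 0 \<Longrightarrow> (F has_real_derivative f x) (at x)"
    and f: "\<And>x. x > 0 \<Longrightarrow> isCont f x"
    and int: "set_integrable lborel {0<..} f"
    and A: "(F \<longlongrightarrow> A) (at_right 0)" and B: "(F \<longlongrightarrow> B) at_top"
  shows "(LBINT x:{0<..}. f x) = B - A"
proof -
  have e: "einterval 0 \<infinity> = {0<..}" by (auto simp: einterval_def)
  have "(LBINT x=0..\<infinity>. f x) = B - A"
  proof (rule interval_integral_FTC_integrable)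
    show "((F \<circ> real_of_ereal) \<longlongrightarrow> A) (at_right 0)"
      using A by (simp add: zero_ereal_def ereal_tendsto_simps)
    show "((F \<circ> real_of_ereal) \<longlongrightarrow> B) (at_left \<infinity>)"
      using B by (simp add: ereal_tendsto_simps)
  qed (use assms e in \<open>auto simp: has_real_derivative_iff_has_vector_derivative[symmetric]\<close>)
  then show ?thesis by (simp add: interval_lebesgue_integral_def e)
qed

lemma nn_integral_Gamma_scaled:
  fixes s z :: real
  assumes "s > 0" "z > 0"
  shows "(\<integral>\<^sup>+t. ennreal (indicator {0<..} t * (t powr (s - 1) * exp (- (z * t)))) \<partial>lborel)
    = ennreal (Gamma s * z powr (- s))"
proof -
  let ?f = "\<lambda>t::real. ennreal (indicator {0..} t * t powr (s - 1) / exp t)"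
  have "ennreal (Gamma s) = (\<integral>\<^sup>+t. ?f t \<partial>lborel)"
    by (rule Gamma_conv_nn_integral_real[OF assms(1)])
  also have "\<dots> = \<bar>z\<bar> * (\<integral>\<^sup>+t. ?f (0 + z * t) \<partial>lborel)"
    using assms by (intro nn_integral_real_affine) auto
  also have "(\<integral>\<^sup>+t. ?f (0 + z * t) \<partial>lborel) =
     (\<integral>\<^sup>+t. ennreal (z powr (s - 1)) * ennreal (indicator {0<..} t * (t powr (s - 1) * exp (- (z * t)))) \<partial>lborel)"
    using assms by (intro nn_integral_cong)
      (auto simp: indicator_def zero_le_mult_iff powr_mult exp_minus field_simps ennreal_mult[symmetric])
  also have "\<bar>z\<bar> * \<dots> = ennreal (z powr s) *
     (\<integral>\<^sup>+t. ennreal (indicator {0<..} t * (t powr (s - 1) * exp (- (z * t)))) \<partial>lborel)"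
    using assms powr_Suc_exponent[of z s]
    by (subst nn_integral_cmult) (auto simp: ennreal_mult' mult.assoc)
  finally have "ennreal (z powr (-s)) * ennreal (Gamma s) = ennreal (z powr (-s)) * (ennreal (z powr s) *
     (\<integral>\<^sup>+t. ennreal (indicator {0<..} t * (t powr (s - 1) * exp (- (z * t)))) \<partial>lborel))" by simp
  also have "\<dots> = (\<integral>\<^sup>+t. ennreal (indicator {0<..} t * (t powr (s - 1) * exp (- (z * t)))) \<partial>lborel)"
    using assms by (simp add: mult.assoc[symmetric] ennreal_mult'[symmetric] powr_add[symmetric])
  finally show ?thesis using assms by (simp add: ennreal_mult'[symmetric] mult.commute)
qed

lemma Gamma_integral_scaled:
  fixes s z :: real
  assumes "s > 0" "z > 0"
  shows "set_integrable lborel {0<..} (\<lambda>t. t powr (s - 1) * exp (- (z * t)))"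
    and "(LBINT t:{0<..}. t powr (s - 1) * exp (- (z * t))) = Gamma s * z powr (- s)"
proof -
  have "has_bochner_integral lborel (\<lambda>t. indicator {0<..} t * (t powr (s - 1) * exp (- (z * t))))
     (Gamma s * z powr (- s))"
  proof (rule has_bochner_integral_nn_integral)
    show "(\<integral>\<^sup>+t. ennreal (indicator {0<..} t * (t powr (s - 1) * exp (- (z * t)))) \<partial>lborel)
      = ennreal (Gamma s * z powr (- s))" by (rule nn_integral_Gamma_scaled[OF assms])
  qed (use assms in \<open>auto simp: intro!: less_imp_le[OF Gamma_real_pos]\<close>)
  then show "set_integrable lborel {0<..} (\<lambda>t. t powr (s - 1) * exp (- (z * t)))"
    "(LBINT t:{0<..}. t powr (s - 1) * exp (- (z * t))) = Gamma s * z powr (- s)"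
    unfolding set_integrable_def set_lebesgue_integral_def
    by (auto simp: has_bochner_integral_iff)
qed

text \<open>For \<open>k = 0\<close> this is Gamma(a) U(a,b,z), as
  \<open>kummer_U_integral_representation\<close> will show; the extra power of \<open>t\<close>
  records \<open>k\<close> differentiations under the integral sign, up to the sign (-1)^k.\<close>

definition kummer_J :: "real \<Rightarrow> real \<Rightarrow> real \<Rightarrow> real \<Rightarrow> real" where
  "kummer_J k a b z = (LBINT t:{0<..}. exp (- (z * t)) * (t powr (a - 1 + k) * (1 + t) powr (b - a - 1)))"

lemma kummer_J_integrable:
  fixes a b k z :: real
  assumes "a + k > 0" "b \<le> a + 1" "z > 0"
  shows "set_integrable lborel {0<..} (\<lambda>t. exp (- (z * t)) * (t powr (a - 1 + k) * (1 + t) powr (b - a - 1)))"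
proof (rule set_integrable_bound)
  show "set_integrable lborel {0<..} (\<lambda>t. t powr (a + k - 1) * exp (- (z * t)))"
    using Gamma_integral_scaled(1)[of "a + k" z] assms by simp
  show "AE t in lborel. t \<in> {0<..} \<longrightarrow> norm (exp (- (z * t)) * (t powr (a - 1 + k) * (1 + t) powr (b - a - 1)))
     \<le> norm (t powr (a + k - 1) * exp (- (z * t)))"
  proof (intro AE_I2 impI)
    fix t :: real assume t: "t \<in> {0<..}"
    have "(1 + t) powr (b - a - 1) \<le> (1 + t) powr 0" using t assms by (intro powr_mono) auto
    then have "(1 + t) powr (b - a - 1) \<le> 1" using t by simp
    then show "norm (exp (- (z * t)) * (t powr (a - 1 + k) * (1 + t) powr (b - a - 1)))
     \<le> norm (t powr (a + k - 1) * exp (- (z * t)))"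
      by (auto simp: abs_mult field_simps intro!: mult_left_le)
  qed
qed (auto simp: set_borel_measurable_def)

lemma exp_second_order_bound:
  fixes u :: real
  shows "\<bar>exp u - 1 - u\<bar> \<le> u\<^sup>2 / 2 * exp \<bar>u\<bar>"
proof -
  obtain t where t: "\<bar>t\<bar> \<le> \<bar>u\<bar>" "exp u = (\<Sum>m<2. u ^ m / fact m) + exp t / fact 2 * u ^ 2"
    using Maclaurin_exp_le[of u 2] by auto
  then have "exp u - 1 - u = u\<^sup>2 / 2 * exp t" by (simp add: numeral_2_eq_2)
  moreover have "u\<^sup>2 / 2 * exp t \<le> u\<^sup>2 / 2 * exp \<bar>u\<bar>" using t(1) by (intro mult_left_mono) auto
  moreover have "u\<^sup>2 / 2 * exp t \<ge> 0" by simp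
  ultimately show ?thesis by linarith
qed

text \<open>Serves to differentiate under the integral sign: integrating a second-order remainder of
  the integrand yields a bound of exactly this shape.\<close>

lemma has_real_derivative_quadratic_remainder:
  fixes f :: "real \<Rightarrow> real"
  assumes "r > 0" and bound: "\<And>y. \<bar>y - z\<bar> < r \<Longrightarrow> \<bar>f y - f z - D * (y - z)\<bar> \<le> C * (y - z)\<^sup>2"
  shows "(f has_real_derivative D) (at z)"
  unfolding has_field_derivative_iff
proof (rule LIM_zero_cancel, rule Lim_null_comparison)
  show "\<forall>\<^sub>F y in at z. norm ((f y - f z) / (y - z) - D) \<le> C * \<bar>y - z\<bar>"
    unfolding eventually_at
  proof (intro exI[of _ r] conjI ballI impI)
    fix y assume y: "y \<noteq> z \<and> dist y z < r"
    have "norm ((f y - f z) / (y - z) - D) = \<bar>f y - f z - D * (y - z)\<bar> / \<bar>y - z\<bar>"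
    proof -
      have "(f y - f z) / (y - z) - D = (f y - f z - D * (y - z)) / (y - z)"
        using y by (simp add: diff_divide_distrib)
      then show ?thesis by (simp add: abs_divide)
    qed
    also have "\<dots> \<le> C * (y - z)\<^sup>2 / \<bar>y - z\<bar>"
      using y bound[of y] by (intro divide_right_mono) (auto simp: dist_real_def)
    also have "(y - z)\<^sup>2 = \<bar>y - z\<bar> * \<bar>y - z\<bar>" by (simp add: power2_eq_square)
    also have "C * (\<bar>y - z\<bar> * \<bar>y - z\<bar>) / \<bar>y - z\<bar> = C * \<bar>y - z\<bar>"
      using y by (simp del: abs_mult_self_eq)
    finally show "norm ((f y - f z) / (y - z) - D) \<le> C * \<bar>y - z\<bar>" .
  qed (use assms in auto)
  have "((\<lambda>y. C * \<bar>y - z\<bar>) \<longlongrightarrow> C * \<bar>z - z\<bar>) (at z)" by (intro tendsto_intros)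
  then show "((\<lambda>y. C * \<bar>y - z\<bar>) \<longlongrightarrow> 0) (at z)" by simp
qed

text \<open>The exponential is expanded to second order in y - z. The linear term brings down one
  power of \<open>t\<close>, the remainder two, and the latter is again an integral of the same
  family.\<close>

lemma kummer_J_deriv:
  assumes "a + k > 0" "b \<le> a + 1" "z > 0"
  shows "(kummer_J k a b has_real_derivative - kummer_J (k + 1) a b z) (at z)"
proof (rule has_real_derivative_quadratic_remainder)
  define v where "v k t = t powr (a - 1 + k) * (1 + t) powr (b - a - 1)" for k t :: real
  have J: "kummer_J k a b z = (LBINT t:{0<..}. exp (- (z * t)) * v k t)" for k z
    by (simp add: kummer_J_def v_def)
  have int: "set_integrable lborel {0<..} (\<lambda>t. exp (- (y * t)) * v (k + j) t)" if "y > 0" "j \<ge> 0" for y j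
    using kummer_J_integrable[of a "k + j" b y] assms that by (simp add: v_def)
  have v1: "v (k + 1) t = t * v k t" and v2: "v (k + 2) t = t\<^sup>2 * v k t" and v0: "v k t \<ge> 0" if "t > 0" for t
    using that powr_Suc_exponent[of t "a - 1 + (k + 1)"] powr_Suc_exponent[of t "a - 1 + (k + 2)"]
    by (simp_all add: v_def power2_eq_square algebra_simps)
  show "z / 2 > 0" using assms by simp
  fix y assume y: "\<bar>y - z\<bar> < z / 2"
  then have y0: "y > 0" "z / 2 > 0" by (auto simp: abs_if split: if_splits)
  let ?e = "\<lambda>t. exp (- (y * t)) * v k t - exp (- (z * t)) * v k t + (y - z) * (exp (- (z * t)) * v (k + 1) t)"
  let ?b = "\<lambda>t. (y - z)\<^sup>2 / 2 * (exp (- (z / 2 * t)) * v (k + 2) t)"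
  have ib: "set_integrable lborel {0<..} ?b"
    using int[of "z / 2" 2] y0 by auto
  have ie: "set_integrable lborel {0<..} ?e"
    using int[of y 0] int[of z 0] int[of z 1] y0 assms by auto
  have pw: "\<bar>?e t\<bar> \<le> ?b t" if t: "t > 0" for t
  proof -
    have "?e t = exp (- (z * t)) * v k t * (exp (- ((y - z) * t)) - 1 - (- ((y - z) * t)))"
    proof -
      have "exp (- (y * t)) = exp (- (z * t)) * exp (- ((y - z) * t))"
        by (subst exp_add[symmetric]) (simp add: left_diff_distrib)
      then show ?thesis using t by (simp only: v1) (simp add: ring_distribs)
    qed
    then have "\<bar>?e t\<bar> = exp (- (z * t)) * v k t * \<bar>exp (- ((y - z) * t)) - 1 - (- ((y - z) * t))\<bar>"
      using v0[OF t] by (simp add: abs_mult)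
    also have "\<dots> \<le> exp (- (z * t)) * v k t * (((y - z) * t)\<^sup>2 / 2 * exp \<bar>(y - z) * t\<bar>)"
      using exp_second_order_bound[of "- ((y - z) * t)"] v0[OF t] by (intro mult_left_mono) auto
    also have "\<dots> = (y - z)\<^sup>2 / 2 * v (k + 2) t * (exp (- (z * t)) * exp \<bar>(y - z) * t\<bar>)"
      using t by (simp only: v2 power_mult_distrib) (simp only: mult_ac times_divide_eq_left times_divide_eq_right)
    \<comment> \<open>For |y - z| < z/2 the exponential of the increment consumes at most half of
      the decay, so the bound no longer depends on \<open>y\<close> and integrates to
      \<open>kummer_J (k + 2)\<close> at z/2.\<close>
    also have "\<dots> \<le> (y - z)\<^sup>2 / 2 * v (k + 2) t * exp (- (z / 2 * t))"
    proof (rule mult_left_mono)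
      have "\<bar>(y - z) * t\<bar> \<le> z / 2 * t" using y t by (simp add: abs_mult)
      then show "exp (- (z * t)) * exp \<bar>(y - z) * t\<bar> \<le> exp (- (z / 2 * t))"
        by (simp add: exp_add[symmetric])
      show "0 \<le> (y - z)\<^sup>2 / 2 * v (k + 2) t" using v0[OF t] t by (simp add: v2)
    qed
    finally show ?thesis by (simp add: mult.commute mult.left_commute)
  qed
  define e where "e = (\<lambda>t. ?e t)"
  define q where "q = (\<lambda>t. ?b t)"
  have i1: "set_integrable lborel {0<..} e" and i2: "set_integrable lborel {0<..} q"
    using ie ib by (simp_all only: e_def q_def)
  have eq: "\<bar>e t\<bar> \<le> q t" if "t \<in> {0<..}" for t
    using pw[of t] that by (simp only: e_def q_def greaterThan_iff)
  have "kummer_J k a b y - kummer_J k a b z - - kummer_J (k + 1) a b z * (y - z) = (LBINT t:{0<..}. e t)"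
    unfolding e_def using int[of y 0] int[of z 0] int[of z 1] y0 assms by (simp add: J mult.commute)
  also have "\<bar>\<dots>\<bar> \<le> (LBINT t:{0<..}. \<bar>e t\<bar>)"
    using set_integral_norm_bound[OF i1] by simp
  also have "\<dots> \<le> (LBINT t:{0<..}. q t)"
    by (rule set_integral_mono[OF set_integrable_abs[OF i1] i2 eq])
  also have "\<dots> = kummer_J (k + 2) a b (z / 2) / 2 * (y - z)\<^sup>2"
    unfolding q_def J using int[of "z / 2" 2] y0 by (subst set_integral_mult_right) simp
  finally show "\<bar>kummer_J k a b y - kummer_J k a b z - - kummer_J (k + 1) a b z * (y - z)\<bar>
    \<le> kummer_J (k + 2) a b (z / 2) / 2 * (y - z)\<^sup>2" .
qed

text \<open>Integration by parts: the difference of the two sides is the integral of the derivative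
  of exp(-zt) t^a (1+t)^(b-a), which vanishes at both ends.\<close>

lemma kummer_J_recurrence:
  assumes "a > 0" "b \<le> a + 1" "z > 0"
  shows "z * kummer_J 2 a b z + z * kummer_J 1 a b z = a * kummer_J 0 a b z + b * kummer_J 1 a b z"
proof -
  let ?w = "\<lambda>k t. exp (- (z * t)) * (t powr (a - 1 + k) * (1 + t) powr (b - a - 1))"
  let ?f = "\<lambda>t. a * ?w 0 t + b * ?w 1 t - z * ?w 2 t - z * ?w 1 t"
  let ?F = "\<lambda>t. exp (- (z * t)) * (t powr a * (1 + t) powr (b - a))"
  have int: "set_integrable lborel {0<..} (?w k)" if "k \<ge> 0" for k
    using assms that by (intro kummer_J_integrable) auto
  have "(LBINT t:{0<..}. ?f t) = 0 - 0"
  proof (rule FTC_positive_half_line)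
    show "set_integrable lborel {0<..} ?f"
      using int[of 0] int[of 1] int[of 2] by (intro set_integral_diff set_integral_add set_integrable_mult_right) auto
    show "isCont ?f x" if "x > 0" for x
      using that by (intro continuous_intros) auto
    show "(?F has_real_derivative ?f t) (at t)" if t: "t > 0" for t
    proof -
      have "(?F has_real_derivative
          exp (- (z * t)) * ((a * t powr (a - 1)) * (1 + t) powr (b - a) + t powr a * ((b - a) * (1 + t) powr (b - a - 1)))
          - z * exp (- (z * t)) * (t powr a * (1 + t) powr (b - a))) (at t)"
        using t by (auto intro!: derivative_eq_intros simp: algebra_simps)
      also have "(exp (- (z * t)) * ((a * t powr (a - 1)) * (1 + t) powr (b - a) + t powr a * ((b - a) * (1 + t) powr (b - a - 1)))
          - z * exp (- (z * t)) * (t powr a * (1 + t) powr (b - a))) = ?f t"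
      proof -
        have e: "t powr (1 + a) = t * (t * t powr (a - 1))" "t powr a = t * t powr (a - 1)"
          "(1 + t) powr (b - a) = (1 + t) * (1 + t) powr (b - a - 1)"
          using t powr_Suc_exponent[of t a] powr_Suc_exponent[of t "1 + a"] powr_Suc_exponent[of "1 + t" "b - a"]
          by simp_all
        show ?thesis by (simp add: e add.commute[of a]) (simp add: algebra_simps)
      qed
      finally show ?thesis .
    qed
    have "((\<lambda>t. exp (- (z * t)) * (t powr a * (1 + t) powr (b - a))) \<longlongrightarrow> exp (- (z * 0)) * (0 powr a * (1 + 0) powr (b - a))) (at_right 0)"
      using assms by (intro tendsto_intros) (auto simp: eventually_at_filter)
    then show "(?F \<longlongrightarrow> 0) (at_right 0)" by simp
    show "(?F \<longlongrightarrow> 0) at_top" using assms by real_asymp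
  qed
  moreover have "(LBINT t:{0<..}. ?f t) = a * kummer_J 0 a b z + b * kummer_J 1 a b z - z * kummer_J 2 a b z - z * kummer_J 1 a b z"
    unfolding kummer_J_def using int[of 0] int[of 1] int[of 2] by simp
  ultimately show ?thesis by simp
qed

lemma kummer_system_J:
  assumes "a > 0" "b \<le> a + 1"
  shows "kummer_system a b (kummer_J 0 a b) (\<lambda>z. - (z powr b * kummer_J 1 a b z))"
  unfolding kummer_system_def
proof (intro allI impI conjI)
  fix z :: real assume z: "z > 0"
  show "(kummer_J 0 a b has_real_derivative z powr - b * - (z powr b * kummer_J 1 a b z)) (at z)"
    using kummer_J_deriv[of a 0 b z] assms z by (simp add: mult.assoc[symmetric] powr_add[symmetric])
  have "((\<lambda>z. - (z powr b * kummer_J 1 a b z)) has_real_derivative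
      z powr b * kummer_J 2 a b z - b * z powr (b - 1) * kummer_J 1 a b z) (at z)"
    using z kummer_J_deriv[of a 1 b z] assms by (auto intro!: derivative_eq_intros)
  also have "z powr b * kummer_J 2 a b z - b * z powr (b - 1) * kummer_J 1 a b z
     = z powr (b - 1) * (z * kummer_J 2 a b z - b * kummer_J 1 a b z)"
    by (simp add: powr_Suc_exponent[OF z, of b] algebra_simps)
  also have "z * kummer_J 2 a b z - b * kummer_J 1 a b z = a * kummer_J 0 a b z - z * kummer_J 1 a b z"
    using kummer_J_recurrence[OF assms z] by simp
  also have "z powr (b - 1) * \<dots> = - (z powr b * kummer_J 1 a b z) + a * z powr (b - 1) * kummer_J 0 a b z"
    by (simp add: powr_Suc_exponent[OF z, of b] algebra_simps)
  finally show "((\<lambda>z. - (z powr b * kummer_J 1 a b z)) has_real_derivative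
     - (z powr b * kummer_J 1 a b z) + a * z powr (b - 1) * kummer_J 0 a b z) (at z)" .
qed

lemma kummer_J_nonneg: "kummer_J k a b z \<ge> 0"
  unfolding kummer_J_def set_lebesgue_integral_def by (auto intro!: integral_nonneg)

text \<open>A Beta integral. With s = 1 + a - b, the factor Gamma(s) (1+t)^(-s) is itself a Gamma
  integral in a second variable \<open>u\<close>; after exchanging the integrations, the one over
  \<open>t\<close> is a Gamma integral too, and a third one in \<open>u\<close> remains. Tonelli
  gives integrability along with the value.\<close>

lemma kummer_J_at_0:
  fixes a b :: real
  assumes "a > 0" "b < 1"
  shows "set_integrable lborel {0<..} (\<lambda>t. t powr (a - 1) * (1 + t) powr (b - a - 1))"
    and "kummer_J 0 a b 0 = Gamma a * Gamma (1 - b) / Gamma (1 + a - b)"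
proof -
  define s where "s = 1 + a - b"
  have s: "s > 0" using assms by (simp add: s_def)
  have G: "Gamma s > 0" "Gamma a > 0" "Gamma (1 - b) > 0" using s assms by (auto intro: Gamma_real_pos)
  let ?i = "indicator {0<..} :: real \<Rightarrow> real"
  let ?f = "\<lambda>t::real. ?i t * (t powr (a - 1) * (1 + t) powr (b - a - 1))"
  let ?h = "\<lambda>u t::real. ennreal (?i t * t powr (a - 1)) * ennreal (?i u * (u powr (s - 1) * exp (- ((1 + t) * u))))"
  have "(\<integral>\<^sup>+t. ennreal (Gamma s) * ennreal (?f t) \<partial>lborel) = (\<integral>\<^sup>+t. (\<integral>\<^sup>+u. ?h u t \<partial>lborel) \<partial>lborel)"
  proof (rule nn_integral_cong)
    fix t :: real
    show "ennreal (Gamma s) * ennreal (?f t) = (\<integral>\<^sup>+u. ?h u t \<partial>lborel)"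
    proof (cases "t > 0")
      case True
      then have "(\<integral>\<^sup>+u. ?h u t \<partial>lborel) = ennreal (?i t * t powr (a - 1)) * ennreal (Gamma s * (1 + t) powr (- s))"
        by (subst nn_integral_cmult) (auto simp: nn_integral_Gamma_scaled s)
      then show ?thesis using True G by (simp add: s_def ennreal_mult'[symmetric] algebra_simps)
    qed simp
  qed
  also have "\<dots> = (\<integral>\<^sup>+u. (\<integral>\<^sup>+t. ?h u t \<partial>lborel) \<partial>lborel)"
    by (rule lborel_pair.Fubini') measurable
  also have "\<dots> = (\<integral>\<^sup>+u. ennreal (Gamma a) * ennreal (?i u * (u powr ((1 - b) - 1) * exp (- (1 * u)))) \<partial>lborel)"
  proof (rule nn_integral_cong)
    fix u :: real
    show "(\<integral>\<^sup>+t. ?h u t \<partial>lborel) = ennreal (Gamma a) * ennreal (?i u * (u powr ((1 - b) - 1) * exp (- (1 * u))))"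
    proof (cases "u > 0")
      case True
      have "(\<integral>\<^sup>+t. ?h u t \<partial>lborel) = (\<integral>\<^sup>+t. ennreal (u powr (s - 1) * exp (- u)) *
          ennreal (?i t * (t powr (a - 1) * exp (- (u * t)))) \<partial>lborel)"
        using True by (intro nn_integral_cong)
          (auto simp: ennreal_mult'[symmetric] exp_add[symmetric] algebra_simps indicator_def)
      also have "\<dots> = ennreal (u powr (s - 1) * exp (- u)) * ennreal (Gamma a * u powr (- a))"
        using True by (subst nn_integral_cmult) (auto simp: nn_integral_Gamma_scaled assms)
      also have "\<dots> = ennreal (Gamma a * (exp (- u) * (u powr (s - 1) * u powr (- a))))"
        using G by (simp add: ennreal_mult'[symmetric] mult_ac)
      also have "u powr (s - 1) * u powr (- a) = u powr ((1 - b) - 1)"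
        using True by (simp add: powr_add[symmetric] s_def)
      finally show ?thesis using True G by (simp add: ennreal_mult'[symmetric] mult_ac)
    qed simp
  qed
  also have "\<dots> = ennreal (Gamma a) * ennreal (Gamma (1 - b))"
    using assms by (subst nn_integral_cmult) (auto simp only: nn_integral_Gamma_scaled, auto)
  also have "(\<integral>\<^sup>+t. ennreal (Gamma s) * ennreal (?f t) \<partial>lborel) = ennreal (Gamma s) * (\<integral>\<^sup>+t. ennreal (?f t) \<partial>lborel)"
    by (rule nn_integral_cmult) auto
  finally have "ennreal (1 / Gamma s) * (ennreal (Gamma s) * (\<integral>\<^sup>+t. ennreal (?f t) \<partial>lborel))
    = ennreal (1 / Gamma s) * (ennreal (Gamma a) * ennreal (Gamma (1 - b)))" by simp
  then have "(\<integral>\<^sup>+t. ennreal (?f t) \<partial>lborel) = ennreal (Gamma a * Gamma (1 - b) / Gamma s)"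
    using G by (simp add: mult.assoc[symmetric] ennreal_mult'[symmetric])
  then have "has_bochner_integral lborel ?f (Gamma a * Gamma (1 - b) / Gamma s)"
    using G by (intro has_bochner_integral_nn_integral) auto
  then show "set_integrable lborel {0<..} (\<lambda>t. t powr (a - 1) * (1 + t) powr (b - a - 1))"
    "kummer_J 0 a b 0 = Gamma a * Gamma (1 - b) / Gamma (1 + a - b)"
    unfolding set_integrable_def set_lebesgue_integral_def kummer_J_def
    by (auto simp: has_bochner_integral_iff s_def)
qed

text \<open>Dominated convergence, with the integrand at z = 0 as the majorant. The limit is taken
  along 1/(n+1) only, which is enough to evaluate constants of integration later.\<close>

lemma kummer_J_tendsto_at_0:
  fixes a b :: real
  assumes "a > 0" "b < 1"
  shows "(\<lambda>n. kummer_J 0 a b (1 / real (Suc n))) \<longlonglongrightarrow> Gamma a * Gamma (1 - b) / Gamma (1 + a - b)"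
proof -
  let ?w = "\<lambda>t. t powr (a - 1) * (1 + t) powr (b - a - 1)"
  have "(\<lambda>n. \<integral>t. indicator {0<..} t *\<^sub>R (exp (- (1 / real (Suc n) * t)) * ?w t) \<partial>lborel)
     \<longlonglongrightarrow> (\<integral>t. indicator {0<..} t *\<^sub>R ?w t \<partial>lborel)"
  proof (rule integral_dominated_convergence)
    show "integrable lborel (\<lambda>t. indicator {0<..} t *\<^sub>R ?w t)"
      using kummer_J_at_0(1)[OF assms] by (simp add: set_integrable_def)
    show "AE t in lborel. (\<lambda>n. indicator {0<..} t *\<^sub>R (exp (- (1 / real (Suc n) * t)) * ?w t)) \<longlonglongrightarrow> indicator {0<..} t *\<^sub>R ?w t"
    proof (intro AE_I2)
      fix t :: real
      have "(\<lambda>n. 1 / real (Suc n)) \<longlonglongrightarrow> 0" by real_asymp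
      then have "(\<lambda>n. exp (- (1 / real (Suc n) * t))) \<longlonglongrightarrow> exp (- (0 * t))" by (intro tendsto_intros)
      then have "(\<lambda>n. exp (- (1 / real (Suc n) * t))) \<longlonglongrightarrow> 1" by simp
      from tendsto_mult[OF this tendsto_const[of "?w t"]]
      have "(\<lambda>n. exp (- (1 / real (Suc n) * t)) * ?w t) \<longlonglongrightarrow> ?w t" by simp
      from tendsto_scaleR[OF tendsto_const this]
      show "(\<lambda>n. indicator {0<..} t *\<^sub>R (exp (- (1 / real (Suc n) * t)) * ?w t)) \<longlonglongrightarrow> indicator {0<..} t *\<^sub>R ?w t" .
    qed
    show "AE t in lborel. norm (indicator {0<..} t *\<^sub>R (exp (- (1 / real (Suc n) * t)) * ?w t)) \<le> indicator {0<..} t *\<^sub>R ?w t" for n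
      by (intro AE_I2) (auto simp: indicator_def abs_mult intro!: mult_right_le_one_le mult_left_le_one_le)
  qed auto
  then show ?thesis
    using kummer_J_at_0(2)[OF assms] by (simp add: kummer_J_def set_lebesgue_integral_def)
qed

text \<open>As z tends to 0 the integral \<open>kummer_J 1\<close> diverges like z^(-b). The
  substitution v = z t absorbs the factor z^b and leaves an integral that stays finite in the
  limit.\<close>

lemma kummer_J_flux:
  fixes a b z :: real
  assumes "z > 0"
  shows "z powr b * kummer_J 1 a b z = (LBINT v:{0<..}. exp (- v) * (v powr a * (z + v) powr (b - a - 1)))"
proof -
  let ?g = "\<lambda>v. indicator {0<..} v *\<^sub>R (exp (- v) * (v powr a * (z + v) powr (b - a - 1)))"
  have "(\<integral>v. ?g v \<partial>lborel) = \<bar>z\<bar> *\<^sub>R (\<integral>t. ?g (0 + z * t) \<partial>lborel)"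
    using assms by (intro lborel_integral_real_affine) auto
  also have "\<dots> = (\<integral>t. z *\<^sub>R ?g (0 + z * t) \<partial>lborel)" using assms by simp
  also have "\<dots> = (\<integral>t. z powr b * (indicator {0<..} t *\<^sub>R (exp (- (z * t)) * (t powr (a - 1 + 1) * (1 + t) powr (b - a - 1)))) \<partial>lborel)"
  proof (rule Bochner_Integration.integral_cong)
    fix t :: real
    show "z *\<^sub>R ?g (0 + z * t) = z powr b * (indicator {0<..} t *\<^sub>R (exp (- (z * t)) * (t powr (a - 1 + 1) * (1 + t) powr (b - a - 1))))"
    proof (cases "t > 0")
      case True
      have "z + z * t = z * (1 + t)" by (simp add: algebra_simps)
      then have "(z + z * t) powr (b - a - 1) = z powr (b - a - 1) * (1 + t) powr (b - a - 1)"
        using assms True by (simp add: powr_mult)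
      moreover have "z powr b = z * (z powr a * z powr (b - a - 1))"
        using assms powr_Suc_exponent[of z b] by (simp add: powr_add[symmetric])
      ultimately show ?thesis using True assms by (simp add: powr_mult zero_less_mult_iff mult_ac)
    qed (use assms in \<open>simp add: zero_less_mult_iff\<close>)
  qed simp
  finally show ?thesis by (simp add: kummer_J_def set_lebesgue_integral_def)
qed

text \<open>Uniform in \<open>z\<close>, so that a single Gamma integrand serves both for the bound
  on the flux and as the majorant for its limit at 0.\<close>

lemma kummer_flux_weight_le:
  fixes a b v z :: real
  assumes "a > 0" "b < 1" "v > 0" "z \<ge> 0"
  shows "v powr a * (z + v) powr (b - a - 1) \<le> v powr (b - 1)"
proof -
  have "(z + v) powr (b - a - 1) \<le> v powr (b - a - 1)"
    using assms by (intro powr_mono2') auto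
  then have "v powr a * (z + v) powr (b - a - 1) \<le> v powr a * v powr (b - a - 1)"
    by (intro mult_left_mono) auto
  then show ?thesis using assms by (simp add: powr_add[symmetric])
qed

lemma kummer_J_flux_le:
  fixes a b z :: real
  assumes "a > 0" "0 < b" "b < 1" "z > 0"
  shows "z powr b * kummer_J 1 a b z \<le> Gamma b"
proof -
  have G: "set_integrable lborel {0<..} (\<lambda>t. t powr (b - 1) * exp (- (1 * t)))"
    using Gamma_integral_scaled(1)[of b 1] assms by simp
  have "z powr b * kummer_J 1 a b z = (LBINT v:{0<..}. exp (- v) * (v powr a * (z + v) powr (b - a - 1)))"
    by (rule kummer_J_flux) fact
  also have "\<dots> \<le> (LBINT v:{0<..}. v powr (b - 1) * exp (- (1 * v)))"
  proof (rule set_integral_mono)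
    show "exp (- v) * (v powr a * (z + v) powr (b - a - 1)) \<le> v powr (b - 1) * exp (- (1 * v))" if "v \<in> {0<..}" for v
      using kummer_flux_weight_le[of a b v z] that assms by (simp add: mult.commute)
    then show "set_integrable lborel {0<..} (\<lambda>v. exp (- v) * (v powr a * (z + v) powr (b - a - 1)))"
      by (intro set_integrable_bound[OF G]) (auto simp: set_borel_measurable_def abs_mult)
  qed fact
  also have "\<dots> = Gamma b" using Gamma_integral_scaled(2)[of b 1] assms by simp
  finally show ?thesis .
qed

lemma kummer_J_flux_tendsto:
  fixes a b :: real
  assumes "a > 0" "0 < b" "b < 1"
  shows "(\<lambda>n. (1 / real (Suc n)) powr b * kummer_J 1 a b (1 / real (Suc n))) \<longlonglongrightarrow> Gamma b"
proof -
  let ?w = "\<lambda>z v. exp (- v) * (v powr a * (z + v) powr (b - a - 1))"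
  have "(\<lambda>n. \<integral>v. indicator {0<..} v *\<^sub>R ?w (1 / real (Suc n)) v \<partial>lborel)
     \<longlonglongrightarrow> (\<integral>v. indicator {0<..} v *\<^sub>R (v powr (b - 1) * exp (- (1 * v))) \<partial>lborel)"
  proof (rule integral_dominated_convergence)
    show "integrable lborel (\<lambda>v. indicator {0<..} v *\<^sub>R (v powr (b - 1) * exp (- (1 * v))))"
      using Gamma_integral_scaled(1)[of b 1] assms by (simp add: set_integrable_def)
    show "AE v in lborel. (\<lambda>n. indicator {0<..} v *\<^sub>R ?w (1 / real (Suc n)) v) \<longlonglongrightarrow> indicator {0<..} v *\<^sub>R (v powr (b - 1) * exp (- (1 * v)))"
    proof (intro AE_I2)
      fix v :: real
      show "(\<lambda>n. indicator {0<..} v *\<^sub>R ?w (1 / real (Suc n)) v) \<longlonglongrightarrow> indicator {0<..} v *\<^sub>R (v powr (b - 1) * exp (- (1 * v)))"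
      proof (cases "v > 0")
        case True
        have z: "(\<lambda>n. 1 / real (Suc n) + v) \<longlonglongrightarrow> 0 + v"
          by (intro tendsto_intros) real_asymp
        have "(\<lambda>n. ?w (1 / real (Suc n)) v) \<longlonglongrightarrow> ?w 0 v"
          using True by (intro tendsto_mult tendsto_const tendsto_powr[OF z]) auto
        also have "?w 0 v = v powr (b - 1) * exp (- (1 * v))"
          using True by (simp add: powr_add[symmetric])
        finally show ?thesis using True by simp
      qed simp
    qed
    show "AE v in lborel. norm (indicator {0<..} v *\<^sub>R ?w (1 / real (Suc n)) v) \<le> indicator {0<..} v *\<^sub>R (v powr (b - 1) * exp (- (1 * v)))" for n
      using kummer_flux_weight_le[of a b _ "1 / real (Suc n)"] assms
      by (intro AE_I2) (auto simp: indicator_def abs_mult mult.commute)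
  qed auto
  then have "(\<lambda>n. LBINT v:{0<..}. ?w (1 / real (Suc n)) v) \<longlonglongrightarrow> Gamma b"
    using Gamma_integral_scaled(2)[of b 1] assms by (simp add: set_lebesgue_integral_def)
  then show ?thesis by (subst kummer_J_flux) auto
qed

section \<open>The function U with its flux z^b U'(z), and their identification with the
  integrals\<close>

definition kummer_U_flux :: "real \<Rightarrow> real \<Rightarrow> real \<Rightarrow> real" where
  "kummer_U_flux a b z =
     Gamma (1 - b) / Gamma (1 + a - b) * (z powr b * kummer_M' a b z)
     + Gamma (b - 1) / Gamma a * ((1 - b) * kummer_M (1 + a - b) (2 - b) z + z * kummer_M' (1 + a - b) (2 - b) z)"

lemma kummer_system_U:
  assumes "a > 0" "0 < b" "b < 1"
  shows "kummer_system a b (kummer_U a b) (kummer_U_flux a b)"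
  using kummer_system_linear[OF kummer_system_M kummer_system_M_conjugate,
      of a b "Gamma (1 - b) / Gamma (1 + a - b)" "Gamma (b - 1) / Gamma a"] assms
  by (simp add: kummer_U_def[abs_def] kummer_U_flux_def[abs_def] mult.assoc)

lemma isCont_kummer_M:
  assumes "a > 0" "b > 0"
  shows "isCont (kummer_M a b) z" "isCont (kummer_M' a b) z"
  using kummer_M_deriv[OF assms, of z UNIV] kummer_M'_deriv[OF assms, of z UNIV]
  by (auto intro: DERIV_isCont)

lemma continuous_on_kummer_M [continuous_intros]:
  assumes "a > 0" "b > 0" "continuous_on A f"
  shows "continuous_on A (\<lambda>x. kummer_M a b (f x))" "continuous_on A (\<lambda>x. kummer_M' a b (f x))"
  using isCont_kummer_M[OF assms(1,2)]
  by (auto intro!: continuous_on_compose2[OF _ assms(3), of UNIV] continuous_at_imp_continuous_on)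

lemma continuous_on_powr_nonneg: "c > 0 \<Longrightarrow> continuous_on {0..} (\<lambda>z::real. z powr c)"
  by (intro continuous_on_powr' continuous_intros) auto

lemma continuous_on_kummer_U:
  assumes "a > 0" "0 < b" "b < 1"
  shows "continuous_on {0..} (kummer_U a b)" "continuous_on {0..} (kummer_U_flux a b)"
proof -
  have "continuous_on {0..} (\<lambda>z. s * kummer_M a b z + t * z powr (1 - b) * kummer_M (1 + a - b) (2 - b) z)" for s t
    using assms
    by (intro continuous_on_add continuous_on_mult continuous_on_const continuous_on_powr_nonneg
        continuous_on_kummer_M continuous_on_id) auto
  then show "continuous_on {0..} (kummer_U a b)" unfolding kummer_U_def[abs_def] .
  have "continuous_on {0..} (\<lambda>z. s * (z powr b * kummer_M' a b z)
      + t * ((1 - b) * kummer_M (1 + a - b) (2 - b) z + z * kummer_M' (1 + a - b) (2 - b) z))" for s t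
    using assms
    by (intro continuous_on_add continuous_on_mult continuous_on_const continuous_on_powr_nonneg
        continuous_on_kummer_M continuous_on_id) auto
  then show "continuous_on {0..} (kummer_U_flux a b)" unfolding kummer_U_flux_def[abs_def] .
qed

lemma kummer_U_flux_0:
  assumes "0 < b" "b < 1"
  shows "kummer_U_flux a b 0 = - Gamma b / Gamma a"
proof -
  have "b - 1 \<notin> \<int>\<^sub>\<le>\<^sub>0"
    using assms by (auto elim!: nonpos_Ints_cases simp: algebra_simps)
  then have "Gamma b = (b - 1) * Gamma (b - 1)"
    using Gamma_plus1[of "b - 1"] by simp
  then have "Gamma (b - 1) * (1 - b) = - Gamma b" by (simp add: algebra_simps)
  then have "Gamma (b - 1) / Gamma a * (1 - b) = - Gamma b / Gamma a"
    by (simp only: times_divide_eq_left)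
  then show ?thesis using assms by (simp add: kummer_U_flux_def)
qed

lemma tendsto_at_0_along_reciprocals:
  fixes f :: "real \<Rightarrow> real"
  assumes "continuous_on {0..} f"
  shows "(\<lambda>n. f (1 / real (Suc n))) \<longlonglongrightarrow> f 0"
proof -
  have "(f \<longlongrightarrow> f 0) (at 0 within {0..})"
    using assms by (auto simp: continuous_on)
  moreover have "filterlim (\<lambda>n. 1 / real (Suc n)) (at 0 within {0..}) sequentially"
  proof -
    have "(\<lambda>n. 1 / real (Suc n)) \<longlonglongrightarrow> 0" by real_asymp
    then show ?thesis unfolding filterlim_at by auto
  qed
  ultimately show ?thesis by (rule filterlim_compose)
qed

text \<open>Both candidates solve the same system and agree at 0 in value and flux, but 0 is a
  singular point, where uniqueness for initial values is not immediate. Instead, the Wronskian of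
  the difference \<open>D\<close> with M is constant and tends to 0, hence vanishes; so
  \<open>D\<close> divided by M is constant, and the constant is 0 because \<open>D\<close> tends to
  0. Division is safe since M is at least 1.\<close>

lemma kummer_U_integral_representation:
  fixes a b z :: real
  assumes ab: "a > 0" "0 < b" "b < 1" and z: "z > 0"
  shows "kummer_U a b z = kummer_J 0 a b z / Gamma a"
    and "kummer_U_flux a b z = - (z powr b * kummer_J 1 a b z) / Gamma a"
proof -
  define D where "D z = (1 / Gamma a) * kummer_J 0 a b z + (- 1) * kummer_U a b z" for z
  define E where "E z = (1 / Gamma a) * (- (z powr b * kummer_J 1 a b z)) + (- 1) * kummer_U_flux a b z" for z
  have G: "Gamma a > 0" using ab by (auto intro: Gamma_real_pos)
  have sys: "kummer_system a b D E"
    unfolding D_def[abs_def] E_def[abs_def] using ab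
    by (intro kummer_system_linear kummer_system_J kummer_system_U) auto
  have sysM: "kummer_system a b (kummer_M a b) (\<lambda>z. z powr b * kummer_M' a b z)"
    using ab by (intro kummer_system_M)
  let ?z = "\<lambda>n. 1 / real (Suc n)"
  have D0: "(\<lambda>n. D (?z n)) \<longlonglongrightarrow> 0"
  proof -
    have "(\<lambda>n. D (?z n)) \<longlonglongrightarrow> (1 / Gamma a) * (Gamma a * Gamma (1 - b) / Gamma (1 + a - b)) + (- 1) * kummer_U a b 0"
      unfolding D_def using ab
      by (intro tendsto_intros kummer_J_tendsto_at_0 tendsto_at_0_along_reciprocals continuous_on_kummer_U)
    then show ?thesis using G by (simp add: kummer_U_0)
  qed
  have E0: "(\<lambda>n. E (?z n)) \<longlonglongrightarrow> 0"
  proof -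
    have "(\<lambda>n. E (?z n)) \<longlonglongrightarrow> (1 / Gamma a) * (- Gamma b) + (- 1) * kummer_U_flux a b 0"
      unfolding E_def using ab
      by (intro tendsto_intros kummer_J_flux_tendsto tendsto_at_0_along_reciprocals continuous_on_kummer_U)
    then show ?thesis using ab by (simp add: kummer_U_flux_0)
  qed
  have M0: "(\<lambda>n. kummer_M a b (?z n)) \<longlonglongrightarrow> 1"
    using tendsto_at_0_along_reciprocals[of "kummer_M a b"] ab continuous_on_kummer_M[of a b "{0..}" "\<lambda>x. x"]
    by auto
  have F0: "(\<lambda>n. ?z n powr b * kummer_M' a b (?z n)) \<longlonglongrightarrow> 0"
  proof -
    have "continuous_on {0..} (\<lambda>z. z powr b * kummer_M' a b z)"
      using ab by (intro continuous_on_mult continuous_on_powr_nonneg continuous_on_kummer_M continuous_on_id)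
    from tendsto_at_0_along_reciprocals[OF this] show ?thesis by simp
  qed
  obtain C where C: "\<And>z. z > 0 \<Longrightarrow> exp (- z) * (E z * kummer_M a b z - z powr b * kummer_M' a b z * D z) = C"
    using kummer_wronskian_constant[OF sys sysM] by auto
  have e0: "(\<lambda>n. exp (- ?z n)) \<longlonglongrightarrow> 1" by real_asymp
  have "(\<lambda>n. exp (- ?z n) * (E (?z n) * kummer_M a b (?z n) - ?z n powr b * kummer_M' a b (?z n) * D (?z n)))
     \<longlonglongrightarrow> 1 * (0 * 1 - 0 * 0)"
    by (intro tendsto_mult tendsto_diff e0 E0 M0 F0 D0)
  then have "(\<lambda>n. C) \<longlonglongrightarrow> 0" by (simp add: C)
  then have "C = 0" by (simp add: LIMSEQ_const_iff)
  then have W: "E z * kummer_M a b z = z powr b * kummer_M' a b z * D z" if "z > 0" for z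
    using C[OF that] by simp
  have Mpos: "kummer_M a b z \<noteq> 0" if "z > 0" for z
    using kummer_M_ge_1[of a b z] ab that by simp
  have "((\<lambda>z. D z / kummer_M a b z) has_real_derivative 0) (at z)" if z: "z > 0" for z
  proof -
    have "((\<lambda>z. D z / kummer_M a b z) has_real_derivative
        ((z powr - b * E z) * kummer_M a b z - D z * (z powr - b * (z powr b * kummer_M' a b z)))
        / (kummer_M a b z * kummer_M a b z)) (at z)"
      using sys sysM z Mpos[OF z] unfolding kummer_system_def by (intro DERIV_divide) auto
    moreover have "(z powr - b * E z) * kummer_M a b z - D z * (z powr - b * (z powr b * kummer_M' a b z)) = 0"
      using W[OF z] by (simp add: mult_ac)
    ultimately show ?thesis by simp
  qed
  then obtain K where K: "\<And>z. z > 0 \<Longrightarrow> D z / kummer_M a b z = K"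
    using has_field_derivative_zero_constant[of "{0<..}" "\<lambda>z. D z / kummer_M a b z"]
      has_field_derivative_at_within by (metis convex_real_interval(3) greaterThan_iff)
  have "(\<lambda>n. D (?z n) / kummer_M a b (?z n)) \<longlonglongrightarrow> 0 / 1"
    by (intro tendsto_divide D0 M0) simp
  then have "K = 0" using K by (simp add: LIMSEQ_const_iff)
  then have "D z = 0" if "z > 0" for z using K[OF that] Mpos[OF that] by simp
  moreover from this W Mpos have "E z = 0" if "z > 0" for z using that by fastforce
  ultimately show "kummer_U a b z = kummer_J 0 a b z / Gamma a"
    "kummer_U_flux a b z = - (z powr b * kummer_J 1 a b z) / Gamma a"
    using z unfolding D_def E_def by (force simp: field_simps)+
qed

text \<open>In the connection formula U is a difference of two terms, because Gamma(b-1) < 0, and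
  neither sign nor size can be read off. The integral shows both; only z = 0 is taken from the
  explicit values.\<close>

lemma kummer_U_bounds:
  fixes a b z :: real
  assumes "a > 0" "0 < b" "b < 1" "z \<ge> 0"
  shows "kummer_U a b z \<ge> 0" "kummer_U_flux a b z \<le> 0" "kummer_U_flux a b z \<ge> - Gamma b / Gamma a"
proof -
  have G: "Gamma a > 0" "Gamma b > 0" "Gamma (1 - b) > 0" "Gamma (1 + a - b) > 0"
    using assms by (auto intro: Gamma_real_pos)
  have "kummer_U a b z \<ge> 0 \<and> kummer_U_flux a b z \<le> 0 \<and> kummer_U_flux a b z \<ge> - Gamma b / Gamma a"
  proof (cases "z = 0")
    case True
    then show ?thesis using G assms by (simp add: kummer_U_0 kummer_U_flux_0)
  next
    case False
    then have "z > 0" using assms by simp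
    then show ?thesis
      using G assms kummer_J_flux_le[of a b z] kummer_J_nonneg[of _ a b z]
      by (simp add: kummer_U_integral_representation divide_right_mono)
  qed
  then show "kummer_U a b z \<ge> 0" "kummer_U_flux a b z \<le> 0" "kummer_U_flux a b z \<ge> - Gamma b / Gamma a"
    by auto
qed

section \<open>Total variation\<close>

lemma nn_integral_atom_plus_density:
  assumes \<rho>: "\<rho> \<in> borel_measurable half_line" and f: "f \<in> borel_measurable half_line"
  shows "(\<integral>\<^sup>+x. f x \<partial>atom_plus_density w \<rho>)
    = ennreal w * f 0 + (\<integral>\<^sup>+x. f x * (ennreal (\<rho> x) * indicator {0..} x) \<partial>lborel)"
proof -
  let ?N = "atom_plus_density w \<rho>"
  let ?r = "\<lambda>x. ennreal (\<rho> x) * indicator {0..} x"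
  have ext: "(\<lambda>x. u x * ?r x) \<in> borel_measurable borel" if "u \<in> borel_measurable half_line" for u
  proof -
    have "(\<lambda>x. u x * ennreal (\<rho> x)) \<in> borel_measurable (restrict_space borel {0..})"
      using \<rho> that by (auto simp: half_line_def)
    then show ?thesis
      by (subst (asm) borel_measurable_restrict_space_iff_ennreal) (auto simp: mult.assoc)
  qed
  have meas: "borel_measurable ?N = borel_measurable half_line"
    by (rule measurable_cong_sets) auto
  have "f \<in> borel_measurable ?N" using f by (simp add: meas)
  then show ?thesis
  proof (induction rule: borel_measurable_induct)
    case (cong f g)
    have "(\<integral>\<^sup>+x. f x \<partial>?N) = (\<integral>\<^sup>+x. g x \<partial>?N)" using cong by (intro nn_integral_cong) auto
    moreover have "(\<integral>\<^sup>+x. f x * ?r x \<partial>lborel) = (\<integral>\<^sup>+x. g x * ?r x \<partial>lborel)"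
      using cong by (intro nn_integral_cong) (auto simp: indicator_def)
    ultimately show ?case using cong by simp
  next
    case (set A)
    then have "(\<integral>\<^sup>+x. indicator A x \<partial>?N) = emeasure ?N A" by simp
    also have "\<dots> = ennreal w * indicator A 0 + (\<integral>\<^sup>+x\<in>A. ennreal (\<rho> x) \<partial>lborel)"
      using set by (intro emeasure_atom_plus_density[OF \<rho>]) simp
    also have "(\<integral>\<^sup>+x\<in>A. ennreal (\<rho> x) \<partial>lborel) = (\<integral>\<^sup>+x. indicator A x * ?r x \<partial>lborel)"
      using set sets_half_lineD[of A] by (intro nn_integral_cong) (auto simp: indicator_def)
    finally show ?case .
  next
    case (mult u c)
    then show ?case using ext[of u]
      by (simp add: nn_integral_cmult meas distrib_left mult.left_commute mult.assoc)
  next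
    case (add u v)
    then show ?case using ext[of u] ext[of v]
      by (simp add: nn_integral_add meas distrib_left distrib_right add_ac)
  next
    case (seq U)
    note inc = \<open>incseq U\<close>
    have "(\<integral>\<^sup>+x. Sup (range U) x \<partial>?N) = (\<integral>\<^sup>+x. (SUP i. U i x) \<partial>?N)"
      by (simp add: image_comp)
    also have "\<dots> = (SUP i. \<integral>\<^sup>+x. U i x \<partial>?N)"
      using seq by (intro nn_integral_monotone_convergence_SUP) auto
    also have "\<dots> = (SUP i. ennreal w * U i 0 + (\<integral>\<^sup>+x. U i x * ?r x \<partial>lborel))"
      using seq by (simp only: )
    also have "\<dots> = (SUP i. ennreal w * U i 0) + (SUP i. \<integral>\<^sup>+x. U i x * ?r x \<partial>lborel)"
      using inc by (intro ennreal_SUP_add)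
        (auto simp: incseq_def le_fun_def intro!: mult_left_mono nn_integral_mono mult_right_mono)
    also have "(SUP i. \<integral>\<^sup>+x. U i x * ?r x \<partial>lborel) = (\<integral>\<^sup>+x. (SUP i. U i x * ?r x) \<partial>lborel)"
      using inc ext seq(1) by (intro nn_integral_monotone_convergence_SUP[symmetric])
        (auto simp: incseq_def le_fun_def meas intro!: mult_right_mono)
    finally show ?case by (simp add: SUP_mult_right_ennreal SUP_mult_left_ennreal image_comp)
  qed
qed

lemma integral_atom_plus_density:
  fixes f :: "real \<Rightarrow> real"
  assumes \<rho>: "\<rho> \<in> borel_measurable half_line" "\<And>x. x \<ge> 0 \<Longrightarrow> \<rho> x \<ge> 0" and w: "w \<ge> 0"
    and f: "f \<in> borel_measurable half_line"
    and int: "set_integrable lborel {0..} (\<lambda>x. \<rho> x * f x)"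
  shows "integrable (atom_plus_density w \<rho>) f"
    and "(\<integral>x. f x \<partial>atom_plus_density w \<rho>) = w * f 0 + (LBINT x:{0..}. \<rho> x * f x)"
proof -
  let ?N = "atom_plus_density w \<rho>"
  let ?g = "\<lambda>x. indicator {0..} x *\<^sub>R (\<rho> x * f x)"
  have ig: "integrable lborel ?g" using int by (simp add: set_integrable_def)
  have meas: "borel_measurable ?N = borel_measurable half_line"
    by (rule measurable_cong_sets) auto
  \<comment> \<open>The factor \<open>s\<close> lets one computation give the positive part (s = 1)
    and the negative part (s = -1), since \<open>ennreal\<close> truncates negative values to
    0.\<close>
  have nn: "(\<integral>\<^sup>+x. ennreal (s * f x) \<partial>?N) = ennreal (w * (s * f 0)) + (\<integral>\<^sup>+x. ennreal (s * ?g x) \<partial>lborel)" for s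
  proof -
    have "(\<integral>\<^sup>+x. ennreal (s * f x) \<partial>?N) = ennreal w * ennreal (s * f 0)
       + (\<integral>\<^sup>+x. ennreal (s * f x) * (ennreal (\<rho> x) * indicator {0..} x) \<partial>lborel)"
      using f by (intro nn_integral_atom_plus_density[OF \<rho>(1)]) auto
    also have "(\<integral>\<^sup>+x. ennreal (s * f x) * (ennreal (\<rho> x) * indicator {0..} x) \<partial>lborel)
       = (\<integral>\<^sup>+x. ennreal (s * ?g x) \<partial>lborel)"
    proof (rule nn_integral_cong)
      fix x :: real
      show "ennreal (s * f x) * (ennreal (\<rho> x) * indicator {0..} x) = ennreal (s * ?g x)"
        using \<rho>(2)[of x] by (cases "x \<ge> 0") (simp_all add: ennreal_mult'[symmetric] mult.commute[of "ennreal (s * f x)"] mult.left_commute)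
    qed
    finally show ?thesis using w by (simp add: ennreal_mult')
  qed
  have abs: "(\<integral>\<^sup>+x. ennreal \<bar>f x\<bar> \<partial>?N) = ennreal (w * \<bar>f 0\<bar>) + (\<integral>\<^sup>+x. ennreal \<bar>?g x\<bar> \<partial>lborel)"
  proof -
    have "(\<integral>\<^sup>+x. ennreal \<bar>f x\<bar> \<partial>?N) = ennreal w * ennreal \<bar>f 0\<bar>
       + (\<integral>\<^sup>+x. ennreal \<bar>f x\<bar> * (ennreal (\<rho> x) * indicator {0..} x) \<partial>lborel)"
      using f by (intro nn_integral_atom_plus_density[OF \<rho>(1)]) auto
    also have "(\<integral>\<^sup>+x. ennreal \<bar>f x\<bar> * (ennreal (\<rho> x) * indicator {0..} x) \<partial>lborel)
       = (\<integral>\<^sup>+x. ennreal \<bar>?g x\<bar> \<partial>lborel)"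
    proof (rule nn_integral_cong)
      fix x :: real
      show "ennreal \<bar>f x\<bar> * (ennreal (\<rho> x) * indicator {0..} x) = ennreal \<bar>?g x\<bar>"
        using \<rho>(2)[of x] by (cases "x \<ge> 0") (simp_all add: ennreal_mult'[symmetric] abs_mult mult.commute[of "ennreal \<bar>f x\<bar>"])
    qed
    finally show ?thesis using w by (simp add: ennreal_mult')
  qed
  have fin: "(\<integral>\<^sup>+x. ennreal \<bar>?g x\<bar> \<partial>lborel) < \<infinity>"
    using ig by (simp add: integrable_iff_bounded)
  show int_f: "integrable ?N f"
    unfolding integrable_iff_bounded using f fin by (simp add: meas abs)
  have fin': "(\<integral>\<^sup>+x. ennreal (s * ?g x) \<partial>lborel) < \<infinity>" if "\<bar>s\<bar> = 1" for s
  proof -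
    have "(\<integral>\<^sup>+x. ennreal (s * ?g x) \<partial>lborel) \<le> (\<integral>\<^sup>+x. ennreal \<bar>?g x\<bar> \<partial>lborel)"
      using that by (intro nn_integral_mono ennreal_leI) (metis abs_ge_self abs_mult mult_1)
    then show ?thesis using fin by (rule le_less_trans)
  qed
  have "(\<integral>x. f x \<partial>?N) = enn2real (\<integral>\<^sup>+x. ennreal (1 * f x) \<partial>?N) - enn2real (\<integral>\<^sup>+x. ennreal ((-1) * f x) \<partial>?N)"
    using int_f by (simp add: real_lebesgue_integral_def)
  also have "\<dots> = max 0 (w * (1 * f 0)) + enn2real (\<integral>\<^sup>+x. ennreal (1 * ?g x) \<partial>lborel)
      - (max 0 (w * (-1 * f 0)) + enn2real (\<integral>\<^sup>+x. ennreal (-1 * ?g x) \<partial>lborel))"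
    unfolding nn using fin'[of 1] fin'[of "-1"]
    by (subst (1 2) enn2real_plus) (auto simp: max_def ennreal_neg enn2real_ennreal)
  also have "\<dots> = w * f 0 + (enn2real (\<integral>\<^sup>+x. ennreal (?g x) \<partial>lborel) - enn2real (\<integral>\<^sup>+x. ennreal (- ?g x) \<partial>lborel))"
    by (simp add: max_def)
  also have "enn2real (\<integral>\<^sup>+x. ennreal (?g x) \<partial>lborel) - enn2real (\<integral>\<^sup>+x. ennreal (- ?g x) \<partial>lborel) = (LBINT x:{0..}. \<rho> x * f x)"
    using real_lebesgue_integral_def[OF ig] by (simp add: set_lebesgue_integral_def)
  finally show "(\<integral>x. f x \<partial>?N) = w * f 0 + (LBINT x:{0..}. \<rho> x * f x)" .
qed

section \<open>Hahn decomposition and total variation\<close>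

lemma half_line_integrable_bounded:
  fixes f :: "real \<Rightarrow> real"
  assumes "finite_measure m" "sets m = sets half_line" "f \<in> borel_measurable half_line"
    and "\<And>x. x \<ge> 0 \<Longrightarrow> \<bar>f x\<bar> \<le> C"
  shows "integrable m f"
proof (rule finite_measure.integrable_const_bound[OF assms(1), where B = C])
  show "AE x in m. norm (f x) \<le> C"
    using assms(4) sets_eq_imp_space_eq[OF assms(2)] by (auto intro!: AE_I2)
  show "f \<in> borel_measurable m"
    using assms(3) measurable_cong_sets[OF assms(2) refl] by blast
qed

lemma half_line_Hahn_decomposition:
  assumes fin: "finite_measure \<mu>1" "finite_measure \<mu>2"
    and sets: "sets \<mu>1 = sets half_line" "sets \<mu>2 = sets half_line"
  obtains Y where "Y \<in> sets half_line"
    "\<And>A. A \<in> sets half_line \<Longrightarrow> A \<subseteq> Y \<Longrightarrow> emeasure \<mu>2 A \<le> emeasure \<mu>1 A"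
    "\<And>A. A \<in> sets half_line \<Longrightarrow> A \<inter> Y = {} \<Longrightarrow> emeasure \<mu>1 A \<le> emeasure \<mu>2 A"
  using finite_unsigned_Hahn_decomposition[OF fin] sets by auto

locale measure_difference =
  fixes \<mu>1 \<mu>2 :: "real measure" and Y :: "real set"
  assumes fin: "finite_measure \<mu>1" "finite_measure \<mu>2"
    and sets: "sets \<mu>1 = sets half_line" "sets \<mu>2 = sets half_line"
    and Y: "Y \<in> sets half_line"
    and Y_pos: "\<And>A. A \<in> sets half_line \<Longrightarrow> A \<subseteq> Y \<Longrightarrow> emeasure \<mu>2 A \<le> emeasure \<mu>1 A"
    and Y_neg: "\<And>A. A \<in> sets half_line \<Longrightarrow> A \<inter> Y = {} \<Longrightarrow> emeasure \<mu>1 A \<le> emeasure \<mu>2 A"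
begin

definition \<sigma> :: "real set \<Rightarrow> real" where "\<sigma> A = measure \<mu>1 A - measure \<mu>2 A"

text \<open>The total variation of \<open>\<sigma>\<close> in Hahn form, \<open>Y\<close> being a
  positive set. In this form additivity is inherited from \<open>\<sigma>\<close>.\<close>

definition \<tau> :: "real set \<Rightarrow> real" where "\<tau> A = \<sigma> (A \<inter> Y) - \<sigma> (A - Y)"

lemma space_eq [simp]: "space \<mu>1 = {0..}" "space \<mu>2 = {0..}"
  using sets[THEN sets_eq_imp_space_eq] by auto

lemma \<sigma>_nonneg: "A \<in> sets half_line \<Longrightarrow> A \<subseteq> Y \<Longrightarrow> \<sigma> A \<ge> 0"
  using Y_pos[of A] fin by (simp add: \<sigma>_def finite_measure.emeasure_eq_measure)

lemma \<sigma>_nonpos: "A \<in> sets half_line \<Longrightarrow> A \<inter> Y = {} \<Longrightarrow> \<sigma> A \<le> 0"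
  using Y_neg[of A] fin by (simp add: \<sigma>_def finite_measure.emeasure_eq_measure)

lemma \<sigma>_Un: "A \<in> sets half_line \<Longrightarrow> B \<in> sets half_line \<Longrightarrow> A \<inter> B = {} \<Longrightarrow> \<sigma> (A \<union> B) = \<sigma> A + \<sigma> B"
  unfolding \<sigma>_def using fin sets
  by (simp add: finite_measure.finite_measure_Union)

lemma abs_\<sigma>_le_\<tau>:
  assumes A: "A \<in> sets half_line"
  shows "\<bar>\<sigma> A\<bar> \<le> \<tau> A" "\<tau> A \<ge> 0"
proof -
  have "\<sigma> A = \<sigma> (A \<inter> Y) + \<sigma> (A - Y)"
    using \<sigma>_Un[of "A \<inter> Y" "A - Y"] A Y by (simp add: Int_Diff_Un sets.Int sets.Diff Int_Diff Diff_Int_distrib)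
  moreover have "\<sigma> (A \<inter> Y) \<ge> 0" "\<sigma> (A - Y) \<le> 0"
    using A Y \<sigma>_nonneg[of "A \<inter> Y"] \<sigma>_nonpos[of "A - Y"] by auto
  ultimately show "\<bar>\<sigma> A\<bar> \<le> \<tau> A" "\<tau> A \<ge> 0" by (auto simp: \<tau>_def)
qed

lemma sums_\<sigma>:
  fixes B :: "nat \<Rightarrow> real set"
  assumes "range B \<subseteq> sets half_line" "disjoint_family B"
  shows "(\<lambda>i. \<sigma> (B i)) sums \<sigma> (\<Union>i. B i)"
  unfolding \<sigma>_def using assms fin sets
  by (intro sums_diff finite_measure.finite_measure_UNION) auto

lemma sums_\<tau>:
  fixes B :: "nat \<Rightarrow> real set"
  assumes B: "range B \<subseteq> sets half_line" "disjoint_family B"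
  shows "(\<lambda>i. \<tau> (B i)) sums \<tau> (\<Union>i. B i)"
proof -
  have "(\<lambda>i. \<sigma> (B i \<inter> Y)) sums \<sigma> (\<Union>i. B i \<inter> Y)" "(\<lambda>i. \<sigma> (B i - Y)) sums \<sigma> (\<Union>i. B i - Y)"
    using B Y by (intro sums_\<sigma>; auto simp: disjoint_family_on_def)+
  then have "(\<lambda>i. \<sigma> (B i \<inter> Y) - \<sigma> (B i - Y)) sums (\<sigma> (\<Union>i. B i \<inter> Y) - \<sigma> (\<Union>i. B i - Y))"
    by (rule sums_diff)
  moreover have "(\<Union>i. B i \<inter> Y) = (\<Union>i. B i) \<inter> Y" "(\<Union>i. B i - Y) = (\<Union>i. B i) - Y" by auto
  ultimately show ?thesis by (simp add: \<tau>_def)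
qed

lemma \<tau>_finite_Un:
  assumes "finite F" "F \<subseteq> sets half_line" "disjoint F"
  shows "\<tau> (\<Union>F) = (\<Sum>B\<in>F. \<tau> B)"
  using assms
proof (induction F)
  case empty
  then show ?case by (simp add: \<tau>_def \<sigma>_def)
next
  case (insert A F)
  then have m: "A \<in> sets half_line" "\<Union>F \<in> sets half_line" by auto
  have "A \<inter> B = {}" if "B \<in> F" for B
    using insert.prems(2) insert.hyps(2) that by (auto dest!: disjointD[of _ A B])
  then have "A \<inter> \<Union>F = {}" by auto
  note m = m this
  have "\<tau> (A \<union> \<Union>F) = \<tau> A + \<tau> (\<Union>F)"
  proof -
    have "(A \<union> \<Union>F) \<inter> Y = (A \<inter> Y) \<union> (\<Union>F \<inter> Y)" "(A \<union> \<Union>F) - Y = (A - Y) \<union> (\<Union>F - Y)" by auto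
    moreover have "\<sigma> ((A \<inter> Y) \<union> (\<Union>F \<inter> Y)) = \<sigma> (A \<inter> Y) + \<sigma> (\<Union>F \<inter> Y)"
      using m Y by (intro \<sigma>_Un sets.Int) auto
    moreover have "\<sigma> ((A - Y) \<union> (\<Union>F - Y)) = \<sigma> (A - Y) + \<sigma> (\<Union>F - Y)"
      using m Y by (intro \<sigma>_Un sets.Diff) auto
    ultimately show ?thesis by (simp add: \<tau>_def)
  qed
  then show ?case using insert by (simp add: pairwise_insert)
qed

text \<open>No partition beats \<open>\<tau>\<close>, which is additive and dominates the absolute
  value of \<open>\<sigma>\<close>; the partition into the parts inside and outside \<open>Y\<close>
  attains it.\<close>

lemma variation_eq:
  assumes A: "A \<in> sets half_line"
  shows "variation \<sigma> A = ennreal (\<tau> A)"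
proof (rule antisym)
  show "variation \<sigma> A \<le> ennreal (\<tau> A)"
    unfolding variation_def
  proof (rule SUP_least)
    fix F assume "F \<in> {F. finite F \<and> F \<subseteq> sets half_line \<and> disjoint F \<and> \<Union>F = A}"
    then have F: "finite F" "F \<subseteq> sets half_line" "disjoint F" "\<Union>F = A" by auto
    have "(\<Sum>B\<in>F. ennreal \<bar>\<sigma> B\<bar>) \<le> (\<Sum>B\<in>F. ennreal (\<tau> B))"
      using F abs_\<sigma>_le_\<tau> by (intro sum_mono ennreal_leI) auto
    also have "\<dots> = ennreal (\<Sum>B\<in>F. \<tau> B)"
      using F abs_\<sigma>_le_\<tau> by (intro sum_ennreal) auto
    also have "(\<Sum>B\<in>F. \<tau> B) = \<tau> A"
      using \<tau>_finite_Un F by auto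
    finally show "(\<Sum>B\<in>F. ennreal \<bar>\<sigma> B\<bar>) \<le> ennreal (\<tau> A)" .
  qed
  have m: "A \<inter> Y \<in> sets half_line" "A - Y \<in> sets half_line" using A Y by auto
  show "ennreal (\<tau> A) \<le> variation \<sigma> A"
  \<comment> \<open>The two pieces coincide only when both are empty. The case is split off because
    the set of pieces would then have one element and the sum one term.\<close>
  proof (cases "A \<inter> Y = A - Y")
    case True
    then have "\<tau> A = 0" by (simp add: \<tau>_def)
    then show ?thesis by simp
  next
    case False
    have "ennreal (\<tau> A) = (\<Sum>B\<in>{A \<inter> Y, A - Y}. ennreal \<bar>\<sigma> B\<bar>)"
    proof -
      have "\<sigma> (A \<inter> Y) \<ge> 0" "\<sigma> (A - Y) \<le> 0"
        using \<sigma>_nonneg[OF m(1)] \<sigma>_nonpos[OF m(2)] by blast+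
      then show ?thesis using False by (simp add: \<tau>_def ennreal_plus[symmetric] del: ennreal_plus)
    qed
    also have "\<dots> \<le> variation \<sigma> A"
      unfolding variation_def using m by (intro SUP_upper) (auto simp: disjoint_def)
    finally show ?thesis .
  qed
qed

lemma space_variation_measure [simp]: "space (variation_measure s) = {0..}"
  and sets_variation_measure [simp]: "sets (variation_measure s) = sets half_line"
  unfolding variation_measure_def
  using sets.space_closed[of half_line] sets.sets_measure_of_eq[of half_line]
  by (simp_all add: space_measure_of)

lemma emeasure_variation_measure:
  assumes A: "A \<in> sets half_line"
  shows "emeasure (variation_measure \<sigma>) A = ennreal (\<tau> A)"
proof -
  have "emeasure (variation_measure \<sigma>) A = variation \<sigma> A"
  proof (rule emeasure_measure_of[OF variation_measure_def])
    show "sets half_line \<subseteq> Pow {0..}" using sets.space_closed[of half_line] by simp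
    show "A \<in> sets (variation_measure \<sigma>)" using A by simp
    show "positive (sets (variation_measure \<sigma>)) (variation \<sigma>)"
      by (simp add: positive_def variation_eq \<tau>_def \<sigma>_def)
    show "countably_additive (sets (variation_measure \<sigma>)) (variation \<sigma>)"
    proof (rule countably_additiveI)
      fix B :: "nat \<Rightarrow> real set"
      assume B: "range B \<subseteq> sets (variation_measure \<sigma>)" "disjoint_family B" "(\<Union>i. B i) \<in> sets (variation_measure \<sigma>)"
      then have m: "\<And>i. B i \<in> sets half_line" "range B \<subseteq> sets half_line" by auto
      have "(\<Sum>i. ennreal (\<tau> (B i))) = ennreal (\<tau> (\<Union>i. B i))"
        using sums_\<tau>[OF m(2) B(2)] abs_\<sigma>_le_\<tau>(2) m(1)
        by (metis sums_iff suminf_ennreal2)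
      then show "(\<Sum>i. variation \<sigma> (B i)) = variation \<sigma> (\<Union>i. B i)"
        using B(3) m(1) by (simp add: variation_eq)
    qed
  qed
  then show ?thesis by (simp add: variation_eq A)
qed

lemma weighted_norm_1: "weighted_norm (\<lambda>_. 1) \<sigma> = ennreal (\<tau> {0..})"
proof -
  have "{0..} \<in> sets half_line" using sets.top[of half_line] by simp
  then show ?thesis
    using emeasure_variation_measure[of "{0..}"] by (simp add: weighted_norm_def)
qed

text \<open>The functions A + \<eta> and A - \<eta> are nonnegative, so their integrals over
  \<open>Y\<close> are ordered as the measures are there, and in reverse order over the complement.
  The four inequalities add up to the claim.\<close>

lemma integral_diff_le:
  assumes \<eta>: "\<eta> \<in> borel_measurable half_line" "\<And>x. x \<ge> 0 \<Longrightarrow> \<bar>\<eta> x\<bar> \<le> A"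
  shows "\<bar>(\<integral>x. \<eta> x \<partial>\<mu>1) - (\<integral>x. \<eta> x \<partial>\<mu>2)\<bar> \<le> A * \<tau> {0..}"
proof -
  have mono: "(\<integral>x. indicator S x * u x \<partial>\<mu>) \<le> (\<integral>x. indicator S x * u x \<partial>\<nu>)"
    if le: "\<And>B. B \<in> sets half_line \<Longrightarrow> B \<subseteq> S \<Longrightarrow> emeasure \<mu> B \<le> emeasure \<nu> B"
      and S: "S \<in> sets half_line" and u: "u \<in> borel_measurable half_line" "\<And>x. x \<ge> 0 \<Longrightarrow> 0 \<le> u x" "\<And>x. x \<ge> 0 \<Longrightarrow> u x \<le> 2 * A"
      and \<mu>: "sets \<mu> = sets half_line" "finite_measure \<mu>" and \<nu>: "sets \<nu> = sets half_line" "finite_measure \<nu>"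
    for \<mu> \<nu> S u
  proof -
    have sp: "space \<mu> = {0..}" "space \<nu> = {0..}" using sets_eq_imp_space_eq[OF \<mu>(1)] sets_eq_imp_space_eq[OF \<nu>(1)] by auto
    have bm: "borel_measurable \<mu> = borel_measurable half_line" "borel_measurable \<nu> = borel_measurable half_line"
      using \<mu> \<nu> measurable_cong_sets by blast+
    let ?D = "\<lambda>m. density m (indicator S)"
    have "sets (?D \<mu>) = sets (?D \<nu>)" using \<mu> \<nu> by simp
    moreover have "?D \<mu> \<le> ?D \<nu>"
    proof -
      have "emeasure (?D \<mu>) B \<le> emeasure (?D \<nu>) B" for B
      proof (cases "B \<in> sets half_line")
        case True
        then have "emeasure (?D \<mu>) B = emeasure \<mu> (S \<inter> B)" "emeasure (?D \<nu>) B = emeasure \<nu> (S \<inter> B)"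
          using S \<mu> \<nu> by (auto intro!: emeasure_restricted)
        then show ?thesis using le[of "S \<inter> B"] True S by auto
      qed (use \<mu> \<nu> in \<open>simp add: emeasure_notin_sets\<close>)
      then show ?thesis unfolding le_measure_iff using \<mu> \<nu> sp by (simp add: le_fun_def)
    qed
    ultimately have "(\<integral>\<^sup>+x. ennreal (u x) \<partial>?D \<mu>) \<le> (\<integral>\<^sup>+x. ennreal (u x) \<partial>?D \<nu>)"
      by (rule nn_integral_mono_measure)
    then have nn: "(\<integral>\<^sup>+x. ennreal (indicator S x * u x) \<partial>\<mu>) \<le> (\<integral>\<^sup>+x. ennreal (indicator S x * u x) \<partial>\<nu>)"
      using u S \<mu> \<nu> by (simp add: nn_integral_density bm ennreal_mult'' ennreal_indicator[symmetric] ennreal_mult')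
    have ub: "u x \<le> 2 * \<bar>A\<bar>" if "x \<ge> 0" for x using u(3)[OF that] by linarith
    have i: "integrable m (\<lambda>x. indicator S x * u x)" if "m = \<mu> \<or> m = \<nu>" for m
      using that u ub S \<mu> \<nu>
      by (intro half_line_integrable_bounded[where C = "2 * \<bar>A\<bar>"]) (auto simp: indicator_def)
    have p: "AE x in m. 0 \<le> indicator S x * u x" if "m = \<mu> \<or> m = \<nu>" for m
      using that u sp by (auto intro!: AE_I2 simp: indicator_def)
    show ?thesis
      using nn nn_integral_eq_integral[OF i p] integral_nonneg_AE[OF p]
      by (simp only: ennreal_le_iff simp_thms)
  qed
  have A0: "A \<ge> 0" using \<eta>(2)[of 0] by auto
  let ?N = "{0..} - Y"
  have top: "{0..} \<in> sets half_line" using sets.top[of half_line] by simp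
  have N: "?N \<in> sets half_line" using top Y by auto
  have bm: "borel_measurable \<mu>1 = borel_measurable half_line" "borel_measurable \<mu>2 = borel_measurable half_line"
    using sets measurable_cong_sets by blast+
  have int: "integrable m \<eta>" "integrable m (indicator Y :: real \<Rightarrow> real)" "integrable m (indicator ?N :: real \<Rightarrow> real)"
    "integrable m (\<lambda>x. indicator Y x * \<eta> x)" "integrable m (\<lambda>x. indicator ?N x * \<eta> x)" if m: "m = \<mu>1 \<or> m = \<mu>2" for m
  proof -
    have ms: "finite_measure m" "sets m = sets half_line" using m fin sets by auto
    have ind: "(indicator S :: real \<Rightarrow> real) \<in> borel_measurable half_line" if "S \<in> sets half_line" for S
      using that by (rule borel_measurable_indicator)
    note * = half_line_integrable_bounded[OF ms, where C = "max 1 A"]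
    have b: "\<bar>\<eta> x\<bar> \<le> max 1 A" if "x \<ge> 0" for x using \<eta>(2)[OF that] by simp
    have b': "\<bar>indicator S x * \<eta> x\<bar> \<le> max 1 A" if "x \<ge> 0" for S x
      using b[OF that] by (auto simp: indicator_def)
    show "integrable m \<eta>" by (rule *[OF \<eta>(1) b])
    show "integrable m (indicator Y :: real \<Rightarrow> real)" "integrable m (indicator ?N :: real \<Rightarrow> real)"
      by (rule *[OF ind]; use Y N in \<open>auto simp: indicator_def max_def\<close>)+
    show "integrable m (\<lambda>x. indicator Y x * \<eta> x)" "integrable m (\<lambda>x. indicator ?N x * \<eta> x)"
      by (rule *[OF borel_measurable_times[OF ind \<eta>(1)] b']; use Y N in simp)+
  qed
  have split: "(\<integral>x. \<eta> x \<partial>m) = (\<integral>x. indicator Y x * \<eta> x \<partial>m) + (\<integral>x. indicator ?N x * \<eta> x \<partial>m)" if "m = \<mu>1 \<or> m = \<mu>2" for m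
  proof -
    have "(\<integral>x. \<eta> x \<partial>m) = (\<integral>x. indicator Y x * \<eta> x + indicator ?N x * \<eta> x \<partial>m)"
      using that space_eq by (intro Bochner_Integration.integral_cong) (auto simp: indicator_def)
    also have "\<dots> = (\<integral>x. indicator Y x * \<eta> x \<partial>m) + (\<integral>x. indicator ?N x * \<eta> x \<partial>m)"
      using int[OF that] by (intro Bochner_Integration.integral_add)
    finally show ?thesis .
  qed
  have iY: "(\<integral>x. indicator Y x * (A + s * \<eta> x) \<partial>m) = A * measure m Y + s * (\<integral>x. indicator Y x * \<eta> x \<partial>m)"
    and iN: "(\<integral>x. indicator ?N x * (A + s * \<eta> x) \<partial>m) = A * measure m ?N + s * (\<integral>x. indicator ?N x * \<eta> x \<partial>m)"
    if "m = \<mu>1 \<or> m = \<mu>2" for m s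
  proof -
    have eq: "(\<lambda>x. indicator S x * (A + s * \<eta> x)) = (\<lambda>x. A * indicator S x + s * (indicator S x * \<eta> x))" for S
      by (auto simp: algebra_simps)
    show "(\<integral>x. indicator Y x * (A + s * \<eta> x) \<partial>m) = A * measure m Y + s * (\<integral>x. indicator Y x * \<eta> x \<partial>m)"
      "(\<integral>x. indicator ?N x * (A + s * \<eta> x) \<partial>m) = A * measure m ?N + s * (\<integral>x. indicator ?N x * \<eta> x \<partial>m)"
      unfolding eq using int[OF that] that Y N sets.sets_into_space[of Y \<mu>1] sets.sets_into_space[of Y \<mu>2] sets
      by (auto simp: Int_absorb2)
  qed
  have u: "(\<lambda>x. A + s * \<eta> x) \<in> borel_measurable half_line" "\<And>x. x \<ge> 0 \<Longrightarrow> 0 \<le> A + s * \<eta> x" "\<And>x. x \<ge> 0 \<Longrightarrow> A + s * \<eta> x \<le> 2 * A"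
    if "\<bar>s\<bar> = 1" for s
  proof -
    have b: "- A \<le> \<eta> x" "\<eta> x \<le> A" if "x \<ge> 0" for x using \<eta>(2)[OF that] by (simp_all add: abs_le_iff)
    have s: "s = 1 \<or> s = - 1" using that by (simp add: abs_if split: if_splits)
    show "(\<lambda>x. A + s * \<eta> x) \<in> borel_measurable half_line" using \<eta>(1) by simp
    show "0 \<le> A + s * \<eta> x" "A + s * \<eta> x \<le> 2 * A" if "x \<ge> 0" for x
      using s b[OF that] by (elim disjE; simp)+
  qed
  have P: "A * measure \<mu>2 Y + s * (\<integral>x. indicator Y x * \<eta> x \<partial>\<mu>2) \<le> A * measure \<mu>1 Y + s * (\<integral>x. indicator Y x * \<eta> x \<partial>\<mu>1)" if "\<bar>s\<bar> = 1" for s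
    using mono[OF Y_pos Y u[OF that] sets(2) fin(2) sets(1) fin(1)] iY[OF disjI1[OF refl], of s] iY[OF disjI2[OF refl], of s] by simp
  have neg: "emeasure \<mu>1 B \<le> emeasure \<mu>2 B" if "B \<in> sets half_line" "B \<subseteq> ?N" for B
    using that by (intro Y_neg) auto
  have M: "A * measure \<mu>1 ?N + s * (\<integral>x. indicator ?N x * \<eta> x \<partial>\<mu>1) \<le> A * measure \<mu>2 ?N + s * (\<integral>x. indicator ?N x * \<eta> x \<partial>\<mu>2)" if "\<bar>s\<bar> = 1" for s
    using mono[OF neg N u[OF that] sets(1) fin(1) sets(2) fin(2)] iN[OF disjI1[OF refl], of s] iN[OF disjI2[OF refl], of s] by simp
  have Y0: "{0..} \<inter> Y = Y" using Y sets_half_lineD by auto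
  have "A * \<tau> {0..} = A * measure \<mu>1 Y - A * measure \<mu>2 Y - (A * measure \<mu>1 ?N - A * measure \<mu>2 ?N)"
    by (simp add: \<tau>_def \<sigma>_def Y0 right_diff_distrib)
  then show ?thesis
    using P[of 1] P[of "-1"] M[of 1] M[of "-1"] split[OF disjI1[OF refl]] split[OF disjI2[OF refl]]
    unfolding abs_le_iff by simp
qed

end

lemma measure_differenceE:
  assumes "finite_measure \<mu>1" "finite_measure \<mu>2" "sets \<mu>1 = sets half_line" "sets \<mu>2 = sets half_line"
  obtains Y where "measure_difference \<mu>1 \<mu>2 Y"
  using half_line_Hahn_decomposition[OF assms] assms unfolding measure_difference_def by metis

lemma weighted_norm_cong:
  assumes "\<And>A. A \<in> sets half_line \<Longrightarrow> s A = t A"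
  shows "weighted_norm V s = weighted_norm V t"
proof -
  have "variation s = variation t"
    unfolding variation_def using assms by (intro ext SUP_cong sum.cong) auto
  then show ?thesis by (simp add: weighted_norm_def variation_measure_def)
qed

lemma weighted_norm_mono: "(\<And>x. V x \<le> W x) \<Longrightarrow> weighted_norm V s \<le> weighted_norm W s"
  unfolding weighted_norm_def by (intro nn_integral_mono ennreal_leI)

section \<open>Total variation and bounded test functions\<close>

lemma integral_diff_le_total_variation:
  assumes fin: "finite_measure \<mu>1" "finite_measure \<mu>2" "sets \<mu>1 = sets half_line" "sets \<mu>2 = sets half_line"
    and T: "weighted_norm (\<lambda>_. 1) (\<lambda>A. measure \<mu>1 A - measure \<mu>2 A) \<le> ennreal T" "T \<ge> 0"
    and \<eta>: "\<eta> \<in> borel_measurable half_line" "\<And>x. x \<ge> 0 \<Longrightarrow> \<bar>\<eta> x\<bar> \<le> A"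
  shows "\<bar>(\<integral>x. \<eta> x \<partial>\<mu>1) - (\<integral>x. \<eta> x \<partial>\<mu>2)\<bar> \<le> A * T"
proof -
  obtain Y where "measure_difference \<mu>1 \<mu>2 Y" using fin by (rule measure_differenceE)
  then interpret measure_difference \<mu>1 \<mu>2 Y .
  have "\<tau> {0..} \<le> T" using T weighted_norm_1 by (simp add: \<sigma>_def[abs_def])
  moreover have "A \<ge> 0" using \<eta>(2)[of 0] by auto
  ultimately have "A * \<tau> {0..} \<le> A * T" by (intro mult_left_mono)
  then show ?thesis using integral_diff_le[OF \<eta>] by simp
qed

text \<open>The measure is pushed forward to the real line, where finite Borel measures are inner
  regular; on subsets of the half line the image measure agrees with the original.\<close>

lemma half_line_inner_regular:
  assumes fin: "finite_measure \<mu>" and s: "sets \<mu> = sets half_line"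
    and B: "B \<in> sets half_line" and e: "e > 0"
  obtains K where "compact K" "K \<subseteq> B" "measure \<mu> (B - K) < e"
proof -
  interpret finite_measure \<mu> by fact
  have sp: "space \<mu> = {0..}" using sets_eq_imp_space_eq[OF s] by simp
  have id: "(\<lambda>x. x) \<in> measurable \<mu> borel"
    using s by (subst measurable_cong_sets[of _ half_line _ borel]) (auto simp: half_line_def intro!: measurable_restrict_space1)
  let ?M = "distr \<mu> borel (\<lambda>x. x)"
  have B': "B \<in> sets borel" "B \<subseteq> {0..}" using sets_half_lineD[OF B] by auto
  have em: "emeasure ?M A = emeasure \<mu> A" if "A \<in> sets borel" "A \<subseteq> {0..}" for A
    using id that sp by (subst emeasure_distr) (auto simp: Int_absorb2)
  interpret M: finite_measure ?M by (rule finite_measure_distr[OF id])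
  have "emeasure \<mu> B = (SUP K \<in> {K. K \<subseteq> B \<and> compact K}. emeasure ?M K)"
    using inner_regular[of ?M B] B' em M.emeasure_finite[of UNIV] by simp
  moreover have "emeasure \<mu> B < top" by (simp add: less_top[symmetric])
  ultimately have "\<exists>K\<in>{K. K \<subseteq> B \<and> compact K}. emeasure ?M K + ennreal e > emeasure \<mu> B"
  proof -
    assume a: "emeasure \<mu> B = (SUP K \<in> {K. K \<subseteq> B \<and> compact K}. emeasure ?M K)" and b: "emeasure \<mu> B < top"
    show ?thesis
    \<comment> \<open>Subtracting \<open>e\<close> lowers the mass strictly only if the mass is
      positive; for mass 0 the empty set will do.\<close>
    proof (cases "emeasure \<mu> B = 0")
      case True
      then show ?thesis using e by (intro bexI[of _ "{}"]) auto
    next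
      case False
      then have "emeasure \<mu> B - ennreal e < emeasure \<mu> B"
        using b e by (intro ennreal_between) (auto simp: less_top zero_less_iff_neq_zero)
      then obtain K where K: "K \<in> {K. K \<subseteq> B \<and> compact K}" "emeasure \<mu> B - ennreal e < emeasure ?M K"
        unfolding a less_SUP_iff by auto
      then have "emeasure \<mu> B < emeasure ?M K + ennreal e"
      proof -
        have "ennreal (measure \<mu> B - e) < ennreal (measure ?M K)"
          using K(2) e by (simp add: emeasure_eq_measure M.emeasure_eq_measure ennreal_minus)
        then have "measure \<mu> B - e < measure ?M K" by (metis ennreal_leI not_le)
        then show ?thesis
          using e by (simp add: emeasure_eq_measure M.emeasure_eq_measure ennreal_plus[symmetric] ennreal_less_iff del: ennreal_plus)
      qed
      then show ?thesis using K by auto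
    qed
  qed
  then obtain K where K: "K \<subseteq> B" "compact K" "emeasure \<mu> B < emeasure ?M K + ennreal e" by auto
  have Kb: "K \<in> sets borel" "K \<subseteq> {0..}" using K B' by (auto simp: borel_closed compact_imp_closed)
  then have Ks: "K \<in> sets \<mu>" unfolding s half_line_def by (auto simp: sets_restrict_space)
  have "measure \<mu> B < measure \<mu> K + e"
    using K(3) e em[OF Kb] by (simp add: emeasure_eq_measure ennreal_plus[symmetric] ennreal_less_iff del: ennreal_plus)
  then have "measure \<mu> (B - K) < e"
    using Ks B s K(1) by (simp add: finite_measure_Diff)
  then show ?thesis using K that by blast
qed

text \<open>The extremal test function is 1 on \<open>Y\<close> and -1 off \<open>Y\<close>. Compact
  subsets of the two parts that carry nearly all mass of both measures are disjoint, and Urysohn's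
  lemma supplies a continuous function with the right values on them. A one-sided hypothesis
  suffices because this function makes the difference of integrals close to its maximum.\<close>

lemma total_variation_le_continuous:
  assumes fm: "finite_measure \<mu>1" "finite_measure \<mu>2" "sets \<mu>1 = sets half_line" "sets \<mu>2 = sets half_line"
    and test: "\<And>\<eta>. continuous_on UNIV \<eta> \<Longrightarrow> (\<And>x. \<bar>\<eta> x\<bar> \<le> 1) \<Longrightarrow> (\<integral>x. \<eta> x \<partial>\<mu>1) - (\<integral>x. \<eta> x \<partial>\<mu>2) \<le> T"
  shows "weighted_norm (\<lambda>_. 1) (\<lambda>A. measure \<mu>1 A - measure \<mu>2 A) \<le> ennreal T"
proof -
  obtain Y where "measure_difference \<mu>1 \<mu>2 Y" using fm by (rule measure_differenceE)
  then interpret measure_difference \<mu>1 \<mu>2 Y .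
  have top: "{0..} \<in> sets half_line" using sets.top[of half_line] by simp
  let ?N = "{0..} - Y"
  have N: "?N \<in> sets half_line" using top Y by auto
  have Ysub: "Y \<subseteq> {0..}" using Y sets_half_lineD by auto
  have "\<tau> {0..} \<le> T"
  proof (rule field_le_epsilon)
    fix e :: real assume e: "e > 0"
    \<comment> \<open>The function is wrong by at most 2 on two sets of mass e/8, which costs e/2
      for each of the two measures and \<open>e\<close> in total.\<close>
    obtain K1 where K1: "compact K1" "K1 \<subseteq> Y" "measure \<mu>1 (Y - K1) < e / 8"
      using half_line_inner_regular[OF fm(1,3) Y, of "e / 8"] e by auto
    obtain K2 where K2: "compact K2" "K2 \<subseteq> Y" "measure \<mu>2 (Y - K2) < e / 8"
      using half_line_inner_regular[OF fm(2,4) Y, of "e / 8"] e by auto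
    obtain L1 where L1: "compact L1" "L1 \<subseteq> ?N" "measure \<mu>1 (?N - L1) < e / 8"
      using half_line_inner_regular[OF fm(1,3) N, of "e / 8"] e by auto
    obtain L2 where L2: "compact L2" "L2 \<subseteq> ?N" "measure \<mu>2 (?N - L2) < e / 8"
      using half_line_inner_regular[OF fm(2,4) N, of "e / 8"] e by auto
    define K where "K = K1 \<union> K2"
    define L where "L = L1 \<union> L2"
    have cl: "closed K" "closed L" "K \<inter> L = {}" "K \<subseteq> Y" "L \<subseteq> ?N"
      using K1 K2 L1 L2 by (auto simp: K_def L_def compact_imp_closed)
    obtain \<eta> :: "real \<Rightarrow> real" where \<eta>: "continuous_on UNIV \<eta>" "\<And>x. \<eta> x \<in> closed_segment 1 (-1)"
      "\<And>x. x \<in> K \<Longrightarrow> \<eta> x = 1" "\<And>x. x \<in> L \<Longrightarrow> \<eta> x = -1"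
      using Urysohn[OF cl(1-3), of 1 "-1"] by metis
    have bd: "\<bar>\<eta> x\<bar> \<le> 1" for x using \<eta>(2)[of x] by (auto simp: closed_segment_eq_real_ivl)
    have hl: "C \<in> sets half_line" if "closed C" "C \<subseteq> {0..}" for C :: "real set"
      using that unfolding half_line_def by (auto simp: sets_restrict_space intro!: image_eqI[of _ _ C])
    have Ks: "K1 \<in> sets half_line" "K2 \<in> sets half_line" "L1 \<in> sets half_line" "L2 \<in> sets half_line"
      using K1 K2 L1 L2 Ysub by (auto intro!: hl compact_imp_closed)
    have Kb: "K \<in> sets half_line" "L \<in> sets half_line"
      using Ks by (auto simp: K_def L_def)
    have \<eta>m: "\<eta> \<in> borel_measurable half_line"
      using \<eta>(1) unfolding half_line_def by (intro measurable_restrict_space1) (simp add: borel_measurable_continuous_onI)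
    have est: "\<bar>(\<integral>x. \<eta> x \<partial>m) - (measure m Y - measure m ?N)\<bar> \<le> e / 2"
      if m: "m = \<mu>1 \<or> m = \<mu>2" for m
    proof -
      interpret m: finite_measure m using m fm by auto
      have ms: "sets m = sets half_line" using m fm by auto
      have msp: "space m = {0..}" using sets_eq_imp_space_eq[OF ms] by simp
      have bm: "borel_measurable m = borel_measurable half_line" using ms measurable_cong_sets by blast
      have small: "measure m (Y - K) \<le> e / 8" "measure m (?N - L) \<le> e / 8"
      proof -
        have "measure m (Y - K) \<le> measure m (Y - K1)" "measure m (Y - K) \<le> measure m (Y - K2)"
          using Ks Y ms by (auto intro!: m.finite_measure_mono simp: K_def)
        moreover have "measure m (?N - L) \<le> measure m (?N - L1)" "measure m (?N - L) \<le> measure m (?N - L2)"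
          using Ks N ms by (auto intro!: m.finite_measure_mono simp: L_def)
        ultimately show "measure m (Y - K) \<le> e / 8" "measure m (?N - L) \<le> e / 8"
          using m K1(3) K2(3) L1(3) L2(3) by auto
      qed
      have i: "integrable m \<eta>" "integrable m (indicator Y :: real \<Rightarrow> real)" "integrable m (indicator ?N :: real \<Rightarrow> real)"
        "integrable m (indicator (Y - K) :: real \<Rightarrow> real)" "integrable m (indicator (?N - L) :: real \<Rightarrow> real)"
        using m.finite_measure_axioms \<eta>m bd Y N ms Kb
        by (auto intro!: half_line_integrable_bounded[where C = 1] sets.Diff)
      have "(\<integral>x. \<eta> x \<partial>m) - (measure m Y - measure m ?N) = (\<integral>x. \<eta> x - (indicator Y x - indicator ?N x) \<partial>m)"
        using i Y N ms msp Ysub by (simp add: Int_absorb2)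
      also have "\<bar>\<dots>\<bar> \<le> (\<integral>x. \<bar>\<eta> x - (indicator Y x - indicator ?N x)\<bar> \<partial>m)"
        using integral_norm_bound[of m "\<lambda>x. \<eta> x - (indicator Y x - indicator ?N x)"] by simp
      also have "\<dots> \<le> (\<integral>x. 2 * indicator (Y - K) x + 2 * indicator (?N - L) x \<partial>m)"
      proof (rule integral_mono)
        fix x assume "x \<in> space m"
        then have x: "x \<ge> 0" by (simp add: msp)
        have "- 1 \<le> \<eta> x" "\<eta> x \<le> 1" using bd[of x] by auto
        then show "\<bar>\<eta> x - (indicator Y x - indicator ?N x)\<bar> \<le> 2 * indicator (Y - K) x + 2 * indicator (?N - L) x"
          using \<eta>(3,4)[of x] x cl by (cases "x \<in> K"; cases "x \<in> L"; cases "x \<in> Y") auto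
      qed (use i in auto)
      also have "\<dots> = 2 * measure m (Y - K) + 2 * measure m (?N - L)"
      proof -
        have "(Y - K) \<inter> {0..} = Y - K" "(?N - L) \<inter> {0..} = ?N - L" using Ysub by auto
        then show ?thesis using i Y N Kb ms msp by simp
      qed
      finally show ?thesis using small by simp
    qed
    have "\<tau> {0..} = (measure \<mu>1 Y - measure \<mu>1 ?N) - (measure \<mu>2 Y - measure \<mu>2 ?N)"
      using Ysub by (simp add: \<tau>_def \<sigma>_def Int_absorb1)
    also have "\<dots> \<le> (\<integral>x. \<eta> x \<partial>\<mu>1) - (\<integral>x. \<eta> x \<partial>\<mu>2) + e"
      using est[OF disjI1[OF refl]] est[OF disjI2[OF refl]] unfolding abs_le_iff by linarith
    also have "\<dots> \<le> T + e" using test[OF \<eta>(1) bd] by simp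
    finally show "\<tau> {0..} \<le> T + e" .
  qed
  then show ?thesis using weighted_norm_1 by (simp add: \<sigma>_def[abs_def] ennreal_leI)
qed

section \<open>The resolvent kernel\<close>

lemma mean_value_interior:
  fixes f f' :: "real \<Rightarrow> real"
  assumes "u < v" "continuous_on {u..v} f" "\<And>x. u < x \<Longrightarrow> x < v \<Longrightarrow> (f has_real_derivative f' x) (at x)"
  obtains z where "u < z" "z < v" "f v - f u = (v - u) * f' z"
proof -
  have "f differentiable (at x)" if "u < x" "x < v" for x
    using assms(3)[OF that] by (auto simp: real_differentiable_def)
  then obtain l z where "u < z" "z < v" "(f has_real_derivative l) (at z)" "f v - f u = (v - u) * l"
    using MVT[OF assms(1,2)] by metis
  then show ?thesis using assms(3)[of z] DERIV_unique that by blast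
qed

section \<open>The two solutions of L w = w/h\<close>

locale sticky_resolvent =
  fixes lam \<beta> \<mu> \<delta> h :: real
  assumes lam: "lam > 0" and \<beta>: "\<beta> > 0" and \<mu>: "\<mu> > 0" and \<delta>: "1 < \<delta>" "\<delta> < 2" and h: "h > 0"
begin

definition a :: real where "a = (1 / h) / (2 * lam)"
definition b :: real where "b = \<delta> / 2"
definition c :: real where "c = lam * \<beta> / 2"
definition W :: real where "W = abs_wronskian lam \<beta> \<delta> (1 / h)"
definition c\<^sub>\<mu> :: real where "c\<^sub>\<mu> = c_sticky lam \<beta> \<mu> \<delta> (1 / h)"
definition r :: "real \<Rightarrow> real" where "r x = x powr (\<delta> - 1) * exp (- lam * \<beta> * x\<^sup>2 / 2)"
abbreviation (input) "m' \<equiv> speed_density lam \<beta> \<delta>"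

lemma ab: "a > 0" "0 < b" "b < 1" "c > 0"
  using lam \<beta> \<delta> h by (auto simp: a_def b_def c_def)

lemma Gammas: "Gamma a > 0" "Gamma b > 0" "Gamma (1 - b) > 0" "Gamma (1 + a - b) > 0"
  using ab by (auto intro: Gamma_real_pos)

lemma W_eq: "W = 2 * c powr (1 - b) * (Gamma b / Gamma a)"
proof -
  have "c powr (1 - b) = c * c powr (- b)" using powr_Suc_exponent[OF ab(4), of "1 - b"] by simp
  then show ?thesis unfolding W_def abs_wronskian_def Let_def a_def[symmetric] b_def[symmetric]
    by (simp add: c_def)
qed

lemma W_pos: "W > 0"
  unfolding W_eq using Gammas ab by simp

lemma c\<mu>_eq: "c\<^sub>\<mu> = - (1 / h) / (\<mu> * W + (1 / h) * kummer_U a b 0)"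
  by (simp add: c\<^sub>\<mu>_def c_sticky_def W_def a_def b_def)

lemma c\<mu>_denominator: "\<mu> * W + (1 / h) * kummer_U a b 0 > 0"
proof -
  have "\<mu> * W > 0" "(1 / h) * kummer_U a b 0 \<ge> 0"
    using \<mu> W_pos h kummer_U_bounds(1)[OF ab(1-3)] by auto
  then show ?thesis by linarith
qed

lemma c\<mu>_neg: "c\<^sub>\<mu> < 0"
  unfolding c\<mu>_eq using c\<mu>_denominator h by (intro divide_neg_pos) auto

text \<open>The definition of \<open>c\<^sub>\<mu>\<close> solved for the value of \<open>p\<close>
  at 0. Together with \<open>values_at_0\<close> it says p(0) = h \<mu> Fp(0): the constant is
  chosen so that \<open>p\<close> satisfies the stickiness condition.\<close>

lemma c\<mu>_relation: "1 + c\<^sub>\<mu> * kummer_U a b 0 = - c\<^sub>\<mu> * \<mu> * W * h"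
proof -
  define D where "D = \<mu> * W + (1 / h) * kummer_U a b 0"
  have D: "D \<noteq> 0" "kummer_U a b 0 = h * (D - \<mu> * W)" using c\<mu>_denominator h by (auto simp: D_def)
  have "c\<^sub>\<mu> = - (1 / h) / D" by (simp add: c\<mu>_eq D_def)
  then show ?thesis using D(1) h unfolding D(2) by (simp add: field_simps)
qed

text \<open>\<open>flux \<Phi> x\<close> is \<open>m'(x)/\<beta>\<close> times the \<open>x\<close>-derivative of \<open>w(z\<^sub>x)\<close>, where \<open>\<Phi>\<close> is the Kummer flux
  of \<open>w\<close>.\<close>

definition flux :: "(real \<Rightarrow> real) \<Rightarrow> real \<Rightarrow> real" where
  "flux \<Phi> x = 2 * c powr (1 - b) * (exp (- zvar lam \<beta> x) * \<Phi> (zvar lam \<beta> x))"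

lemma zvar_eq: "zvar lam \<beta> x = c * x\<^sup>2" by (simp add: zvar_def c_def)

lemma zvar_nonneg: "zvar lam \<beta> x \<ge> 0" using ab by (simp add: zvar_eq)

lemma zvar_pos: "x > 0 \<Longrightarrow> zvar lam \<beta> x > 0" using ab by (simp add: zvar_eq)

lemma zvar_deriv: "(zvar lam \<beta> has_real_derivative 2 * c * x) (at x)"
  unfolding zvar_eq[abs_def] by (auto intro!: derivative_eq_intros)

lemma zvar_powr: "x > 0 \<Longrightarrow> zvar lam \<beta> x powr s = c powr s * x powr (2 * s)"
proof -
  assume x: "x > 0"
  have "x\<^sup>2 = x powr 2" using x by simp
  then have "(x\<^sup>2) powr s = x powr (2 * s)" by (simp only: powr_powr)
  then show ?thesis using ab by (simp add: zvar_eq powr_mult)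
qed

lemma continuous_on_zvar: "continuous_on A (zvar lam \<beta>)"
  unfolding zvar_eq[abs_def] by (intro continuous_intros)

lemma continuous_on_zvar_compose: "continuous_on {0..} f \<Longrightarrow> continuous_on {0..} (\<lambda>x. f (zvar lam \<beta> x))"
  by (rule continuous_on_compose2[OF _ continuous_on_zvar]) (auto simp: zvar_nonneg)

lemma continuous_on_flux: "continuous_on {0..} \<Phi> \<Longrightarrow> continuous_on {0..} (flux \<Phi>)"
  unfolding flux_def[abs_def]
  by (intro continuous_on_mult continuous_on_const continuous_on_exp continuous_on_minus continuous_on_zvar
      continuous_on_zvar_compose)

text \<open>Under z = c x^2 Kummer's system becomes L w = w/h in divergence form, (r w')' = \<beta>
  r w / h. The parameter a = 1/(2 lam h) is what turns the constant 4 c a into \<beta>/h.\<close>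

lemma flux_derivs:
  assumes "kummer_system a b w \<Phi>" and x: "x > 0"
  shows "((\<lambda>x. w (zvar lam \<beta> x)) has_real_derivative flux \<Phi> x / r x) (at x)"
    and "(flux \<Phi> has_real_derivative (1 / h) * m' x * w (zvar lam \<beta> x)) (at x)"
proof -
  let ?z = "zvar lam \<beta> x"
  note z = zvar_pos[OF x]
  have dw: "(w has_real_derivative ?z powr (- b) * \<Phi> ?z) (at ?z)"
    and dF: "(\<Phi> has_real_derivative \<Phi> ?z + a * ?z powr (b - 1) * w ?z) (at ?z)"
    using assms(1) z by (auto simp: kummer_system_def)
  have "((\<lambda>x. w (zvar lam \<beta> x)) has_real_derivative (?z powr (- b) * \<Phi> ?z) * (2 * c * x)) (at x)"
    by (rule DERIV_chain2[where f = w and g = "zvar lam \<beta>", OF dw zvar_deriv])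
  also have "(?z powr (- b) * \<Phi> ?z) * (2 * c * x) = flux \<Phi> x / r x"
  proof -
    have "?z powr (- b) = c powr (- b) * x powr (- \<delta>)"
      using zvar_powr[OF x, of "- b"] by (simp add: b_def)
    moreover have "x powr (\<delta> - 1) * (x * x powr (- \<delta>)) = 1"
    proof -
      have "x powr (1 - \<delta>) = x * x powr (- \<delta>)" using powr_Suc_exponent[OF x, of "1 - \<delta>"] by simp
      moreover have "x powr (\<delta> - 1) * x powr (1 - \<delta>) = 1" using x by (simp add: powr_add[symmetric])
      ultimately show ?thesis by (simp only:)
    qed
    moreover have "c powr (1 - b) = c * c powr (- b)" using powr_Suc_exponent[OF ab(4), of "1 - b"] by simp
    moreover have "r x = x powr (\<delta> - 1) * exp (- ?z)" by (simp add: zvar_def r_def)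
    ultimately show ?thesis using x by (simp add: flux_def divide_simps) (simp add: algebra_simps)
  qed
  finally show "((\<lambda>x. w (zvar lam \<beta> x)) has_real_derivative flux \<Phi> x / r x) (at x)" .
  have "(flux \<Phi> has_real_derivative 2 * c powr (1 - b) *
     (exp (- ?z) * ((\<Phi> ?z + a * ?z powr (b - 1) * w ?z) * (2 * c * x)) - exp (- ?z) * (2 * c * x) * \<Phi> ?z)) (at x)"
    unfolding flux_def[abs_def]
    by (rule DERIV_cmult)
      (auto intro!: derivative_eq_intros DERIV_chain2[where f = \<Phi> and g = "zvar lam \<beta>", OF dF zvar_deriv] zvar_deriv)
  also have "2 * c powr (1 - b) *
     (exp (- ?z) * ((\<Phi> ?z + a * ?z powr (b - 1) * w ?z) * (2 * c * x)) - exp (- ?z) * (2 * c * x) * \<Phi> ?z)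
     = (4 * c * a) * (c powr (1 - b) * c powr (b - 1)) * (x * x powr (\<delta> - 2)) * exp (- ?z) * w ?z"
  proof -
    have "?z powr (b - 1) = c powr (b - 1) * x powr (\<delta> - 2)"
      using zvar_powr[OF x, of "b - 1"] by (simp add: b_def algebra_simps)
    then show ?thesis by (simp add: algebra_simps)
  qed
  also have "c powr (1 - b) * c powr (b - 1) = 1" using ab by (simp add: powr_add[symmetric])
  also have "x * x powr (\<delta> - 2) = x powr (\<delta> - 1)" using powr_Suc_exponent[OF x, of "\<delta> - 1"] by simp
  also have "4 * c * a * 1 * x powr (\<delta> - 1) * exp (- ?z) * w ?z = (1 / h) * m' x * w ?z"
    using lam h by (simp add: speed_density_def zvar_def c_def a_def)
  finally show "(flux \<Phi> has_real_derivative (1 / h) * m' x * w (zvar lam \<beta> x)) (at x)" .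
qed

text \<open>The two solutions from which the kernel is built: \<open>\<psi>\<close> is nonincreasing
  and its flux decays at infinity, \<open>p\<close> meets the stickiness condition at 0.
  \<open>F\<psi>\<close> and \<open>Fp\<close> are their fluxes.\<close>

definition \<psi> :: "real \<Rightarrow> real" where "\<psi> x = kummer_U a b (zvar lam \<beta> x)"
definition p :: "real \<Rightarrow> real" where "p x = f0_sticky lam \<beta> \<mu> \<delta> (1 / h) x"
definition F\<psi> :: "real \<Rightarrow> real" where "F\<psi> = flux (kummer_U_flux a b)"
definition Fp :: "real \<Rightarrow> real" where
  "Fp = flux (\<lambda>z. z powr b * kummer_M' a b z + c\<^sub>\<mu> * kummer_U_flux a b z)"

lemma p_eq: "p x = kummer_M a b (zvar lam \<beta> x) + c\<^sub>\<mu> * \<psi> x"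
  by (simp add: p_def f0_sticky_def Let_def \<psi>_def a_def b_def c\<^sub>\<mu>_def)

lemma p_system: "kummer_system a b (\<lambda>z. kummer_M a b z + c\<^sub>\<mu> * kummer_U a b z)
    (\<lambda>z. z powr b * kummer_M' a b z + c\<^sub>\<mu> * kummer_U_flux a b z)"
  using kummer_system_linear[OF kummer_system_M[of a b] kummer_system_U[of a b], of 1 "c\<^sub>\<mu>"] ab by simp

lemma \<psi>_deriv: "x > 0 \<Longrightarrow> (\<psi> has_real_derivative F\<psi> x / r x) (at x)"
  and F\<psi>_deriv: "x > 0 \<Longrightarrow> (F\<psi> has_real_derivative (1 / h) * m' x * \<psi> x) (at x)"
  using flux_derivs[OF kummer_system_U[OF ab(1-3)]] by (simp_all add: \<psi>_def[abs_def] F\<psi>_def)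

lemma p_deriv: "x > 0 \<Longrightarrow> (p has_real_derivative Fp x / r x) (at x)"
  and Fp_deriv: "x > 0 \<Longrightarrow> (Fp has_real_derivative (1 / h) * m' x * p x) (at x)"
  using flux_derivs[OF p_system] by (simp_all add: p_eq[abs_def] \<psi>_def[abs_def] Fp_def)

lemma continuous_on_parts:
  "continuous_on {0..} \<psi>" "continuous_on {0..} p" "continuous_on {0..} F\<psi>" "continuous_on {0..} Fp"
  "continuous_on {0..} m'"
proof -
  note U = continuous_on_kummer_U[OF ab(1-3)]
  show psi: "continuous_on {0..} \<psi>" unfolding \<psi>_def[abs_def] by (rule continuous_on_zvar_compose[OF U(1)])
  show "continuous_on {0..} p"
    unfolding p_eq[abs_def]
    by (intro continuous_on_add continuous_on_mult continuous_on_const psi continuous_on_kummer_M ab continuous_on_zvar)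
  show "continuous_on {0..} F\<psi>" unfolding F\<psi>_def by (rule continuous_on_flux[OF U(2)])
  show "continuous_on {0..} Fp" unfolding Fp_def
    by (intro continuous_on_flux continuous_on_add continuous_on_mult continuous_on_const U(2)
        continuous_on_kummer_M continuous_on_powr_nonneg ab continuous_on_id)
  show "continuous_on {0..} m'" unfolding speed_density_def[abs_def] using \<delta>
    by (intro continuous_on_mult continuous_on_const continuous_on_powr_nonneg continuous_intros) auto
qed

lemma m'_nonneg: "x \<ge> 0 \<Longrightarrow> m' x \<ge> 0" using \<beta> by (simp add: speed_density_def)

lemma r_pos: "x > 0 \<Longrightarrow> r x > 0" by (simp add: r_def)

lemma values_at_0: "\<psi> 0 = kummer_U a b 0" "p 0 = - c\<^sub>\<mu> * \<mu> * W * h" "F\<psi> 0 = - W" "Fp 0 = - c\<^sub>\<mu> * W"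
proof -
  show "\<psi> 0 = kummer_U a b 0" by (simp add: \<psi>_def zvar_def)
  then show "p 0 = - c\<^sub>\<mu> * \<mu> * W * h" using c\<mu>_relation by (simp add: p_eq zvar_def)
  show "F\<psi> 0 = - W" unfolding F\<psi>_def flux_def W_eq using ab by (simp add: zvar_def kummer_U_flux_0)
  moreover have "Fp 0 = c\<^sub>\<mu> * F\<psi> 0" unfolding F\<psi>_def Fp_def flux_def using ab by (simp add: zvar_def)
  ultimately show "Fp 0 = - c\<^sub>\<mu> * W" by simp
qed

lemma F\<psi>_bounds: "F\<psi> x \<le> 0" "\<bar>F\<psi> x\<bar> \<le> W * exp (- zvar lam \<beta> x)"
proof -
  note B = kummer_U_bounds[OF ab(1-3) zvar_nonneg[of x]]
  have k: "2 * c powr (1 - b) * exp (- zvar lam \<beta> x) \<ge> 0" by simp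
  have eq: "F\<psi> x = (2 * c powr (1 - b) * exp (- zvar lam \<beta> x)) * kummer_U_flux a b (zvar lam \<beta> x)"
    by (simp add: F\<psi>_def flux_def)
  show "F\<psi> x \<le> 0" unfolding eq by (rule mult_nonneg_nonpos[OF k B(2)])
  have "\<bar>F\<psi> x\<bar> = (2 * c powr (1 - b) * exp (- zvar lam \<beta> x)) * \<bar>kummer_U_flux a b (zvar lam \<beta> x)\<bar>"
    unfolding eq by (simp add: abs_mult)
  also have "\<dots> \<le> (2 * c powr (1 - b) * exp (- zvar lam \<beta> x)) * (Gamma b / Gamma a)"
    using B(2,3) by (intro mult_left_mono[OF _ k]) simp
  also have "\<dots> = W * exp (- zvar lam \<beta> x)" unfolding W_eq by simp
  finally show "\<bar>F\<psi> x\<bar> \<le> W * exp (- zvar lam \<beta> x)" .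
qed

lemma \<psi>_nonneg: "\<psi> x \<ge> 0"
  using kummer_U_bounds(1)[OF ab(1-3) zvar_nonneg] by (simp add: \<psi>_def)

lemma \<psi>_le: "\<psi> x \<le> \<psi> 0" if "x \<ge> 0"
proof (cases "x = 0")
  case False
  with that have x: "x > 0" by simp
  have "continuous_on {0..x} \<psi>" by (rule continuous_on_subset[OF continuous_on_parts(1)]) auto
  then obtain y where y: "0 < y" "\<psi> x - \<psi> 0 = (x - 0) * (F\<psi> y / r y)"
    using mean_value_interior[OF x, of \<psi> "\<lambda>y. F\<psi> y / r y"] \<psi>_deriv by auto
  have "F\<psi> y / r y \<le> 0" using F\<psi>_bounds(1)[of y] r_pos[OF y(1)] by (simp add: divide_nonpos_pos)
  then show ?thesis using y x mult_nonneg_nonpos[of x "F\<psi> y / r y"] by simp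
qed simp

text \<open>Since \<open>c\<^sub>\<mu>\<close> is negative, \<open>p\<close> is a difference. But M
  is at least 1 and \<open>\<psi>\<close> is largest at 0, so \<open>p\<close> is nowhere smaller
  than at 0, where \<open>c\<mu>_relation\<close> gives its sign.\<close>

lemma p_nonneg: "p x \<ge> 0" if x: "x \<ge> 0"
proof -
  have "0 \<le> (- c\<^sub>\<mu>) * (\<mu> * W * h)"
    using c\<mu>_neg \<mu> W_pos h by (intro mult_nonneg_nonneg) auto
  also have "\<dots> = 1 + c\<^sub>\<mu> * \<psi> 0" using c\<mu>_relation values_at_0 by simp
  also have "\<dots> \<le> p x"
    unfolding p_eq using kummer_M_ge_1[OF ab(1,2) zvar_nonneg[of x]] \<psi>_le[OF x] c\<mu>_neg
    by (intro add_mono mult_left_mono_neg) auto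
  finally show ?thesis .
qed

text \<open>In divergence form the equation has no first-order term, so no exponential factor is
  needed here. The constant is found at 0, where the contributions of \<open>c\<^sub>\<mu>\<close>
  cancel.\<close>

lemma wronskian:
  assumes "x \<ge> 0"
  shows "Fp x * \<psi> x - F\<psi> x * p x = W"
proof -
  have "((\<lambda>x. Fp x * \<psi> x - F\<psi> x * p x) has_real_derivative 0) (at x within {0<..})" if "x > 0" for x
  proof (rule has_field_derivative_at_within)
    show "((\<lambda>x. Fp x * \<psi> x - F\<psi> x * p x) has_real_derivative 0) (at x)"
      by (rule derivative_eq_intros Fp_deriv F\<psi>_deriv \<psi>_deriv p_deriv that refl)+ (simp add: field_simps)
  qed
  then obtain C where C: "\<And>x. x > 0 \<Longrightarrow> Fp x * \<psi> x - F\<psi> x * p x = C"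
    using has_field_derivative_zero_constant[of "{0<..}" "\<lambda>x. Fp x * \<psi> x - F\<psi> x * p x"] by auto
  have "continuous_on {0..} (\<lambda>x. Fp x * \<psi> x - F\<psi> x * p x)"
    by (intro continuous_intros continuous_on_parts)
  from tendsto_at_0_along_reciprocals[OF this]
  have "Fp 0 * \<psi> 0 - F\<psi> 0 * p 0 = C" by (simp add: C LIMSEQ_const_iff)
  moreover have "Fp 0 * \<psi> 0 - F\<psi> 0 * p 0 = W"
  proof -
    have "p 0 = 1 + c\<^sub>\<mu> * \<psi> 0" by (simp add: p_eq zvar_def)
    then show ?thesis by (simp add: values_at_0(3,4) algebra_simps)
  qed
  ultimately show ?thesis using C[of x] assms by (cases "x = 0") auto
qed

end

section \<open>Integrals over the half line\<close>

lemma set_integrable_closed_half_line: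
  fixes f :: "real \<Rightarrow> real"
  shows "set_integrable lborel {0..} f \<longleftrightarrow> set_integrable lborel {0<..} f"
  by (rule set_integrable_discrete_difference[of "{0}"]) (auto simp: countable_finite)

lemma set_integral_closed_half_line:
  fixes f :: "real \<Rightarrow> real"
  shows "(LBINT x:{0..}. f x) = (LBINT x:{0<..}. f x)"
  by (rule set_integral_discrete_difference[of "{0}"]) (auto simp: countable_finite)

text \<open>Completing the square gives d x - c x^2 <= (d+1)^2/(4c) - x, so a Gamma integrand
  dominates. The linear term is there to accommodate a drift potential of linear growth.\<close>

lemma gaussian_powr_integrable:
  fixes s c d :: real
  assumes "s > 0" "c > 0"
  shows "set_integrable lborel {0<..} (\<lambda>x. x powr (s - 1) * exp (d * x - c * x\<^sup>2))"
proof (rule set_integrable_bound)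
  let ?K = "exp ((d + 1)\<^sup>2 / (4 * c))"
  show "set_integrable lborel {0<..} (\<lambda>x. ?K * (x powr (s - 1) * exp (- (1 * x))))"
    using Gamma_integral_scaled(1)[of s 1] assms by (intro set_integrable_mult_right) auto
  show "AE x in lborel. x \<in> {0<..} \<longrightarrow> norm (x powr (s - 1) * exp (d * x - c * x\<^sup>2))
     \<le> norm (?K * (x powr (s - 1) * exp (- (1 * x))))"
  proof (intro AE_I2 impI)
    fix x :: real
    have "0 \<le> c * (x - (d + 1) / (2 * c))\<^sup>2" using assms by simp
    also have "\<dots> = c * x\<^sup>2 - (d + 1) * x + (d + 1)\<^sup>2 / (4 * c)"
      using assms by (simp add: power2_eq_square field_simps)
    finally have "exp (d * x - c * x\<^sup>2) \<le> exp ((d + 1)\<^sup>2 / (4 * c) + - (1 * x))"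
      by (simp add: algebra_simps)
    also have "\<dots> = ?K * exp (- (1 * x))" by (rule exp_add)
    finally have "x powr (s - 1) * exp (d * x - c * x\<^sup>2) \<le> x powr (s - 1) * (?K * exp (- (1 * x)))"
      by (rule mult_left_mono) simp
    then show "norm (x powr (s - 1) * exp (d * x - c * x\<^sup>2))
     \<le> norm (?K * (x powr (s - 1) * exp (- (1 * x))))" by (simp add: abs_mult mult_ac)
  qed
qed (auto simp: set_borel_measurable_def)

lemma set_integral_Icc_continuous:
  fixes f :: "real \<Rightarrow> real"
  assumes "continuous_on {0..s} f"
  shows "set_integrable lborel {0..s} f" "(LBINT x:{0..s}. f x) = integral {0..s} f"
proof -
  show i: "set_integrable lborel {0..s} f"
    unfolding set_integrable_def using borel_integrable_compact[of "{0..s}" f] assms by auto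
  show "(LBINT x:{0..s}. f x) = integral {0..s} f"
    using set_borel_integral_eq_integral(2)[OF i] .
qed

section \<open>The resolvent as an integral operator\<close>

context sticky_resolvent
begin

lemma m'_integrable: "set_integrable lborel {0..} m'"
  unfolding set_integrable_closed_half_line
  using set_integrable_mult_right[OF gaussian_powr_integrable[of \<delta> c 0], of \<beta>] \<delta> ab
  by (simp add: speed_density_def[abs_def] c_def mult.assoc)

definition density_at :: "real \<Rightarrow> real \<Rightarrow> real" where
  "density_at s y = (1 / h) * G_sticky lam \<beta> \<mu> \<delta> (1 / h) s y * m' y"

lemma density_at_eq: "density_at s y =
    (if y \<le> s then \<psi> s * (p y * m' y) else p s * (\<psi> y * m' y)) / (h * W)"
  by (auto simp: density_at_def G_sticky_def min_def max_def p_def \<psi>_def W_def a_def b_def)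

lemma resolvent_kernel_eq:
  "resolvent_kernel lam \<beta> \<mu> \<delta> h s = atom_plus_density (- c\<^sub>\<mu> * \<psi> s) (density_at s)"
  by (simp add: resolvent_kernel_def Let_def c\<^sub>\<mu>_def \<psi>_def a_def b_def density_at_def[abs_def])

lemma weight_nonneg: "- c\<^sub>\<mu> * \<psi> s \<ge> 0"
  using c\<mu>_neg \<psi>_nonneg[of s] by (simp add: mult_nonpos_nonneg)

lemma density_nonneg: "s \<ge> 0 \<Longrightarrow> y \<ge> 0 \<Longrightarrow> density_at s y \<ge> 0"
  unfolding density_at_eq using p_nonneg \<psi>_nonneg m'_nonneg W_pos h
  by (auto intro!: divide_nonneg_pos mult_nonneg_nonneg)

lemma borel_measurable_parts [measurable]:
  "\<psi> \<in> borel_measurable borel" "p \<in> borel_measurable borel" "m' \<in> borel_measurable borel"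
proof -
  have M: "kummer_M s t \<in> borel_measurable borel" if "s > 0" "t > 0" for s t
    using isCont_kummer_M(1)[OF that]
    by (intro borel_measurable_continuous_onI continuous_at_imp_continuous_on) auto
  have [measurable]: "kummer_M a b \<in> borel_measurable borel" "kummer_M (1 + a - b) (2 - b) \<in> borel_measurable borel"
    using ab by (auto intro!: M)
  have [measurable]: "kummer_U a b \<in> borel_measurable borel"
    unfolding kummer_U_def[abs_def] by measurable
  have [measurable]: "zvar lam \<beta> \<in> borel_measurable borel"
    unfolding zvar_def[abs_def] by measurable
  show [measurable]: "\<psi> \<in> borel_measurable borel" unfolding \<psi>_def[abs_def] by measurable
  show "p \<in> borel_measurable borel" unfolding p_eq[abs_def] by measurable
  show "m' \<in> borel_measurable borel" unfolding speed_density_def[abs_def] by measurable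
qed

lemma borel_measurable_density [measurable]: "density_at s \<in> borel_measurable borel"
  unfolding density_at_eq[abs_def] by measurable

lemma density_half_line: "density_at s \<in> borel_measurable half_line"
  unfolding half_line_def by (intro measurable_restrict_space1) measurable

text \<open>The coefficients in the variation-of-constants formula for the resolvent. The tail
  integral \<open>B\<close> is written as the total minus an initial piece, so that both are
  differentiated as integrals from 0.\<close>

definition A :: "(real \<Rightarrow> real) \<Rightarrow> real \<Rightarrow> real" where "A f s = integral {0..s} (\<lambda>y. p y * m' y * f y)"
definition B :: "(real \<Rightarrow> real) \<Rightarrow> real \<Rightarrow> real" where
  "B f s = (LBINT y:{0..}. \<psi> y * m' y * f y) - integral {0..s} (\<lambda>y. \<psi> y * m' y * f y)"

context
  fixes f :: "real \<Rightarrow> real" and C :: real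
  assumes f: "continuous_on {0..} f" and bound: "\<forall>x\<ge>0. \<bar>f x\<bar> \<le> C"
begin

lemma f_measurable: "f \<in> borel_measurable half_line"
  unfolding half_line_def using f by (rule borel_measurable_continuous_on_restrict)

lemma integrands_continuous:
  "continuous_on {0..} (\<lambda>y. p y * m' y * f y)" "continuous_on {0..} (\<lambda>y. \<psi> y * m' y * f y)"
  by (intro continuous_on_mult continuous_on_parts f)+

lemma tail_integrable: "set_integrable lborel {0..} (\<lambda>y. \<psi> y * m' y * f y)"
proof (rule set_integrable_bound)
  show "set_integrable lborel {0..} (\<lambda>y. (\<psi> 0 * C) * m' y)"
    using m'_integrable by (rule set_integrable_mult_right)
  show "AE y in lborel. y \<in> {0..} \<longrightarrow> norm (\<psi> y * m' y * f y) \<le> norm (\<psi> 0 * C * m' y)"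
  proof (intro AE_I2 impI)
    fix y :: real assume "y \<in> {0..}"
    then have y: "y \<ge> 0" by simp
    have "\<psi> y * \<bar>f y\<bar> \<le> \<psi> 0 * C"
      using \<psi>_le[OF y] bound[rule_format, OF y] \<psi>_nonneg by (intro mult_mono) auto
    then have "m' y * (\<psi> y * \<bar>f y\<bar>) \<le> m' y * (\<psi> 0 * C)" using m'_nonneg[OF y] by (rule mult_left_mono)
    also have "\<dots> \<le> \<bar>m' y * (\<psi> 0 * C)\<bar>" by simp
    finally show "norm (\<psi> y * m' y * f y) \<le> norm (\<psi> 0 * C * m' y)"
      using m'_nonneg[OF y] \<psi>_nonneg[of y] by (simp add: abs_mult mult_ac)
  qed
  show "set_borel_measurable lborel {0..} (\<lambda>y. \<psi> y * m' y * f y)"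
    unfolding set_borel_measurable_def
    using borel_measurable_continuous_on_indicator[OF _ integrands_continuous(2)] by auto
qed

lemma density_integral:
  assumes s: "s \<ge> 0"
  shows "set_integrable lborel {0..} (\<lambda>y. density_at s y * f y)"
    and "(LBINT y:{0..}. density_at s y * f y) = (\<psi> s * A f s + p s * B f s) / (h * W)"
proof -
  let ?k1 = "\<lambda>y. p y * m' y * f y" and ?k2 = "\<lambda>y. \<psi> y * m' y * f y" and ?d = "\<lambda>y. density_at s y * f y"
  have c1: "continuous_on {0..s} ?k1" and c2: "continuous_on {0..s} ?k2"
    by (rule continuous_on_subset[OF integrands_continuous(1)], simp)
       (rule continuous_on_subset[OF integrands_continuous(2)], simp)
  note I1 = set_integral_Icc_continuous[OF c1] and I2 = set_integral_Icc_continuous[OF c2]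
  have T: "set_integrable lborel {s<..} ?k2"
    using s by (intro set_integrable_subset[OF tail_integrable]) auto
  have split: "{0..} = {0..s} \<union> {s<..}" using s by auto
  have T2: "(LBINT y:{s<..}. ?k2 y) = B f s"
  proof -
    have "{0..s} \<inter> {s<..} = {}" by auto
    from set_integral_Un[OF this I2(1) T] show ?thesis unfolding B_def I2(2)[symmetric] by (simp add: split)
  qed
  have e1: "?d y = \<psi> s / (h * W) * ?k1 y" if "y \<in> {0..s}" for y using that by (simp add: density_at_eq)
  have e2: "?d y = p s / (h * W) * ?k2 y" if "y \<in> {s<..}" for y using that by (simp add: density_at_eq)
  have D1: "set_integrable lborel {0..s} ?d" "(LBINT y:{0..s}. ?d y) = \<psi> s / (h * W) * A f s"
    using I1 set_lebesgue_integral_cong[of "{0..s}" lborel ?d "\<lambda>y. \<psi> s / (h * W) * ?k1 y"] e1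
      set_integrable_cong[of lborel lborel "{0..s}" "{0..s}" ?d "\<lambda>y. \<psi> s / (h * W) * ?k1 y"]
    by (auto simp: A_def)
  have D2: "set_integrable lborel {s<..} ?d" "(LBINT y:{s<..}. ?d y) = p s / (h * W) * B f s"
    using T T2 set_lebesgue_integral_cong[of "{s<..}" lborel ?d "\<lambda>y. p s / (h * W) * ?k2 y"] e2
      set_integrable_cong[of lborel lborel "{s<..}" "{s<..}" ?d "\<lambda>y. p s / (h * W) * ?k2 y"]
    by auto
  show "set_integrable lborel {0..} ?d"
    unfolding split using D1(1) D2(1) by (rule set_integrable_Un) auto
  have "(LBINT y:{0..s} \<union> {s<..}. ?d y) = \<psi> s / (h * W) * A f s + p s / (h * W) * B f s"
  proof -
    have "{0..s} \<inter> {s<..} = {}" by auto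
    from set_integral_Un[OF this D1(1) D2(1)] show ?thesis using D1(2) D2(2) by simp
  qed
  then show "(LBINT y:{0..}. ?d y) = (\<psi> s * A f s + p s * B f s) / (h * W)"
    by (simp add: split add_divide_distrib)
qed

lemma resolvent_integral:
  assumes "s \<ge> 0"
  shows "integrable (resolvent_kernel lam \<beta> \<mu> \<delta> h s) f"
    and "(\<integral>y. f y \<partial>resolvent_kernel lam \<beta> \<mu> \<delta> h s)
      = - c\<^sub>\<mu> * \<psi> s * f 0 + (\<psi> s * A f s + p s * B f s) / (h * W)"
  unfolding resolvent_kernel_eq
  using integral_atom_plus_density[OF density_half_line density_nonneg[OF assms] weight_nonneg f_measurable
      density_integral(1)[OF assms]] density_integral(2)[OF assms] by auto

lemma AB_derivs:
  assumes s: "s > 0"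
  shows "(A f has_real_derivative p s * m' s * f s) (at s)"
    and "(B f has_real_derivative - (\<psi> s * m' s * f s)) (at s)"
proof -
  have D: "((\<lambda>u. integral {0..u} k) has_real_derivative k s) (at s)" if "continuous_on {0..} k" for k :: "real \<Rightarrow> real"
  proof -
    have c: "continuous_on {0..s + 1} k" by (rule continuous_on_subset[OF that]) auto
    have "((\<lambda>u. integral {0..u} k) has_real_derivative k s) (at s within {0..s + 1})"
      using integral_has_real_derivative[OF c, of s] s by simp
    then show ?thesis using s at_within_Icc_at[of 0 s "s + 1"] by simp
  qed
  show "(A f has_real_derivative p s * m' s * f s) (at s)"
    unfolding A_def[abs_def] by (rule D[OF integrands_continuous(1)])
  show "(B f has_real_derivative - (\<psi> s * m' s * f s)) (at s)"
    unfolding B_def[abs_def] by (rule derivative_eq_intros D[OF integrands_continuous(2)] refl | simp)+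
qed

lemma AB_continuous: "continuous_on {0..} (A f)" "continuous_on {0..} (B f)"
proof -
  have D: "continuous_on {0..} (\<lambda>u. integral {0..u} k)" if k: "continuous_on {0..} k" for k :: "real \<Rightarrow> real"
    unfolding continuous_on_eq_continuous_within
  proof
    fix s :: real assume s: "s \<in> {0..}"
    have c: "continuous_on {0..s + 1} k" by (rule continuous_on_subset[OF k]) auto
    have "continuous_on {0..s + 1} (\<lambda>u. integral {0..u} k)"
      by (intro indefinite_integral_continuous_1 integrable_continuous_real c)
    then have "continuous (at s within {0..s + 1}) (\<lambda>u. integral {0..u} k)"
      using s by (auto simp: continuous_on_eq_continuous_within)
    moreover have "at s within {0..s + 1} = at s within {0..}"
      using s by (intro at_within_nhd[of _ "{s - 1<..<s + 1}"]) auto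
    ultimately show "continuous (at s within {0..}) (\<lambda>u. integral {0..u} k)" by simp
  qed
  show "continuous_on {0..} (A f)" unfolding A_def[abs_def] by (rule D[OF integrands_continuous(1)])
  show "continuous_on {0..} (B f)" unfolding B_def[abs_def]
    by (intro continuous_on_diff continuous_on_const D[OF integrands_continuous(2)])
qed

lemma A_0: "A f 0 = 0" by (simp add: A_def)

end

lemma F\<psi>_tendsto: "(F\<psi> \<longlongrightarrow> 0) at_top"
proof (rule Lim_null_comparison)
  show "\<forall>\<^sub>F x in at_top. norm (F\<psi> x) \<le> W * exp (- zvar lam \<beta> x)" using F\<psi>_bounds(2) by simp
  show "((\<lambda>x. W * exp (- zvar lam \<beta> x)) \<longlongrightarrow> 0) at_top"
    unfolding zvar_eq using ab W_pos by real_asymp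
qed

text \<open>For f = 1 the integrands are \<open>h\<close> times the derivatives of the fluxes, so
  both integrals are increments of fluxes; at infinity the flux of \<open>\<psi>\<close>
  vanishes.\<close>

lemma AB_const: "s \<ge> 0 \<Longrightarrow> A (\<lambda>_. 1) s = h * (Fp s - Fp 0)" "s \<ge> 0 \<Longrightarrow> B (\<lambda>_. 1) s = - h * F\<psi> s"
proof -
  have I: "integral {0..s} (\<lambda>y. w y * m' y) = h * (F s - F 0)"
    if s: "s \<ge> 0" and D: "\<And>x. x > 0 \<Longrightarrow> (F has_real_derivative (1 / h) * m' x * w x) (at x)"
      and c: "continuous_on {0..} F" for F w s
  proof -
    have "((\<lambda>y. (1 / h) * m' y * w y) has_integral (F s - F 0)) {0..s}"
      using s D continuous_on_subset[OF c, of "{0..s}"]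
      by (intro fundamental_theorem_of_calculus_interior)
         (auto simp: has_real_derivative_iff_has_vector_derivative[symmetric])
    from has_integral_mult_right[OF this, of h] show ?thesis
      using h by (intro integral_unique) (simp add: mult.commute)
  qed
  show "A (\<lambda>_. 1) s = h * (Fp s - Fp 0)" if "s \<ge> 0"
    using I[OF that Fp_deriv] continuous_on_parts by (simp add: A_def)
  have "(LBINT y:{0..}. \<psi> y * m' y) = h * (LBINT y:{0<..}. (1 / h) * m' y * \<psi> y)"
    using h unfolding set_integral_closed_half_line by (subst set_integral_mult_right[symmetric]) (simp add: mult.commute)
  also have "(LBINT y:{0<..}. (1 / h) * m' y * \<psi> y) = 0 - F\<psi> 0"
  proof (rule FTC_positive_half_line)
    show "isCont (\<lambda>y. (1 / h) * m' y * \<psi> y) x" if "x > 0" for x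
      by (intro continuous_on_interior[of "{0..}"] continuous_on_mult continuous_on_const continuous_on_parts)
         (use that in auto)
    show "set_integrable lborel {0<..} (\<lambda>y. (1 / h) * m' y * \<psi> y)"
      using set_integrable_mult_right[OF tail_integrable[of "\<lambda>_. 1" 1], of "1 / h"]
      unfolding set_integrable_closed_half_line by (simp add: mult_ac)
    show "(F\<psi> \<longlongrightarrow> F\<psi> 0) (at_right 0)"
      using continuous_on_parts(3) by (auto simp: continuous_on intro: tendsto_within_subset[of _ _ _ "{0..}"])
  qed (rule F\<psi>_deriv F\<psi>_tendsto; assumption)+
  finally have tot: "(LBINT y:{0..}. \<psi> y * m' y) = - h * F\<psi> 0" by simp
  show "B (\<lambda>_. 1) s = - h * F\<psi> s" if "s \<ge> 0"
    using I[OF that F\<psi>_deriv] continuous_on_parts tot by (simp add: B_def algebra_simps)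
qed

text \<open>With the integrals of the constant 1 known, the density part has mass 1 +
  \<open>c\<^sub>\<mu> * \<psi> s\<close> by the Wronskian; the second summand stems from the flux
  of \<open>p\<close> at 0 and is exactly compensated by the atom.\<close>

lemma resolvent_mass:
  assumes s: "s \<ge> 0"
  shows "prob_space (resolvent_kernel lam \<beta> \<mu> \<delta> h s)"
proof
  have c1: "continuous_on {0..} (\<lambda>_::real. 1::real)" by simp
  have c2: "\<forall>x\<ge>0. \<bar>1::real\<bar> \<le> 1" by simp
  note R = resolvent_integral[OF c1 c2 s]
  have "- c\<^sub>\<mu> * \<psi> s + (\<psi> s * A (\<lambda>_. 1) s + p s * B (\<lambda>_. 1) s) / (h * W) = 1"
  proof -
    have "\<psi> s * A (\<lambda>_. 1) s + p s * B (\<lambda>_. 1) s = h * ((Fp s * \<psi> s - F\<psi> s * p s) + \<psi> s * (c\<^sub>\<mu> * W))"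
      using AB_const[OF s] by (simp add: values_at_0 algebra_simps)
    also have "\<dots> = h * W * (1 + c\<^sub>\<mu> * \<psi> s)" unfolding wronskian[OF s] by (simp add: algebra_simps)
    finally show ?thesis using h W_pos by simp
  qed
  then have "(\<integral>y. (1::real) \<partial>resolvent_kernel lam \<beta> \<mu> \<delta> h s) = 1"
    using R(2) by (simp only: mult_1_right)
  then have "measure (resolvent_kernel lam \<beta> \<mu> \<delta> h s) (space (resolvent_kernel lam \<beta> \<mu> \<delta> h s)) = 1" by simp
  moreover have "emeasure (resolvent_kernel lam \<beta> \<mu> \<delta> h s) (space (resolvent_kernel lam \<beta> \<mu> \<delta> h s)) < \<infinity>"
    using R(1) by (simp add: integrable_iff_bounded)
  ultimately show "emeasure (resolvent_kernel lam \<beta> \<mu> \<delta> h s) (space (resolvent_kernel lam \<beta> \<mu> \<delta> h s)) = 1"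
    by (simp add: emeasure_eq_ennreal_measure less_top[symmetric])
qed

lemma resolvent_measurable: "resolvent_kernel lam \<beta> \<mu> \<delta> h \<in> measurable half_line (prob_algebra half_line)"
proof (rule measurable_prob_algebraI)
  show "prob_space (resolvent_kernel lam \<beta> \<mu> \<delta> h s)" if "s \<in> space half_line" for s
    using that by (intro resolvent_mass) simp
  show "resolvent_kernel lam \<beta> \<mu> \<delta> h \<in> measurable half_line (subprob_algebra half_line)"
  proof (rule measurable_subprob_algebra)
    show "subprob_space (resolvent_kernel lam \<beta> \<mu> \<delta> h s)" if "s \<in> space half_line" for s
      using that by (intro prob_space_imp_subprob_space resolvent_mass) simp
    show "sets (resolvent_kernel lam \<beta> \<mu> \<delta> h s) = sets half_line" for s
      by (simp add: resolvent_kernel_eq)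
    fix X assume X: "X \<in> sets half_line"
    then have [measurable]: "X \<in> sets borel" using sets_half_lineD by auto
    have [measurable]: "(\<lambda>x. density_at (fst x) (snd x)) \<in> borel_measurable (borel \<Otimes>\<^sub>M borel)"
      unfolding density_at_eq by measurable
    have "(\<lambda>s. ennreal (- c\<^sub>\<mu> * \<psi> s) * indicator X 0 + (\<integral>\<^sup>+y. ennreal (density_at (fst (s, y)) (snd (s, y))) * indicator X y \<partial>lborel))
       \<in> borel_measurable borel"
      by measurable
    then have "(\<lambda>s. emeasure (resolvent_kernel lam \<beta> \<mu> \<delta> h s) X) \<in> borel_measurable borel"
      by (simp add: resolvent_kernel_eq emeasure_atom_plus_density[OF density_half_line X])
    then show "(\<lambda>s. emeasure (resolvent_kernel lam \<beta> \<mu> \<delta> h s) X) \<in> borel_measurable half_line"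
      unfolding half_line_def by (rule measurable_restrict_space1)
  qed
qed

text \<open>Variation of constants. The flux of g is obtained by replacing \<open>\<psi>\<close> and
  \<open>p\<close> in the formula for g by their fluxes. In the derivative of g the terms from
  \<open>A f\<close> and \<open>B f\<close> cancel; in the derivative of the flux they combine to
  the Wronskian and produce the inhomogeneity -f. The value of the flux at 0 is the stickiness
  condition.\<close>

theorem resolvent_equation:
  assumes f: "continuous_on {0..} f" and bound: "\<forall>x\<ge>0. \<bar>f x\<bar> \<le> C"
  defines "g \<equiv> \<lambda>s. \<integral>y. f y \<partial>resolvent_kernel lam \<beta> \<mu> \<delta> h s"
  obtains F where
    "continuous_on {0..} g"
    "\<And>x. x \<ge> 0 \<Longrightarrow> \<bar>g x\<bar> \<le> C"
    "\<And>x. x > 0 \<Longrightarrow> (g has_real_derivative F x / r x) (at x)"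
    "\<And>x. x > 0 \<Longrightarrow> (F has_real_derivative m' x * ((g x - f x) / h)) (at x)"
    "continuous_on {0..} F"
    "F 0 = (g 0 - f 0) / (h * \<mu>)"
proof
  define F where "F s = - c\<^sub>\<mu> * F\<psi> s * f 0 + (F\<psi> s * A f s + Fp s * B f s) / (h * W)" for s
  have hW: "h * W > 0" using h W_pos by simp
  note R = resolvent_integral[OF f bound]
  have g: "g s = - c\<^sub>\<mu> * \<psi> s * f 0 + (\<psi> s * A f s + p s * B f s) / (h * W)" if "s \<ge> 0" for s
    unfolding g_def by (rule R(2)[OF that])
  note ABd = AB_derivs[OF f bound] and ABc = AB_continuous[OF f bound]
  have "continuous_on {0..} (\<lambda>s. - c\<^sub>\<mu> * \<psi> s * f 0 + (\<psi> s * A f s + p s * B f s) / (h * W))"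
    using hW by (intro continuous_on_add continuous_on_mult continuous_on_const continuous_on_divide continuous_on_parts ABc) auto
  then show "continuous_on {0..} g" by (rule continuous_on_eq) (use g in auto)
  show "continuous_on {0..} F"
    unfolding F_def[abs_def] using hW
    by (intro continuous_on_add continuous_on_mult continuous_on_const continuous_on_divide continuous_on_parts ABc) auto
  show "\<bar>g x\<bar> \<le> C" if x: "x \<ge> 0" for x
  proof -
    interpret prob_space "resolvent_kernel lam \<beta> \<mu> \<delta> h x" by (rule resolvent_mass[OF x])
    have sp: "space (resolvent_kernel lam \<beta> \<mu> \<delta> h x) = {0..}" by (simp add: resolvent_kernel_eq)
    have "\<bar>g x\<bar> \<le> (\<integral>y. \<bar>f y\<bar> \<partial>resolvent_kernel lam \<beta> \<mu> \<delta> h x)"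
      unfolding g_def by (rule integral_abs_bound)
    also have "\<dots> \<le> (\<integral>y. C \<partial>resolvent_kernel lam \<beta> \<mu> \<delta> h x)"
      using R(1)[OF x] bound sp by (intro integral_mono) auto
    finally show ?thesis by (simp add: prob_space)
  qed
  have rr: "r x > 0" if "x > 0" for x using r_pos[OF that] .
  show "(g has_real_derivative F x / r x) (at x)" if x: "x > 0" for x
  proof -
    have "((\<lambda>s. - c\<^sub>\<mu> * \<psi> s * f 0 + (\<psi> s * A f s + p s * B f s) / (h * W)) has_real_derivative
       - c\<^sub>\<mu> * (F\<psi> x / r x) * f 0 + ((F\<psi> x / r x) * A f x + (p x * m' x * f x) * \<psi> x
         + ((Fp x / r x) * B f x + - (\<psi> x * m' x * f x) * p x)) / (h * W)) (at x)"
      by (intro DERIV_add DERIV_cdivide DERIV_cmult DERIV_cmult_right DERIV_mult \<psi>_deriv p_deriv ABd x)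
    also have "- c\<^sub>\<mu> * (F\<psi> x / r x) * f 0 + ((F\<psi> x / r x) * A f x + (p x * m' x * f x) * \<psi> x
         + ((Fp x / r x) * B f x + - (\<psi> x * m' x * f x) * p x)) / (h * W) = F x / r x"
      unfolding F_def add_divide_distrib diff_divide_distrib
      by (simp add: mult.commute[of "r x"])
    finally have "((\<lambda>s. - c\<^sub>\<mu> * \<psi> s * f 0 + (\<psi> s * A f s + p s * B f s) / (h * W)) has_real_derivative F x / r x) (at x)" .
    moreover have "\<forall>\<^sub>F s in nhds x. - c\<^sub>\<mu> * \<psi> s * f 0 + (\<psi> s * A f s + p s * B f s) / (h * W) = g s"
      using eventually_nhds_in_open[of "{0<..}" x] x by (auto elim!: eventually_mono simp: g)
    ultimately show ?thesis by (subst (asm) DERIV_cong_ev[OF refl _ refl]) auto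
  qed
  show "(F has_real_derivative m' x * ((g x - f x) / h)) (at x)" if x: "x > 0" for x
  proof -
    have "(F has_real_derivative
       - c\<^sub>\<mu> * ((1 / h) * m' x * \<psi> x) * f 0 + (((1 / h) * m' x * \<psi> x) * A f x + (p x * m' x * f x) * F\<psi> x
         + (((1 / h) * m' x * p x) * B f x + - (\<psi> x * m' x * f x) * Fp x)) / (h * W)) (at x)"
      unfolding F_def[abs_def]
      by (intro DERIV_add DERIV_cdivide DERIV_cmult DERIV_cmult_right DERIV_mult F\<psi>_deriv Fp_deriv ABd x)
    also have "- c\<^sub>\<mu> * ((1 / h) * m' x * \<psi> x) * f 0 + (((1 / h) * m' x * \<psi> x) * A f x + (p x * m' x * f x) * F\<psi> x
         + (((1 / h) * m' x * p x) * B f x + - (\<psi> x * m' x * f x) * Fp x)) / (h * W)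
      = (1 / h) * m' x * g x - m' x * f x * (Fp x * \<psi> x - F\<psi> x * p x) / (h * W)"
      using x by (subst g) (simp_all add: add_divide_distrib diff_divide_distrib algebra_simps)
    also have "\<dots> = m' x * ((g x - f x) / h)"
      using wronskian[of x] x hW W_pos h by (simp add: diff_divide_distrib algebra_simps)
    finally show ?thesis .
  qed
  show "F 0 = (g 0 - f 0) / (h * \<mu>)"
  proof -
    have F0: "F 0 = c\<^sub>\<mu> * W * f 0 - c\<^sub>\<mu> / h * B f 0"
      unfolding F_def using A_0[OF f bound] hW W_pos h by (simp add: values_at_0 algebra_simps)
    \<comment> \<open>Here the choice of \<open>c\<^sub>\<mu>\<close> enters: by
      \<open>c\<mu>_relation\<close> the coefficient of f(0) acquires the factor \<mu>, as that of B
      f 0 already has, so that g(0) - f(0) is a multiple of the flux.\<close>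
    have "g 0 - f 0 = - (1 + c\<^sub>\<mu> * kummer_U a b 0) * f 0 - c\<^sub>\<mu> * \<mu> * B f 0"
      using g[of 0] A_0[OF f bound] hW W_pos h by (simp add: values_at_0 algebra_simps)
    also have "\<dots> = c\<^sub>\<mu> * \<mu> * W * h * f 0 - c\<^sub>\<mu> * \<mu> * B f 0" unfolding c\<mu>_relation by simp
    also have "\<dots> = (h * \<mu>) * F 0" unfolding F0 using h by (simp add: algebra_simps)
    finally show ?thesis using h \<mu> by simp
  qed
qed

end

section \<open>Gradient bounds\<close>

text \<open>\<open>B\<close> and \<open>B1\<close> bound \<open>G'\<close> and \<open>G''\<close>; \<open>Cf\<close> is the constant in the bound on the partial sums \<open>f\<close>
  below, and \<open>\<omega>\<close> is the weight that controls derivatives of resolvents.\<close>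

locale drift_setting =
  fixes lam \<beta> \<mu> \<delta> B B1 Cf :: real and G G' :: "real \<Rightarrow> real"
  assumes lam: "lam > 0" and \<beta>: "\<beta> > 0" and \<mu>: "\<mu> > 0" and \<delta>: "1 < \<delta>" "\<delta> < 2"
    and B: "B \<ge> 0" "\<And>x. x \<ge> 0 \<Longrightarrow> \<bar>G' x\<bar> \<le> B"
    and B1: "B1 \<ge> 0" "\<And>x. x \<ge> 0 \<Longrightarrow> \<bar>G' x - G' 0\<bar> \<le> B1 * x"
    and G: "\<And>x. x \<ge> 0 \<Longrightarrow> (G has_real_derivative G' x) (at x within {0..})"
    and G'_continuous: "continuous_on {0..} G'"
    and Cf: "Cf \<ge> 0"
begin

definition c :: real where "c = lam * \<beta> / 2"
definition r :: "real \<Rightarrow> real" where "r x = x powr (\<delta> - 1) * exp (- lam * \<beta> * x\<^sup>2 / 2)"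
text \<open>The power x^(1-\<delta>) is the blow-up at 0 of g' = F/r when the flux does not vanish
  there; x^2 is the growth that the weight in (E) allows at infinity.\<close>

definition \<omega> :: "real \<Rightarrow> real" where "\<omega> x = x powr (1 - \<delta>) + x\<^sup>2"
text \<open>\<open>K1\<close> arises from integrating \<open>\<omega>\<close> from 0 up to a point
  of [0,1]. \<open>C1\<close> is 2 * 5 * B * \<open>K1\<close>: two increments of g through 0, on
  the scale 5 B h. \<open>\<epsilon>\<close> is the interpolation length, small enough for the
  absorption in \<open>D_le_absorb\<close>, and \<open>K2\<close> is the resulting constant in the
  gradient bound.\<close>

definition K1 :: real where "K1 = 1 / (2 - \<delta>) + 1"
definition C1 :: real where "C1 = 10 * B * K1"
definition \<epsilon> :: real where "\<epsilon> = min 1 (1 / (16 * \<beta> * (C1 + 1) * exp c))"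
definition K2 :: real where "K2 = 2 * (exp c * (1 / \<mu> + \<beta>) + (72 * (Cf + 1) / \<epsilon> + 2 * \<beta>))"

lemma c_pos: "c > 0" using lam \<beta> by (simp add: c_def)

lemma r_eq: "r x = x powr (\<delta> - 1) * exp (- c * x\<^sup>2)" by (simp add: r_def c_def)

lemma r_pos: "x > 0 \<Longrightarrow> r x > 0" by (simp add: r_def)

lemma constants: "K1 \<ge> 2" "C1 \<ge> 0" "\<epsilon> > 0" "\<epsilon> \<le> 1" "16 * \<beta> * (C1 + 1) * exp c * \<epsilon> \<le> 1" "C1 \<ge> 2 * B"
proof -
  have "1 / (2 - \<delta>) \<ge> 1" using \<delta> by (simp add: field_simps)
  then show K1: "K1 \<ge> 2" by (simp add: K1_def)
  then show C1: "C1 \<ge> 0" using B by (simp add: C1_def)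
  have "10 * B * K1 \<ge> 10 * B * 2" using K1 B by (intro mult_left_mono) auto
  then show "C1 \<ge> 2 * B" using B by (simp add: C1_def)
  define X where "X = 16 * \<beta> * (C1 + 1) * exp c"
  have D: "X > 0" unfolding X_def using \<beta> C1 by (intro mult_pos_pos) auto
  have \<epsilon>: "\<epsilon> = min 1 (1 / X)" by (simp add: \<epsilon>_def X_def)
  then show "\<epsilon> > 0" "\<epsilon> \<le> 1" using D by (auto simp: \<epsilon>)
  have "\<epsilon> \<le> 1 / X" by (simp add: \<epsilon>)
  then have "X * \<epsilon> \<le> 1" using D by (simp add: field_simps)
  then show "16 * \<beta> * (C1 + 1) * exp c * \<epsilon> \<le> 1" by (simp add: X_def)
qed

lemma K2_nonneg: "K2 \<ge> 0"
  unfolding K2_def using \<mu> \<beta> Cf constants by (intro mult_nonneg_nonneg add_nonneg_nonneg divide_nonneg_pos) auto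

lemma \<omega>_nonneg: "\<omega> x \<ge> 0" by (simp add: \<omega>_def)

lemma \<omega>_ge_powr: "\<omega> x \<ge> x powr (1 - \<delta>)" by (simp add: \<omega>_def)

lemma \<omega>_ge_1: "x > 0 \<Longrightarrow> \<omega> x \<ge> 1"
proof (cases "x \<le> 1")
  case True
  assume "x > 0"
  then have "1 powr (1 - \<delta>) \<le> x powr (1 - \<delta>)" using True \<delta> by (intro powr_mono2') auto
  then show ?thesis by (simp add: \<omega>_def add_increasing2)
next
  case False
  then have "x\<^sup>2 \<ge> 1" by (simp add: power2_eq_square mult_ge1_I)
  then show ?thesis by (simp add: \<omega>_def add_increasing)
qed

lemma \<omega>_scale:
  assumes "x > 0" "3 / 4 * x \<le> y" "y \<le> 2 * x"
  shows "\<omega> y \<le> 4 * \<omega> x" "y \<le> 5 / 4 * x \<Longrightarrow> \<omega> y \<le> 2 * \<omega> x"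
proof -
  have "y powr (1 - \<delta>) \<le> (3 / 4 * x) powr (1 - \<delta>)" using assms \<delta> by (intro powr_mono2') auto
  also have "\<dots> = (3 / 4) powr (1 - \<delta>) * x powr (1 - \<delta>)" by (rule powr_mult)
  also have "\<dots> \<le> 2 * x powr (1 - \<delta>)"
  proof (rule mult_right_mono)
    have "(3 / 4 :: real) powr (1 - \<delta>) \<le> (3 / 4) powr (- 1)" using \<delta> by (intro powr_mono') auto
    also have "\<dots> = 4 / 3" by (simp add: powr_minus)
    finally show "(3 / 4) powr (1 - \<delta>) \<le> 2" by simp
  qed simp
  finally have 1: "y powr (1 - \<delta>) \<le> 2 * x powr (1 - \<delta>)" .
  have "y\<^sup>2 \<le> (2 * x)\<^sup>2" using assms by (intro power_mono) auto
  then have 2: "y\<^sup>2 \<le> 4 * x\<^sup>2" by (simp add: power_mult_distrib)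
  have p: "x powr (1 - \<delta>) \<ge> 0" by simp
  show "\<omega> y \<le> 4 * \<omega> x" unfolding \<omega>_def distrib_left using 1 2 p by linarith
  assume "y \<le> 5 / 4 * x"
  then have "y\<^sup>2 \<le> (5 / 4 * x)\<^sup>2" using assms by (intro power_mono) auto
  then have "y\<^sup>2 \<le> 25 / 16 * x\<^sup>2" by (simp add: power_mult_distrib power_divide)
  then have "y\<^sup>2 \<le> 2 * x\<^sup>2" using zero_le_power2[of x] by linarith
  then show "\<omega> y \<le> 2 * \<omega> x" unfolding \<omega>_def distrib_left using 1 by linarith
qed

lemma r_le: "x \<ge> 0 \<Longrightarrow> r x \<le> x powr (\<delta> - 1)"
  unfolding r_eq using c_pos by (intro mult_left_le) auto

lemma powr_le_2: "0 < x \<Longrightarrow> x \<le> 2 \<Longrightarrow> x powr (\<delta> - 1) \<le> 2"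
proof -
  assume x: "0 < x" "x \<le> 2"
  have "x powr (\<delta> - 1) \<le> 2 powr (\<delta> - 1)" using x \<delta> by (intro powr_mono2) auto
  also have "\<dots> \<le> 2 powr 1" using \<delta> by (intro powr_mono) auto
  finally show ?thesis by simp
qed

lemma powr_\<omega>: "x > 0 \<Longrightarrow> x powr (\<delta> - 1) * \<omega> x = 1 + x powr (\<delta> - 1) * x\<^sup>2"
  by (simp add: \<omega>_def distrib_left powr_add[symmetric])

lemma r_\<omega>_le: "0 < x \<Longrightarrow> x \<le> 2 \<Longrightarrow> r x * \<omega> x \<le> 9" "0 < x \<Longrightarrow> x \<le> 1 \<Longrightarrow> x powr (\<delta> - 1) * \<omega> x \<le> 2"
proof -
  assume x: "0 < x" "x \<le> 2"
  have "r x * \<omega> x \<le> x powr (\<delta> - 1) * \<omega> x" using r_le[of x] x \<omega>_nonneg by (intro mult_right_mono) auto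
  also have "\<dots> = 1 + x powr (\<delta> - 1) * x\<^sup>2" using x by (simp add: powr_\<omega>)
  also have "x powr (\<delta> - 1) * x\<^sup>2 \<le> 2 * 2\<^sup>2"
    using powr_le_2[OF x] x by (intro mult_mono power_mono) auto
  finally show "r x * \<omega> x \<le> 9" by simp
next
  assume x: "0 < x" "x \<le> 1"
  have "x powr (\<delta> - 1) \<le> 1 powr (\<delta> - 1)" using x \<delta> by (intro powr_mono2) auto
  then have "x powr (\<delta> - 1) * x\<^sup>2 \<le> 1 * 1" using x by (intro mult_mono) (auto simp: power_le_one)
  then show "x powr (\<delta> - 1) * \<omega> x \<le> 2" using x by (simp add: powr_\<omega>)
qed

lemma r_le_double: "0 < x \<Longrightarrow> x \<le> y \<Longrightarrow> y \<le> 2 * x \<Longrightarrow> r y \<le> 2 * r x"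
proof -
  assume x: "0 < x" "x \<le> y" "y \<le> 2 * x"
  have "y powr (\<delta> - 1) \<le> (2 * x) powr (\<delta> - 1)" using x \<delta> by (intro powr_mono2) auto
  also have "\<dots> = 2 powr (\<delta> - 1) * x powr (\<delta> - 1)" using x by (simp add: powr_mult)
  also have "\<dots> \<le> 2 * x powr (\<delta> - 1)" using powr_le_2[of 2] by (intro mult_right_mono) auto
  finally have 1: "y powr (\<delta> - 1) \<le> 2 * x powr (\<delta> - 1)" .
  have "x\<^sup>2 \<le> y\<^sup>2" using x by (intro power_mono) auto
  then have "exp (- c * y\<^sup>2) \<le> exp (- c * x\<^sup>2)" using c_pos by simp
  then show ?thesis unfolding r_eq using mult_mono[OF 1] by (simp add: mult.assoc)
qed

lemma r_inverse_le: "0 < x \<Longrightarrow> x \<le> 1 \<Longrightarrow> 1 / r x \<le> exp c * x powr (1 - \<delta>)"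
proof -
  assume x: "0 < x" "x \<le> 1"
  have "1 / r x = exp (c * x\<^sup>2) * x powr (1 - \<delta>)"
  proof -
    have "x powr (1 - \<delta>) * x powr (\<delta> - 1) = 1" using x by (simp add: powr_add[symmetric])
    moreover have "exp (c * x\<^sup>2) * exp (- c * x\<^sup>2) = 1" by (simp add: exp_add[symmetric])
    ultimately have "(exp (c * x\<^sup>2) * x powr (1 - \<delta>)) * r x = 1"
      unfolding r_eq by (metis mult.assoc mult.commute mult_1)
    then show ?thesis using r_pos[OF x(1)] by (simp add: field_simps)
  qed
  also have "\<dots> \<le> exp c * x powr (1 - \<delta>)"
    using x c_pos by (intro mult_right_mono) (auto simp: power_le_one mult_left_le)
  finally show ?thesis .
qed

end

text \<open>Here \<open>g = R\<^sub>h f\<close>, \<open>F\<close> is its flux \<open>r g'\<close>, and \<open>F_0\<close> is the stickiness condition at \<open>0\<close>; \<open>q\<close> will be \<open>L g\<close>.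
  The quantity \<open>f - g \<circ> \<phi> = f - K\<^sub>h f\<close> is of size \<open>A\<close>, while \<open>f\<close> is of size \<open>A/h\<close>. The qualitative
  bound \<open>Cb\<close> does not enter the constants.\<close>

locale resolvent_instance = drift_setting +
  fixes h A Cb :: real and \<phi> f g F :: "real \<Rightarrow> real"
  assumes h: "h > 0" "(5 * B + 1) * h \<le> 1"
    and \<phi>: "\<phi> 0 = 0" "\<And>x. x \<ge> 0 \<Longrightarrow> \<phi> x \<ge> 0" "\<And>x. x \<ge> 0 \<Longrightarrow> \<bar>\<phi> x - x\<bar> \<le> B * h"
      "\<And>x. x \<ge> 0 \<Longrightarrow> x \<ge> B * h \<Longrightarrow> \<phi> x = x - h * G' x"
    and \<phi>_continuous: "continuous_on {0..} \<phi>"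
    and f: "\<And>x. x \<ge> 0 \<Longrightarrow> \<bar>f x\<bar> \<le> Cb" "continuous_on {0..} f"
    and f_le: "\<And>x. x \<ge> 0 \<Longrightarrow> \<bar>f x\<bar> \<le> Cf * A * (1 + x\<^sup>2) / h"
    and g: "\<And>x. x \<ge> 0 \<Longrightarrow> \<bar>g x\<bar> \<le> Cb" "continuous_on {0..} g"
    and g_deriv: "\<And>x. x > 0 \<Longrightarrow> (g has_real_derivative F x / r x) (at x)"
    and F_deriv: "\<And>x. x > 0 \<Longrightarrow> (F has_real_derivative \<beta> * r x * ((g x - f x) / h)) (at x)"
    and F_continuous: "continuous_on {0..} F"
    and F_0: "F 0 = (g 0 - f 0) / (h * \<mu>)"
    and \<zeta>: "\<And>x. x \<ge> 0 \<Longrightarrow> \<bar>f x - g (\<phi> x)\<bar> \<le> A"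
begin

definition q :: "real \<Rightarrow> real" where "q x = (g x - f x) / h"
definition D :: "real \<Rightarrow> real" where "D x = F x / r x"

lemma A_nonneg: "A \<ge> 0" using \<zeta>[of 0] by linarith

lemma Bh: "5 * (B * h) + h \<le> 1" "h \<le> 1" "B * h \<ge> 0" "B * h \<le> 1"
proof -
  show 1: "5 * (B * h) + h \<le> 1" using h by (simp add: algebra_simps)
  show 2: "B * h \<ge> 0" using h B by simp
  show "h \<le> 1" "B * h \<le> 1" using 1 2 h by linarith+
qed

text \<open>Since \<phi>(0) = 0, the stickiness condition expresses the flux at 0 through
  \<open>f - g \<circ> \<phi>\<close>, which is of size \<open>A\<close>, and not through
  \<open>f\<close>, which is of size A/h. This is what ties the coefficient of the logarithm to the
  value of the test function at 0.\<close>

lemma F_0_le: "\<bar>F 0\<bar> \<le> A / (h * \<mu>)" "F 0 = - (f 0 - g (\<phi> 0)) / (h * \<mu>)"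
proof -
  show eq: "F 0 = - (f 0 - g (\<phi> 0)) / (h * \<mu>)" using F_0 \<phi>(1) by simp
  show "\<bar>F 0\<bar> \<le> A / (h * \<mu>)"
    using \<zeta>[of 0] h \<mu> unfolding eq by (simp add: abs_mult divide_right_mono)
qed

text \<open>The hypotheses control g only on the range of \<phi>. By the intermediate value theorem
  this is everything: \<phi>(0) = 0 and \<phi>(x + B h) >= x, so x = \<phi>(y) with y <= x + 1, and
  g(x) is within \<open>A\<close> of f(y).\<close>

lemma g_le:
  assumes x: "x \<ge> 0"
  shows "\<bar>g x\<bar> \<le> 3 * (Cf + 1) * A / h * (1 + x\<^sup>2)"
proof -
  have up: "x \<le> \<phi> (x + B * h)" using \<phi>(3)[of "x + B * h"] x Bh by simp
  have "continuous_on {0..x + B * h} \<phi>" by (rule continuous_on_subset[OF \<phi>_continuous]) auto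
  then obtain y where y: "0 \<le> y" "y \<le> x + B * h" "\<phi> y = x"
    using IVT'[of \<phi> 0 x "x + B * h"] up x Bh \<phi>(1) by auto
  have y1: "y \<le> x + 1" using y Bh by linarith
  have "y\<^sup>2 \<le> (x + 1)\<^sup>2" using y1 y by (intro power_mono) auto
  also have "(x + 1)\<^sup>2 \<le> 2 * x\<^sup>2 + 2"
    using zero_le_power2[of "x - 1"] by (simp add: power2_eq_square algebra_simps)
  finally have yy: "1 + y\<^sup>2 \<le> 3 * (1 + x\<^sup>2)" by (smt (verit) zero_le_power2)
  have Ah: "A \<le> A * (1 + y\<^sup>2) / h"
  proof -
    have "A * h \<le> A * (1 + y\<^sup>2)" using Bh A_nonneg by (intro mult_left_mono) (auto intro: add_increasing2)
    then show ?thesis using h by (simp add: field_simps)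
  qed
  have "\<bar>g x\<bar> \<le> \<bar>f y\<bar> + \<bar>f y - g (\<phi> y)\<bar>" using y by simp
  also have "\<dots> \<le> Cf * A * (1 + y\<^sup>2) / h + A" using f_le[OF y(1)] \<zeta>[OF y(1)] by linarith
  also have "\<dots> \<le> Cf * A * (1 + y\<^sup>2) / h + A * (1 + y\<^sup>2) / h" using Ah by simp
  also have "\<dots> = (Cf + 1) * A / h * (1 + y\<^sup>2)" by (simp add: add_divide_distrib algebra_simps)
  also have "\<dots> \<le> (Cf + 1) * A / h * (3 * (1 + x\<^sup>2))"
    using yy Cf A_nonneg h by (intro mult_left_mono) auto
  also have "\<dots> = 3 * (Cf + 1) * A / h * (1 + x\<^sup>2)" by (simp add: algebra_simps add_divide_distrib)
  finally show ?thesis .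
qed

text \<open>As g' is unbounded at 0, g is compared with S times the antiderivative \<open>v\<close>
  of \<open>\<omega>\<close> that vanishes at 0, which is of order x^(2-\<delta>).\<close>

lemma g_near_0:
  assumes S: "\<And>x. x > 0 \<Longrightarrow> \<bar>D x\<bar> \<le> S * \<omega> x" and x: "0 \<le> x" "x \<le> 1"
  shows "\<bar>g x - g 0\<bar> \<le> S * K1 * x powr (2 - \<delta>)"
proof (cases "x = 0")
  case False
  with x have x0: "x > 0" by simp
  have S0: "S \<ge> 0" using S[of 1] \<omega>_ge_1[of 1] by (smt (verit) mult_neg_pos)
  define v where "v y = y powr (2 - \<delta>) / (2 - \<delta>) + y ^ 3 / 3" for y :: real
  have vd: "(v has_real_derivative \<omega> y) (at y)" if "y > 0" for y
  proof -
    have "((\<lambda>y. y powr (2 - \<delta>) / (2 - \<delta>)) has_real_derivative ((2 - \<delta>) * y powr (2 - \<delta> - 1)) / (2 - \<delta>)) (at y)"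
      by (intro DERIV_cdivide has_real_derivative_powr that)
    moreover have "((\<lambda>y. y ^ 3 / 3) has_real_derivative y\<^sup>2) (at y)"
      by (auto intro!: derivative_eq_intros)
    ultimately have "(v has_real_derivative ((2 - \<delta>) * y powr (2 - \<delta> - 1)) / (2 - \<delta>) + y\<^sup>2) (at y)"
      unfolding v_def[abs_def] by (rule DERIV_add)
    then show ?thesis using \<delta> by (simp add: \<omega>_def)
  qed
  have vc: "continuous_on {0..x} v"
    unfolding v_def[abs_def] using \<delta>
    by (intro continuous_on_add continuous_on_divide continuous_on_const continuous_on_subset[OF continuous_on_powr_nonneg]
        continuous_on_power continuous_on_id) auto
  have gc: "continuous_on {0..x} g" by (rule continuous_on_subset[OF g(2)]) auto
  have *: "s * (g x - g 0) \<le> S * v x" if s: "\<bar>s\<bar> = 1" for s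
  proof -
    have c: "continuous_on {0..x} (\<lambda>y. s * g y - S * v y)"
      by (intro continuous_on_diff continuous_on_mult continuous_on_const gc vc)
    have d: "((\<lambda>y. s * g y - S * v y) has_real_derivative (s * D y - S * \<omega> y)) (at y)" if "y > 0" for y
      using g_deriv[OF that] vd[OF that] by (auto intro!: derivative_eq_intros simp: D_def)
    obtain z where z: "0 < z" "s * g x - S * v x - (s * g 0 - S * v 0) = (x - 0) * (s * D z - S * \<omega> z)"
      by (rule mean_value_interior[OF x0 c, of "\<lambda>y. s * D y - S * \<omega> y"]) (use d in auto)
    have "s * D z \<le> \<bar>s * D z\<bar>" by simp
    also have "\<dots> \<le> S * \<omega> z" using S[OF z(1)] s by (simp add: abs_mult)
    finally have "(x - 0) * (s * D z - S * \<omega> z) \<le> 0" using x0 by (intro mult_nonneg_nonpos) auto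
    moreover have "v 0 = 0" by (simp add: v_def)
    ultimately show ?thesis using z by (simp add: algebra_simps)
  qed
  have "x ^ 3 / 3 \<le> x powr (2 - \<delta>)"
  proof -
    have "x powr 3 \<le> x powr (2 - \<delta>)" using x0 x \<delta> by (intro powr_mono') auto
    then have "x ^ 3 \<le> x powr (2 - \<delta>)" using x0 by simp
    then show ?thesis using powr_ge_zero[of x "2 - \<delta>"] by linarith
  qed
  then have "v x \<le> K1 * x powr (2 - \<delta>)" by (simp add: v_def K1_def algebra_simps)
  then have "S * v x \<le> S * (K1 * x powr (2 - \<delta>))" using S0 by (intro mult_left_mono)
  then show ?thesis using *[of 1] *[of "-1"] by (auto simp: abs_le_iff mult.assoc)
qed simp

text \<open>At distance 4 B h or more from 0 a step moves a point by at most a quarter of its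
  position, so \<open>\<omega>\<close> at most doubles along the way and the mean value theorem
  applies.\<close>

lemma g_increment:
  assumes S: "\<And>x. x > 0 \<Longrightarrow> \<bar>D x\<bar> \<le> S * \<omega> x" and x: "x > 0" "4 * (B * h) \<le> x"
  shows "\<bar>g x - g (\<phi> x)\<bar> \<le> B * h * (2 * S * \<omega> x)"
proof (cases "\<phi> x = x")
  case True
  have S0: "S \<ge> 0" using S[of 1] \<omega>_ge_1[of 1] by (smt (verit) mult_neg_pos)
  then show ?thesis using True Bh \<omega>_nonneg by simp
next
  case False
  have S0: "S \<ge> 0" using S[of 1] \<omega>_ge_1[of 1] by (smt (verit) mult_neg_pos)
  have \<phi>x: "\<bar>\<phi> x - x\<bar> \<le> B * h" using \<phi>(3) x by simp
  have m: "3 / 4 * x \<le> min x (\<phi> x)" "max x (\<phi> x) \<le> 5 / 4 * x" using \<phi>x x by (auto simp: abs_le_iff)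
  have lt: "min x (\<phi> x) < max x (\<phi> x)" using False by auto
  have pos: "min x (\<phi> x) > 0" using m x by linarith
  have c: "continuous_on {min x (\<phi> x)..max x (\<phi> x)} g"
    by (rule continuous_on_subset[OF g(2)]) (use pos in auto)
  have d: "(g has_real_derivative D y) (at y)" if "min x (\<phi> x) < y" "y < max x (\<phi> x)" for y
    unfolding D_def using that pos by (intro g_deriv) linarith
  obtain z where z: "min x (\<phi> x) < z" "z < max x (\<phi> x)"
    "g (max x (\<phi> x)) - g (min x (\<phi> x)) = (max x (\<phi> x) - min x (\<phi> x)) * D z"
    by (rule mean_value_interior[OF lt c d])
  have "3 / 4 * x \<le> z" "z \<le> 5 / 4 * x" "z \<le> 2 * x" "z > 0" using z m pos x by linarith+
  then have "\<bar>D z\<bar> \<le> S * (2 * \<omega> x)"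
    using S[of z] \<omega>_scale(2)[of x z] x S0 by (meson mult_left_mono order_trans)
  then have Dz: "\<bar>D z\<bar> \<le> 2 * S * \<omega> x" by (simp add: mult_ac)
  have "\<bar>g x - g (\<phi> x)\<bar> = \<bar>g (max x (\<phi> x)) - g (min x (\<phi> x))\<bar>" by (auto simp: max_def min_def)
  also have "\<dots> = \<bar>\<phi> x - x\<bar> * \<bar>D z\<bar>" unfolding z(3) by (auto simp: abs_mult max_def min_def)
  also have "\<dots> \<le> (B * h) * (2 * S * \<omega> x)"
    using \<phi>x Dz Bh by (intro mult_mono) auto
  finally show ?thesis .
qed

text \<open>Close to 0 a step may be as long as the distance to 0, so both points are compared with
  0.\<close>

lemma g_increment_near_0:
  assumes S: "\<And>x. x > 0 \<Longrightarrow> \<bar>D x\<bar> \<le> S * \<omega> x" and x: "x > 0" "x \<le> y" "x + B * h \<le> y" "y \<le> 1"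
  shows "\<bar>g x - g (\<phi> x)\<bar> \<le> 2 * S * K1 * y powr (2 - \<delta>)"
proof -
  have S0: "S \<ge> 0" using S[of 1] \<omega>_ge_1[of 1] by (smt (verit) mult_neg_pos)
  have \<phi>x: "0 \<le> \<phi> x" "\<phi> x \<le> y" using \<phi>(2,3)[of x] x by auto
  have *: "\<bar>g u - g 0\<bar> \<le> S * K1 * y powr (2 - \<delta>)" if "0 \<le> u" "u \<le> y" for u
  proof -
    have "u powr (2 - \<delta>) \<le> y powr (2 - \<delta>)" using that \<delta> by (intro powr_mono2) auto
    then have "S * K1 * u powr (2 - \<delta>) \<le> S * K1 * y powr (2 - \<delta>)"
      using S0 constants by (intro mult_left_mono) auto
    then show ?thesis using g_near_0[OF S, of u] that x by linarith
  qed
  have "\<bar>g x - g (\<phi> x)\<bar> \<le> \<bar>g x - g 0\<bar> + \<bar>g (\<phi> x) - g 0\<bar>" by linarith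
  also have "\<dots> \<le> 2 * S * K1 * y powr (2 - \<delta>)" using *[of x] *[of "\<phi> x"] x \<phi>x by (simp add: mult.assoc)
  finally show ?thesis .
qed

text \<open>The function h q is the difference of g - g \<circ> \<phi> and f - g \<circ> \<phi>. The
  latter is at most \<open>A\<close>; the former is an increment over a distance at most B h, hence
  O(h) times S \<open>\<omega>\<close>. Below 4 B h this holds as well: for y = 5 B h one has
  y^(2-\<delta>) = y y^(1-\<delta>), and y^(1-\<delta>) is at most x^(1-\<delta>) because the
  exponent is negative.\<close>

lemma q_le:
  assumes S: "\<And>x. x > 0 \<Longrightarrow> \<bar>D x\<bar> \<le> S * \<omega> x" and x: "x > 0"
  shows "\<bar>q x\<bar> \<le> C1 * S * \<omega> x + A / h"
proof -
  have S0: "S \<ge> 0" using S[of 1] \<omega>_ge_1[of 1] by (smt (verit) mult_neg_pos)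
  have inc: "\<bar>g x - g (\<phi> x)\<bar> \<le> h * (C1 * S * \<omega> x)"
  proof (cases "4 * (B * h) \<le> x")
    case True
    have "B * h * (2 * S * \<omega> x) = h * ((2 * B) * (S * \<omega> x))" by simp
    also have "\<dots> \<le> h * (C1 * (S * \<omega> x))"
      using h S0 \<omega>_nonneg constants by (intro mult_left_mono mult_right_mono mult_nonneg_nonneg) auto
    finally show ?thesis using g_increment[OF S x True] by (simp add: mult.assoc)
  next
    case False
    have y: "x \<le> 5 * (B * h)" "x + B * h \<le> 5 * (B * h)" "5 * (B * h) \<le> 1" using False Bh h by linarith+
    have "(5 * (B * h)) powr (2 - \<delta>) = 5 * (B * h) * (5 * (B * h)) powr (1 - \<delta>)"
      using powr_Suc_exponent[of "5 * (B * h)" "2 - \<delta>"] y x by simp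
    also have "(5 * (B * h)) powr (1 - \<delta>) \<le> x powr (1 - \<delta>)" using y x \<delta> by (intro powr_mono2') auto
    also have "x powr (1 - \<delta>) \<le> \<omega> x" by (rule \<omega>_ge_powr)
    finally have p: "(5 * (B * h)) powr (2 - \<delta>) \<le> 5 * (B * h) * \<omega> x" using Bh by (simp add: mult_left_mono)
    have "\<bar>g x - g (\<phi> x)\<bar> \<le> 2 * S * K1 * (5 * (B * h)) powr (2 - \<delta>)"
      by (rule g_increment_near_0[OF S x y])
    also have "\<dots> \<le> 2 * S * K1 * (5 * (B * h) * \<omega> x)" using p S0 constants by (intro mult_left_mono) auto
    also have "\<dots> = h * (C1 * S * \<omega> x)" by (simp add: C1_def)
    finally show ?thesis .
  qed
  have "\<bar>h * q x\<bar> \<le> \<bar>g x - g (\<phi> x)\<bar> + \<bar>f x - g (\<phi> x)\<bar>" using h by (simp add: q_def)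
  also have "\<dots> \<le> h * (C1 * S * \<omega> x) + A" using inc \<zeta>[of x] x by simp
  also have "\<dots> = h * (C1 * S * \<omega> x + A / h)" using h by (simp add: distrib_left)
  finally show ?thesis using h by (simp add: abs_mult)
qed

text \<open>The derivative of F is \<beta> r q, and r cancels the singularity of
  \<open>\<omega>\<close>. So the flux is Lipschitz at 0 although g' blows up there.\<close>

lemma F_increment:
  assumes S: "\<And>x. x > 0 \<Longrightarrow> \<bar>D x\<bar> \<le> S * \<omega> x" and x: "0 < x" "x \<le> 2"
  shows "\<bar>F x - F 0\<bar> \<le> x * (\<beta> * (9 * C1 * S + 2 * A / h))"
    and "x \<le> 1 \<Longrightarrow> \<bar>F x - F 0\<bar> \<le> x * (\<beta> * (2 * C1 * S + A / h))"
proof -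
  have S0: "S \<ge> 0" using S[of 1] \<omega>_ge_1[of 1] by (smt (verit) mult_neg_pos)
  have c: "continuous_on {0..x} F" by (rule continuous_on_subset[OF F_continuous]) auto
  obtain z where z: "0 < z" "z < x" "F x - F 0 = (x - 0) * (\<beta> * r z * ((g z - f z) / h))"
    by (rule mean_value_interior[OF x(1) c F_deriv])
  have rz: "r z * \<bar>q z\<bar> \<le> C1 * S * (r z * \<omega> z) + r z * (A / h)"
    using mult_left_mono[OF q_le[OF S z(1)] less_imp_le[OF r_pos[OF z(1)]]] by (simp add: algebra_simps)
  have eq: "\<bar>F x - F 0\<bar> = x * (\<beta> * (r z * \<bar>q z\<bar>))"
    unfolding z(3) q_def[symmetric] using x \<beta> r_pos[OF z(1)] by (simp add: abs_mult)
  have Ah: "A / h \<ge> 0" using A_nonneg h by simp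
  have "C1 * S * (r z * \<omega> z) \<le> C1 * S * 9"
    using r_\<omega>_le(1)[of z] z x constants S0 by (intro mult_left_mono) auto
  moreover have "r z * (A / h) \<le> 2 * (A / h)"
    using r_le[of z] powr_le_2[of z] z x Ah by (intro mult_right_mono) auto
  ultimately have "r z * \<bar>q z\<bar> \<le> 9 * C1 * S + 2 * A / h" using rz by simp
  then show "\<bar>F x - F 0\<bar> \<le> x * (\<beta> * (9 * C1 * S + 2 * A / h))"
    unfolding eq using x \<beta> by (intro mult_left_mono) auto
  assume x1: "x \<le> 1"
  have p1: "z powr (\<delta> - 1) \<le> 1" using z x1 \<delta> powr_mono2[of "\<delta> - 1" z 1] by simp
  have "r z * \<omega> z \<le> z powr (\<delta> - 1) * \<omega> z" using r_le[of z] z \<omega>_nonneg by (intro mult_right_mono) auto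
  also have "\<dots> \<le> 2" using r_\<omega>_le(2)[of z] z x1 by simp
  finally have "C1 * S * (r z * \<omega> z) \<le> C1 * S * 2" using constants S0 by (intro mult_left_mono) auto
  moreover have "r z * (A / h) \<le> 1 * (A / h)"
    using r_le[of z] p1 z Ah by (intro mult_right_mono) auto
  ultimately have "r z * \<bar>q z\<bar> \<le> 2 * C1 * S + A / h" using rz by simp
  then show "\<bar>F x - F 0\<bar> \<le> x * (\<beta> * (2 * C1 * S + A / h))"
    unfolding eq using x \<beta> by (intro mult_left_mono) auto
qed

text \<open>An inequality of Landau type. The mean value theorem gives a point \<open>y\<close> in
  the interval with |g'| <= 2 P / l; the flux carries this back to \<open>x\<close>, its change
  being governed by q. The condition l <= x keeps r from more than doubling on the interval.\<close>

lemma D_interpolation: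
  assumes x: "x > 0" "0 < l" "l \<le> x"
    and P: "\<And>y. x \<le> y \<Longrightarrow> y \<le> x + l \<Longrightarrow> \<bar>g y\<bar> \<le> P"
    and Q: "\<And>y. x \<le> y \<Longrightarrow> y \<le> x + l \<Longrightarrow> \<bar>q y\<bar> \<le> Q"
  shows "\<bar>D x\<bar> \<le> 4 * P / l + 2 * \<beta> * l * Q"
proof -
  have lt: "x < x + l" using x by simp
  have c: "continuous_on {x..x + l} g" by (rule continuous_on_subset[OF g(2)]) (use x in auto)
  have d: "(g has_real_derivative D y) (at y)" if "x < y" "y < x + l" for y
    unfolding D_def using that x by (intro g_deriv) auto
  obtain y where y: "x < y" "y < x + l" "g (x + l) - g x = (x + l - x) * D y"
    by (rule mean_value_interior[OF lt c d])
  have "l * \<bar>D y\<bar> = \<bar>g (x + l) - g x\<bar>" using y x by (simp add: abs_mult)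
  also have "\<dots> \<le> 2 * P" using P[of x] P[of "x + l"] x by simp
  finally have Dy: "\<bar>D y\<bar> \<le> 2 * P / l" using x by (simp add: field_simps)
  have cF: "continuous_on {x..y} F" by (rule continuous_on_subset[OF F_continuous]) (use x in auto)
  obtain z where z: "x < z" "z < y" "F y - F x = (y - x) * (\<beta> * r z * ((g z - f z) / h))"
    by (rule mean_value_interior[OF y(1) cF F_deriv]) (use x in auto)
  have rx: "r x > 0" "r y > 0" "r z > 0" using x y z r_pos by auto
  have "\<bar>F y\<bar> = r y * \<bar>D y\<bar>" using rx by (simp add: D_def abs_mult)
  also have "\<dots> \<le> 2 * r x * (2 * P / l)"
    using r_le_double[of x y] x y Dy rx by (intro mult_mono) auto
  finally have Fy: "\<bar>F y\<bar> \<le> 2 * r x * (2 * P / l)" .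
  have "\<bar>F y - F x\<bar> = (y - x) * (\<beta> * (r z * \<bar>q z\<bar>))"
    unfolding z(3) q_def[symmetric] using y rx \<beta> by (simp add: abs_mult)
  also have "\<dots> \<le> l * (\<beta> * (2 * r x * Q))"
    using r_le_double[of x z] Q[of z] x y z rx \<beta> by (intro mult_mono mult_left_mono mult_nonneg_nonneg) auto
  finally have "\<bar>F x\<bar> \<le> 2 * r x * (2 * P / l) + l * (\<beta> * (2 * r x * Q))" using Fy by linarith
  also have "\<dots> = r x * (4 * P / l + 2 * \<beta> * l * Q)" by (simp add: algebra_simps)
  finally show ?thesis using rx by (simp add: D_def divide_le_eq mult.commute)
qed

text \<open>Purely qualitative: the constant depends on \<open>Cb\<close>, \<open>h\<close> and the
  flux on [0,1]. It ensures that the best constant is finite, without which it could not be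
  absorbed.\<close>

lemma D_bounded: "\<exists>S. \<forall>x>0. \<bar>D x\<bar> \<le> S * \<omega> x"
proof -
  have "compact (F ` {0..1})"
    by (intro compact_continuous_image continuous_on_subset[OF F_continuous]) auto
  then obtain KF where "\<forall>y\<in>F ` {0..1}. norm y \<le> KF"
    using compact_imp_bounded[of "F ` {0..1}"] unfolding bounded_iff by blast
  then have KF: "\<bar>F x\<bar> \<le> KF" if "0 \<le> x" "x \<le> 1" for x using that by auto
  define K where "K = 4 * Cb / 1 + 2 * \<beta> * 1 * (2 * Cb / h)"
  have KF0: "KF \<ge> 0" using KF[of 0] by simp
  have Cb0: "Cb \<ge> 0" using f(1)[of 0] by simp
  have K0: "K \<ge> 0" using Cb0 h \<beta> by (simp add: K_def)
  have "\<bar>D x\<bar> \<le> max (KF * exp c) K * \<omega> x" if x: "x > 0" for x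
  proof (cases "x \<le> 1")
    case True
    have "\<bar>D x\<bar> = \<bar>F x\<bar> * (1 / r x)" using r_pos[OF x] by (simp add: D_def)
    also have "\<dots> \<le> KF * (exp c * x powr (1 - \<delta>))"
      using KF[of x] x True r_inverse_le[OF x True] r_pos[OF x] KF0 by (intro mult_mono) auto
    also have "\<dots> \<le> (KF * exp c) * \<omega> x"
      using \<omega>_ge_powr[of x] KF0 by (simp add: mult.assoc mult_left_mono)
    also have "\<dots> \<le> max (KF * exp c) K * \<omega> x" using \<omega>_nonneg by (intro mult_right_mono) auto
    finally show ?thesis .
  next
    case False
    have gq: "\<bar>q y\<bar> \<le> 2 * Cb / h" if "x \<le> y" for y
      using f(1)[of y] g(1)[of y] that x h by (auto simp: q_def divide_right_mono abs_le_iff)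
    have "\<bar>D x\<bar> \<le> K"
      unfolding K_def using False x gq g(1) by (intro D_interpolation) auto
    also have "K * 1 \<le> max (KF * exp c) K * \<omega> x" using \<omega>_ge_1[OF x] K0 by (intro mult_mono) auto
    finally show ?thesis by simp
  qed
  then show ?thesis by blast
qed

text \<open>\<open>q\<close> is bounded in terms of \<open>S\<close>, and interpolation over a length \<open>\<epsilon>\<close>
  (near \<open>0\<close>, integration of \<open>F'\<close> over it) multiplies that bound by \<open>\<epsilon>\<close>;
  the choice of \<open>\<epsilon>\<close> makes the resulting factor at most \<open>1/2\<close>, so iterating removes \<open>S\<close>.\<close>

lemma D_le_absorb:
  assumes S: "\<And>x. x > 0 \<Longrightarrow> \<bar>D x\<bar> \<le> S * \<omega> x" and x: "x > 0"
  shows "\<bar>D x\<bar> \<le> (S / 2 + K2 / 2 * (A / h)) * \<omega> x"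
proof -
  have S0: "S \<ge> 0" using S[of 1] \<omega>_ge_1[of 1] by (smt (verit) mult_neg_pos)
  have Ah: "A / h \<ge> 0" using A_nonneg h by simp
  note k = constants
  have e1: "exp c \<ge> 1" using c_pos by simp
  have abs1: "\<epsilon> * \<beta> * (C1 * exp c) \<le> 1 / 16" "\<epsilon> * \<beta> * C1 \<le> 1 / 16"
  proof -
    have "16 * (\<epsilon> * \<beta> * ((C1 + 1) * exp c)) \<le> 1" using k(5) by (simp only: mult_ac)
    then have k16: "\<epsilon> * \<beta> * ((C1 + 1) * exp c) \<le> 1 / 16" by linarith
    have "\<epsilon> * \<beta> * (C1 * exp c) \<le> \<epsilon> * \<beta> * ((C1 + 1) * exp c)"
      using k \<beta> by (intro mult_left_mono mult_right_mono) auto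
    also note k16
    finally show 1: "\<epsilon> * \<beta> * (C1 * exp c) \<le> 1 / 16" .
    have "\<epsilon> * \<beta> * C1 * 1 \<le> \<epsilon> * \<beta> * C1 * exp c" using e1 k \<beta> by (intro mult_left_mono) auto
    then show "\<epsilon> * \<beta> * C1 \<le> 1 / 16" using 1 by (simp add: mult.assoc)
  qed
  \<comment> \<open>The bound on [0,\<epsilon>], through the flux, costs \<open>Ka\<close>; the one
    beyond \<epsilon>, by interpolation, costs \<open>Kb\<close>. Their sum is half of
    \<open>K2\<close>.\<close>
  define Ka where "Ka = exp c * (1 / \<mu> + \<beta>)"
  define Kb where "Kb = 72 * (Cf + 1) / \<epsilon> * 1 + 2 * \<beta>"
  have K2: "K2 / 2 = Ka + Kb" by (simp add: K2_def Ka_def Kb_def)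
  have Ka0: "Ka \<ge> 0" "Kb \<ge> 0" using \<mu> \<beta> Cf k by (auto simp: Ka_def Kb_def intro!: mult_nonneg_nonneg add_nonneg_nonneg)
  show ?thesis
  proof (cases "x \<le> \<epsilon>")
    case True
    have x1: "x \<le> 1" using True k by simp
    have "\<bar>F x\<bar> \<le> \<bar>F 0\<bar> + \<bar>F x - F 0\<bar>" by linarith
    also have "\<dots> \<le> A / (h * \<mu>) + \<epsilon> * (\<beta> * (2 * C1 * S + A / h))"
    proof (rule add_mono[OF F_0_le(1)])
      have "\<bar>F x - F 0\<bar> \<le> x * (\<beta> * (2 * C1 * S + A / h))" using F_increment(2)[OF S x] x1 by simp
      also have "\<dots> \<le> \<epsilon> * (\<beta> * (2 * C1 * S + A / h))"
        using True \<beta> k S0 Ah by (intro mult_right_mono mult_nonneg_nonneg add_nonneg_nonneg) auto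
      finally show "\<bar>F x - F 0\<bar> \<le> \<epsilon> * (\<beta> * (2 * C1 * S + A / h))" .
    qed
    finally have "\<bar>F x\<bar> * exp c \<le> (A / (h * \<mu>) + \<epsilon> * (\<beta> * (2 * C1 * S + A / h))) * exp c"
      by (rule mult_right_mono) simp
    also have "\<dots> = exp c * (1 / \<mu>) * (A / h) + 2 * (\<epsilon> * \<beta> * (C1 * exp c)) * S + \<epsilon> * (exp c * \<beta> * (A / h))"
      by (simp add: algebra_simps)
    also have "\<dots> \<le> exp c * (1 / \<mu>) * (A / h) + 2 * (1 / 16) * S + 1 * (exp c * \<beta> * (A / h))"
    proof -
      have "exp c * \<beta> * (A / h) \<ge> 0" using Ah \<beta> by (intro mult_nonneg_nonneg) auto
      then have "\<epsilon> * (exp c * \<beta> * (A / h)) \<le> 1 * (exp c * \<beta> * (A / h))"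
        using k by (intro mult_right_mono) auto
      moreover have "2 * (\<epsilon> * \<beta> * (C1 * exp c)) * S \<le> 2 * (1 / 16) * S"
        using abs1(1) S0 by (intro mult_right_mono) auto
      ultimately show ?thesis by linarith
    qed
    also have "\<dots> = Ka * (A / h) + S / 8" by (simp add: Ka_def distrib_left distrib_right add_divide_distrib mult.commute)
    also have "\<dots> \<le> S / 2 + K2 / 2 * (A / h)"
    proof -
      have "Ka * (A / h) \<le> K2 / 2 * (A / h)" unfolding K2 using Ka0 Ah by (intro mult_right_mono) auto
      then show ?thesis using S0 by linarith
    qed
    finally have *: "\<bar>F x\<bar> * exp c \<le> S / 2 + K2 / 2 * (A / h)" .
    have "\<bar>D x\<bar> = \<bar>F x\<bar> * (1 / r x)" using r_pos[OF x] by (simp add: D_def)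
    also have "\<dots> \<le> \<bar>F x\<bar> * (exp c * x powr (1 - \<delta>))"
      using r_inverse_le[OF x x1] by (intro mult_left_mono) auto
    also have "\<dots> = \<bar>F x\<bar> * exp c * x powr (1 - \<delta>)" by simp
    also have "\<dots> \<le> (S / 2 + K2 / 2 * (A / h)) * \<omega> x"
      using * \<omega>_ge_powr[of x] S0 K2_nonneg Ah by (intro mult_mono add_nonneg_nonneg mult_nonneg_nonneg) auto
    finally show ?thesis .
  next
    case False
    define P where "P = 3 * (Cf + 1) * A / h * (6 * \<omega> x)"
    define Q where "Q = C1 * S * (4 * \<omega> x) + A / h * \<omega> x"
    have CA: "3 * (Cf + 1) * A / h \<ge> 0" using Cf A_nonneg h by simp
    have P: "\<bar>g y\<bar> \<le> P" if "x \<le> y" "y \<le> x + \<epsilon>" for y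
    proof -
      have "y \<le> x + 1" using that k by linarith
      then have "y\<^sup>2 \<le> (x + 1)\<^sup>2" using that x by (intro power_mono) auto
      also have "(x + 1)\<^sup>2 \<le> 2 * x\<^sup>2 + 2"
        using zero_le_power2[of "x - 1"] by (simp add: power2_eq_square algebra_simps)
      finally have "1 + y\<^sup>2 \<le> 3 * (1 + x\<^sup>2)" by (smt (verit) zero_le_power2)
      also have "1 + x\<^sup>2 \<le> 2 * \<omega> x" using \<omega>_ge_1[OF x] powr_ge_zero[of x "1 - \<delta>"] unfolding \<omega>_def by (smt (verit))
      finally have "1 + y\<^sup>2 \<le> 6 * \<omega> x" by simp
      then have "3 * (Cf + 1) * A / h * (1 + y\<^sup>2) \<le> P" unfolding P_def using CA by (rule mult_left_mono)
      then show ?thesis using g_le[of y] that x by linarith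
    qed
    have Q: "\<bar>q y\<bar> \<le> Q" if "x \<le> y" "y \<le> x + \<epsilon>" for y
    proof -
      have "y \<le> 2 * x" "3 / 4 * x \<le> y" using that False x by linarith+
      then have "C1 * S * \<omega> y \<le> C1 * S * (4 * \<omega> x)"
        using \<omega>_scale(1)[of x y] x S0 k by (intro mult_left_mono) auto
      moreover have "A / h * 1 \<le> A / h * \<omega> x" using \<omega>_ge_1[OF x] Ah by (rule mult_left_mono)
      ultimately show ?thesis using q_le[OF S, of y] that x unfolding Q_def by simp
    qed
    have "\<bar>D x\<bar> \<le> 4 * P / \<epsilon> + 2 * \<beta> * \<epsilon> * Q"
      by (rule D_interpolation) (use x k False P Q in auto)
    also have "\<dots> = (72 * (Cf + 1) / \<epsilon> * (A / h) + 8 * (\<epsilon> * \<beta> * C1) * S + \<epsilon> * (2 * \<beta> * (A / h))) * \<omega> x"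
      unfolding P_def Q_def by (simp add: algebra_simps add_divide_distrib)
    also have "\<dots> \<le> (72 * (Cf + 1) / \<epsilon> * (A / h) + 8 * (1 / 16) * S + 1 * (2 * \<beta> * (A / h))) * \<omega> x"
    proof (rule mult_right_mono[OF _ \<omega>_nonneg])
      have "2 * \<beta> * (A / h) \<ge> 0" using Ah \<beta> by (intro mult_nonneg_nonneg) auto
      then have "\<epsilon> * (2 * \<beta> * (A / h)) \<le> 1 * (2 * \<beta> * (A / h))"
        using k by (intro mult_right_mono) auto
      moreover have "8 * (\<epsilon> * \<beta> * C1) * S \<le> 8 * (1 / 16) * S"
        using abs1(2) S0 by (intro mult_right_mono) auto
      ultimately show "72 * (Cf + 1) / \<epsilon> * (A / h) + 8 * (\<epsilon> * \<beta> * C1) * S + \<epsilon> * (2 * \<beta> * (A / h))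
        \<le> 72 * (Cf + 1) / \<epsilon> * (A / h) + 8 * (1 / 16) * S + 1 * (2 * \<beta> * (A / h))" by linarith
    qed
    also have "\<dots> = (Kb * (A / h) + S / 2) * \<omega> x"
    proof -
      have "(k1 * u + 8 * (1 / 16) * S + 1 * (2 * \<beta> * u)) * w = ((k1 * 1 + 2 * \<beta>) * u + S / 2) * w" for k1 u w
        by (simp add: algebra_simps)
      then show ?thesis unfolding Kb_def .
    qed
    also have "\<dots> \<le> (S / 2 + K2 / 2 * (A / h)) * \<omega> x"
    proof (rule mult_right_mono[OF _ \<omega>_nonneg])
      have "Kb * (A / h) \<le> K2 / 2 * (A / h)" unfolding K2 using Ka0 Ah by (intro mult_right_mono) auto
      then show "Kb * (A / h) + S / 2 \<le> S / 2 + K2 / 2 * (A / h)" by linarith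
    qed
    finally show ?thesis .
  qed
qed

text \<open>Taking for S the best constant, which is finite by \<open>D_bounded\<close>, the
  absorption gives S <= S/2 + (K2/2)(A/h), and S can be solved for.\<close>

lemma D_le: "x > 0 \<Longrightarrow> \<bar>D x\<bar> \<le> K2 * (A / h) * \<omega> x"
proof -
  assume x: "x > 0"
  obtain S0 where S0: "\<And>x. x > 0 \<Longrightarrow> \<bar>D x\<bar> \<le> S0 * \<omega> x" using D_bounded by blast
  have \<omega>0: "\<omega> x > 0" if "x > 0" for x using \<omega>_ge_1[OF that] by linarith
  define S where "S = (SUP x\<in>{0<..}. \<bar>D x\<bar> / \<omega> x)"
  have "bdd_above ((\<lambda>x. \<bar>D x\<bar> / \<omega> x) ` {0<..})"
    using S0 \<omega>0 by (auto intro!: bdd_aboveI[of _ S0] simp: divide_le_eq)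
  then have "\<bar>D x\<bar> / \<omega> x \<le> S" if "x > 0" for x
    unfolding S_def using that by (intro cSUP_upper) auto
  then have S: "\<bar>D x\<bar> \<le> S * \<omega> x" if "x > 0" for x
    using that \<omega>0[OF that] by (simp add: divide_le_eq)
  have "S \<le> S / 2 + K2 / 2 * (A / h)"
    unfolding S_def
  proof (rule cSUP_least)
    show "\<bar>D x\<bar> / \<omega> x \<le> (SUP x\<in>{0<..}. \<bar>D x\<bar> / \<omega> x) / 2 + K2 / 2 * (A / h)" if "x \<in> {0<..}" for x
      using D_le_absorb[OF S, of x] that \<omega>0[of x] unfolding S_def[symmetric] by (simp add: divide_le_eq)
  qed auto
  moreover have half: "u \<le> 2 * v" if "u \<le> u / 2 + v" for u v :: real using that by simp
  ultimately have "S \<le> 2 * (K2 / 2 * (A / h))" by blast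
  then have "S \<le> K2 * (A / h)" by simp
  then have "S * \<omega> x \<le> K2 * (A / h) * \<omega> x" using \<omega>_nonneg by (rule mult_right_mono)
  then show ?thesis using S[OF x] by linarith
qed

end

section \<open>Consistency error\<close>

context drift_setting
begin

definition \<rho> :: "real \<Rightarrow> real" where
  "\<rho> x = \<beta> * x powr (\<delta> - 1) * exp (- lam * \<beta> * x\<^sup>2 / 2 - \<beta> * G x)"
text \<open>The summands beyond \<open>K2\<close> make the scale \<open>N\<close> below dominate
  also A/h and the flux at 0.\<close>

definition K3 :: real where "K3 = K2 + 1 + 1 / \<mu>"
text \<open>From \<kappa> h on, the displacement B h is at most x/4 and the clamp is inactive. The
  extra 1 keeps the threshold positive and of order h even when B = 0.\<close>

definition \<kappa> :: real where "\<kappa> = 4 * B + 1"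
definition E0 :: real where "E0 = exp (- \<beta> * G 0 + \<beta> * B)"
text \<open>The regular factor of the quadratic Taylor term: \<rho> G'^2 = H r, where the weight r
  is kept apart because r g'' is expressed by the flux.\<close>

definition H :: "real \<Rightarrow> real" where "H x = \<beta> * exp (- \<beta> * G x) * (G' x)\<^sup>2"
definition KH :: real where "KH = \<beta> * (E0 * (\<beta> * B) * B\<^sup>2 + E0 * (2 * B * B1))"
definition KF :: real where "KF = \<beta> * (9 * C1 + 2)"

lemma \<rho>_eq: "\<rho> x = \<beta> * exp (- \<beta> * G x) * r x"
  by (simp add: \<rho>_def r_def exp_add[symmetric])

lemma \<rho>_nonneg: "\<rho> x \<ge> 0" using \<beta> by (simp add: \<rho>_def)

lemma K3_nonneg: "K3 \<ge> 0" using K2_nonneg \<mu> by (simp add: K3_def)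

lemma E0_pos: "E0 > 0" by (simp add: E0_def)

lemma KH_nonneg: "KH \<ge> 0" unfolding KH_def using \<beta> B(1) B1(1) E0_pos by (intro mult_nonneg_nonneg add_nonneg_nonneg) auto

lemma KF_nonneg: "KF \<ge> 0" unfolding KF_def using \<beta> constants by simp

lemma G_deriv: "x > 0 \<Longrightarrow> (G has_real_derivative G' x) (at x)"
  using G[of x] at_within_interior[of x "{0..}"] by simp

lemma G_continuous: "continuous_on {0..} G"
  using G by (auto simp: continuous_on_eq_continuous_within intro: DERIV_continuous)

lemma G_increment: "x \<ge> 0 \<Longrightarrow> \<bar>G x - G 0\<bar> \<le> B * x"
proof (cases "x = 0")
  case False
  assume "x \<ge> 0"
  with False have x: "x > 0" by simp
  have c: "continuous_on {0..x} G" by (rule continuous_on_subset[OF G_continuous]) auto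
  obtain z where z: "0 < z" "z < x" "G x - G 0 = (x - 0) * G' z"
    by (rule mean_value_interior[OF x c G_deriv])
  then show ?thesis using B(2)[of z] x by (simp add: abs_mult mult.commute)
qed simp

lemma exp_G_le: "x \<ge> 0 \<Longrightarrow> exp (- \<beta> * G x) \<le> exp (- \<beta> * G 0) * exp (\<beta> * B * x)"
proof -
  assume x: "x \<ge> 0"
  have "\<beta> * (G 0 - G x) \<le> \<beta> * (B * x)" using G_increment[OF x] \<beta> by (intro mult_left_mono) auto
  then show ?thesis by (simp add: exp_add[symmetric] algebra_simps)
qed

lemma exp_G_le_E0: "0 \<le> x \<Longrightarrow> x \<le> 1 \<Longrightarrow> exp (- \<beta> * G x) \<le> E0"
proof -
  assume x: "0 \<le> x" "x \<le> 1"
  have "\<beta> * B * x \<le> \<beta> * B * 1" using x \<beta> B(1) by (intro mult_left_mono) auto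
  then have "exp (- \<beta> * G 0) * exp (\<beta> * B * x) \<le> E0" by (simp add: E0_def exp_add[symmetric])
  then show ?thesis using exp_G_le[OF x(1)] by linarith
qed

lemma exp_difference: "u \<le> M \<Longrightarrow> v \<le> M \<Longrightarrow> \<bar>exp u - exp v\<bar> \<le> exp M * \<bar>u - v\<bar>" for u v M :: real
proof (induction u v rule: linorder_wlog)
  case (le u v)
  show ?case
  proof (cases "u = v")
    case False
    with le have uv: "u < v" by simp
    have c: "continuous_on {u..v} exp" by (intro continuous_intros)
    obtain z where z: "u < z" "z < v" "exp v - exp u = (v - u) * exp z"
      by (rule mean_value_interior[OF uv c DERIV_exp])
    have "exp z \<le> exp M" using z le by simp
    then have "(v - u) * exp z \<le> (v - u) * exp M" using uv by (intro mult_left_mono) auto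
    then show ?thesis using z uv by (simp add: mult.commute)
  qed simp
qed (simp add: abs_minus_commute)

text \<open>The Lipschitz bound at 0 permits freezing H at 0 in front of 1/x: the error (H x - H
  0)/x is bounded and causes no logarithm.\<close>

lemma H_bounds:
  assumes x: "0 \<le> x" "x \<le> 1"
  shows "\<bar>H x\<bar> \<le> \<beta> * E0 * B\<^sup>2" "\<bar>H x - H 0\<bar> \<le> KH * x"
proof -
  have g: "(G' y)\<^sup>2 \<le> B\<^sup>2" if "y \<ge> 0" for y
    using power_mono[OF B(2)[OF that], of 2] by simp
  show "\<bar>H x\<bar> \<le> \<beta> * E0 * B\<^sup>2"
    unfolding H_def using exp_G_le_E0[OF x] g[of x] x \<beta> E0_pos
    by (auto simp: abs_mult intro!: mult_mono mult_left_mono)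
  have M: "- \<beta> * G x \<le> - \<beta> * G 0 + \<beta> * B" "- \<beta> * G 0 \<le> - \<beta> * G 0 + \<beta> * B"
    using exp_G_le_E0[OF x] \<beta> B(1) by (simp_all add: E0_def)
  have e: "\<bar>exp (- \<beta> * G x) - exp (- \<beta> * G 0)\<bar> \<le> E0 * (\<beta> * B * x)"
  proof -
    have "\<bar>exp (- \<beta> * G x) - exp (- \<beta> * G 0)\<bar> \<le> E0 * \<bar>- \<beta> * G x - - \<beta> * G 0\<bar>"
      using exp_difference[OF M] by (simp add: E0_def)
    also have "\<bar>- \<beta> * G x - - \<beta> * G 0\<bar> = \<beta> * \<bar>G x - G 0\<bar>"
    proof -
      have "- \<beta> * G x - - \<beta> * G 0 = - (\<beta> * (G x - G 0))" by (simp add: algebra_simps)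
      then show ?thesis using \<beta> by (simp only: abs_minus_cancel abs_mult)
    qed
    also have "E0 * (\<beta> * \<bar>G x - G 0\<bar>) \<le> E0 * (\<beta> * (B * x))"
      using G_increment[OF x(1)] E0_pos \<beta> by (intro mult_left_mono) auto
    finally show ?thesis by (simp add: mult.assoc)
  qed
  have s: "\<bar>(G' x)\<^sup>2 - (G' 0)\<^sup>2\<bar> \<le> 2 * B * B1 * x"
  proof -
    have "(G' x)\<^sup>2 - (G' 0)\<^sup>2 = (G' x + G' 0) * (G' x - G' 0)" by (simp add: power2_eq_square algebra_simps)
    then have "\<bar>(G' x)\<^sup>2 - (G' 0)\<^sup>2\<bar> = \<bar>G' x + G' 0\<bar> * \<bar>G' x - G' 0\<bar>" by (simp add: abs_mult)
    also have "\<dots> \<le> (2 * B) * (B1 * x)"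
      using B(2)[of x] B(2)[of 0] B1(2)[OF x(1)] x B(1) by (intro mult_mono) auto
    finally show ?thesis by simp
  qed
  have "H x - H 0 = \<beta> * ((exp (- \<beta> * G x) - exp (- \<beta> * G 0)) * (G' x)\<^sup>2
      + exp (- \<beta> * G 0) * ((G' x)\<^sup>2 - (G' 0)\<^sup>2))" by (simp add: H_def algebra_simps)
  also have "\<bar>\<dots>\<bar> \<le> \<beta> * (E0 * (\<beta> * B * x) * B\<^sup>2 + E0 * (2 * B * B1 * x))"
  proof -
    have "\<bar>(exp (- \<beta> * G x) - exp (- \<beta> * G 0)) * (G' x)\<^sup>2\<bar> \<le> E0 * (\<beta> * B * x) * B\<^sup>2"
      using e g[OF x(1)] x \<beta> B(1) E0_pos by (simp only: abs_mult) (auto intro!: mult_mono)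
    moreover have "\<bar>exp (- \<beta> * G 0) * ((G' x)\<^sup>2 - (G' 0)\<^sup>2)\<bar> \<le> E0 * (2 * B * B1 * x)"
      using s exp_G_le_E0[of 0] E0_pos by (simp only: abs_mult) (auto intro!: mult_mono)
    ultimately have "\<bar>(exp (- \<beta> * G x) - exp (- \<beta> * G 0)) * (G' x)\<^sup>2 + exp (- \<beta> * G 0) * ((G' x)\<^sup>2 - (G' 0)\<^sup>2)\<bar>
      \<le> E0 * (\<beta> * B * x) * B\<^sup>2 + E0 * (2 * B * B1 * x)" by linarith
    then show ?thesis using \<beta> by (simp only: abs_mult) (auto intro!: mult_left_mono)
  qed
  also have "\<dots> = KH * x" by (simp add: KH_def algebra_simps)
  finally show "\<bar>H x - H 0\<bar> \<le> KH * x" .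
qed

text \<open>The singular term of g'' is (\<delta>-1) g'(y)/y = (\<delta>-1) F(y)/k(y).\<close>

definition k :: "real \<Rightarrow> real" where "k y = y * r y"

lemma k_eq: "y > 0 \<Longrightarrow> k y = y powr \<delta> * exp (- c * y\<^sup>2)"
  using powr_Suc_exponent[of y \<delta>] by (simp add: k_def r_eq)

lemma k_deriv: "y > 0 \<Longrightarrow> (k has_real_derivative r y * (\<delta> - 2 * c * y\<^sup>2)) (at y)"
proof -
  assume y: "y > 0"
  have "((\<lambda>y. y powr \<delta> * exp (- c * y\<^sup>2)) has_real_derivative
     \<delta> * y powr (\<delta> - 1) * exp (- c * y\<^sup>2) + exp (- c * y\<^sup>2) * (- c * (2 * y)) * y powr \<delta>) (at y)"
    using y by (auto intro!: derivative_eq_intros)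
  also have "\<delta> * y powr (\<delta> - 1) * exp (- c * y\<^sup>2) + exp (- c * y\<^sup>2) * (- c * (2 * y)) * y powr \<delta> = r y * (\<delta> - 2 * c * y\<^sup>2)"
    using powr_Suc_exponent[OF y, of \<delta>] by (simp add: r_eq algebra_simps power2_eq_square)
  finally have "((\<lambda>y. y powr \<delta> * exp (- c * y\<^sup>2)) has_real_derivative r y * (\<delta> - 2 * c * y\<^sup>2)) (at y)" .
  moreover have "\<forall>\<^sub>F z in nhds y. z powr \<delta> * exp (- c * z\<^sup>2) = k z"
    using eventually_nhds_in_open[of "{0<..}" y] y by (auto elim!: eventually_mono simp: k_eq)
  ultimately show ?thesis by (subst (asm) DERIV_cong_ev[OF refl _ refl]) auto
qed

lemma r_deriv: "y > 0 \<Longrightarrow> (r has_real_derivative r y * ((\<delta> - 1) / y - 2 * c * y)) (at y)"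
proof -
  assume y: "y > 0"
  have "(r has_real_derivative
     (\<delta> - 1) * y powr (\<delta> - 1 - 1) * exp (- c * y\<^sup>2) + exp (- c * y\<^sup>2) * (- c * (2 * y)) * y powr (\<delta> - 1)) (at y)"
    unfolding r_eq[abs_def] using y by (auto intro!: derivative_eq_intros)
  also have "(\<delta> - 1) * y powr (\<delta> - 1 - 1) * exp (- c * y\<^sup>2) + exp (- c * y\<^sup>2) * (- c * (2 * y)) * y powr (\<delta> - 1)
    = r y * ((\<delta> - 1) / y - 2 * c * y)"
    unfolding r_eq powr_Suc_exponent[OF y, of "\<delta> - 1"] using y by (simp add: field_simps)
  finally show ?thesis .
qed

end

section \<open>The Taylor remainder in three regions\<close>

context resolvent_instance
begin

definition N :: real where "N = K3 * (A / h)"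

lemma Ah_nonneg: "A / h \<ge> 0" using A_nonneg h by simp

lemma N_nonneg: "N \<ge> 0" unfolding N_def using K3_nonneg Ah_nonneg by (rule mult_nonneg_nonneg)

lemma N_bounds: "A / h \<le> N" "\<bar>F 0\<bar> \<le> N"
proof -
  have N: "N = K2 * (A / h) + (A / h) + (1 / \<mu>) * (A / h)" by (simp add: N_def K3_def distrib_right add_divide_distrib)
  have p: "K2 * (A / h) \<ge> 0" "(1 / \<mu>) * (A / h) \<ge> 0"
    using mult_nonneg_nonneg[OF K2_nonneg Ah_nonneg] mult_nonneg_nonneg[OF _ Ah_nonneg, of "1 / \<mu>"] \<mu> by simp_all
  show "A / h \<le> N" using N p by linarith
  have "A / (h * \<mu>) = (1 / \<mu>) * (A / h)" by simp
  then show "\<bar>F 0\<bar> \<le> N" using F_0_le(1) N p Ah_nonneg by linarith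
qed

lemma D_le_N: "x > 0 \<Longrightarrow> \<bar>D x\<bar> \<le> N * \<omega> x"
proof -
  assume x: "x > 0"
  have "K2 * (A / h) \<le> N" unfolding N_def K3_def
    using Ah_nonneg \<mu> by (intro mult_right_mono) auto
  then have "K2 * (A / h) * \<omega> x \<le> N * \<omega> x" using \<omega>_nonneg by (rule mult_right_mono)
  then show ?thesis using D_le[OF x] by linarith
qed

lemma q_le_N: "x > 0 \<Longrightarrow> \<bar>q x\<bar> \<le> (C1 + 1) * N * \<omega> x"
proof -
  assume x: "x > 0"
  have "A / h * 1 \<le> N * \<omega> x" using N_bounds(1) \<omega>_ge_1[OF x] N_nonneg Ah_nonneg by (intro mult_mono) auto
  then show ?thesis using q_le[OF D_le_N x] by (simp add: distrib_right)
qed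

lemma F_increment_N: "0 < x \<Longrightarrow> x \<le> 2 \<Longrightarrow> \<bar>F x - F 0\<bar> \<le> x * (KF * N)"
proof -
  assume x: "0 < x" "x \<le> 2"
  have "\<beta> * (9 * C1 * N + 2 * A / h) \<le> KF * N"
    unfolding KF_def using N_bounds(1) \<beta> by (simp add: mult.assoc distrib_right)
  then have "x * (\<beta> * (9 * C1 * N + 2 * A / h)) \<le> x * (KF * N)" using x by (intro mult_left_mono) auto
  then show ?thesis using F_increment(1)[OF D_le_N x] by linarith
qed

text \<open>This is g'', solved from L g = q; the bracket is the logarithmic derivative of
  \<open>r\<close>.\<close>

definition D2 :: "real \<Rightarrow> real" where "D2 x = \<beta> * q x - D x * ((\<delta> - 1) / x - 2 * c * x)"

lemma D_deriv: "x > 0 \<Longrightarrow> (D has_real_derivative D2 x) (at x)"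
proof -
  assume x: "x > 0"
  have r0: "r x \<noteq> 0" using r_pos[OF x] by simp
  have "(D has_real_derivative ((\<beta> * r x * q x) * r x - F x * (r x * ((\<delta> - 1) / x - 2 * c * x))) / (r x * r x)) (at x)"
    unfolding D_def[abs_def] q_def using F_deriv[OF x] r_deriv[OF x] r0 by (rule DERIV_divide)
  also have "((\<beta> * r x * q x) * r x - F x * (r x * ((\<delta> - 1) / x - 2 * c * x))) / (r x * r x) = D2 x"
    using r0 unfolding D2_def D_def by (simp add: diff_divide_distrib)
  finally show ?thesis .
qed

lemma g_deriv': "x > 0 \<Longrightarrow> (g has_real_derivative D x) (at x)"
  using g_deriv by (simp add: D_def)

definition T :: "real \<Rightarrow> real" where "T x = g (\<phi> x) - g x + h * G' x * D x"

text \<open>Here \<phi> is not known to be x - h G'(x), so the two parts of \<open>T\<close> are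
  bounded separately. The weight contributes y^(\<delta>-1) and the increment of g contributes
  y^(2-\<delta>), at the scale y = (5 B + 1) h; the product is of order h. Over an interval of
  length \<kappa> h this is O(h^2) N.\<close>

lemma T_near:
  assumes x: "0 < x" "x < \<kappa> * h"
  shows "\<bar>\<rho> x * T x\<bar> \<le> \<beta> * E0 * (2 * K1 * (5 * B + 1) + 2 * B) * N * h"
proof -
  let ?y = "(5 * B + 1) * h"
  have y: "x \<le> ?y" "x + B * h \<le> ?y" "?y \<le> 1" "?y > 0" "x \<le> 1"
  proof -
    have "?y = 5 * (B * h) + h" "\<kappa> * h = 4 * (B * h) + h" by (simp_all add: \<kappa>_def algebra_simps)
    then show "x \<le> ?y" "x + B * h \<le> ?y" "?y \<le> 1" "?y > 0" "x \<le> 1"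
      using x h(1) Bh by linarith+
  qed
  have rx: "0 \<le> r x" "r x \<le> x powr (\<delta> - 1)" using r_le[of x] r_pos[of x] x by auto
  have 1: "r x * \<bar>g (\<phi> x) - g x\<bar> \<le> 2 * K1 * (5 * B + 1) * N * h"
  proof -
    have "x powr (\<delta> - 1) \<le> ?y powr (\<delta> - 1)" using x y \<delta> by (intro powr_mono2) auto
    then have "r x \<le> ?y powr (\<delta> - 1)" using rx by linarith
    then have "r x * \<bar>g x - g (\<phi> x)\<bar> \<le> ?y powr (\<delta> - 1) * (2 * N * K1 * ?y powr (2 - \<delta>))"
      using g_increment_near_0[OF D_le_N x(1) y(1-3)] rx by (intro mult_mono) auto
    also have "\<dots> = 2 * N * K1 * (?y powr (\<delta> - 1) * ?y powr (2 - \<delta>))" by simp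
    also have "?y powr (\<delta> - 1) * ?y powr (2 - \<delta>) = ?y" using y by (simp add: powr_add[symmetric])
    finally show ?thesis by (simp add: abs_minus_commute algebra_simps)
  qed
  have 2: "r x * \<bar>h * G' x * D x\<bar> \<le> 2 * B * N * h"
  proof -
    have "r x * \<bar>D x\<bar> \<le> r x * (N * \<omega> x)" using D_le_N[OF x(1)] rx by (intro mult_left_mono) auto
    also have "\<dots> \<le> N * (x powr (\<delta> - 1) * \<omega> x)"
      using rx N_nonneg \<omega>_nonneg[of x] by (simp add: mult.left_commute mult_left_mono mult_right_mono)
    also have "\<dots> \<le> N * 2" using r_\<omega>_le(2)[of x] x y N_nonneg by (intro mult_left_mono) auto
    finally have rD: "r x * \<bar>D x\<bar> \<le> N * 2" .
    have "\<bar>h * G' x\<bar> \<le> h * B" using B(2)[of x] x h by (simp add: abs_mult)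
    from mult_mono[OF this rD] have "\<bar>h * G' x\<bar> * (r x * \<bar>D x\<bar>) \<le> (h * B) * (N * 2)"
      using h B(1) rx by simp
    then show ?thesis by (simp add: abs_mult mult_ac)
  qed
  have "r x * \<bar>T x\<bar> \<le> r x * (\<bar>g (\<phi> x) - g x\<bar> + \<bar>h * G' x * D x\<bar>)"
    unfolding T_def using rx by (intro mult_left_mono) auto
  also have "\<dots> \<le> (2 * K1 * (5 * B + 1) + 2 * B) * N * h" using 1 2 by (simp add: algebra_simps)
  finally have 3: "r x * \<bar>T x\<bar> \<le> (2 * K1 * (5 * B + 1) + 2 * B) * N * h" .
  have "\<bar>\<rho> x * T x\<bar> = \<beta> * exp (- \<beta> * G x) * (r x * \<bar>T x\<bar>)"
    using \<beta> rx by (simp add: \<rho>_eq abs_mult)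
  also have "\<dots> \<le> \<beta> * E0 * ((2 * K1 * (5 * B + 1) + 2 * B) * N * h)"
  proof (rule mult_mono[OF _ 3])
    show "\<beta> * exp (- \<beta> * G x) \<le> \<beta> * E0" using exp_G_le_E0[of x] x y \<beta> by (intro mult_left_mono) auto
  qed (use \<beta> E0_pos rx in auto)
  finally show ?thesis by (simp add: mult.assoc)
qed

text \<open>Beyond \<kappa> h the unclamped formula for \<phi> cancels the linear term, and the
  intermediate point stays comparable with x, away from the singularity. If the step has length 0,
  both sides vanish.\<close>

lemma T_Taylor:
  assumes x: "\<kappa> * h \<le> x"
  obtains \<xi> where "3 / 4 * x \<le> \<xi>" "\<xi> \<le> 5 / 4 * x" "\<bar>\<xi> - x\<bar> \<le> B * h" "T x = 1 / 2 * h\<^sup>2 * (G' x)\<^sup>2 * D2 \<xi>"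
proof -
  have x0: "x > 0" and xB: "4 * (B * h) \<le> x" "B * h \<le> x"
  proof -
    have "\<kappa> * h = 4 * (B * h) + h" by (simp add: \<kappa>_def algebra_simps)
    then show "x > 0" "4 * (B * h) \<le> x" "B * h \<le> x" using x h(1) Bh by linarith+
  qed
  have \<phi>x: "\<phi> x = x - h * G' x" using \<phi>(4)[of x] x0 xB by simp
  have d: "\<bar>\<phi> x - x\<bar> \<le> B * h" using \<phi>(3)[of x] x0 by simp
  show ?thesis
  proof (cases "\<phi> x = x")
    case True
    then have "T x = 1 / 2 * h\<^sup>2 * (G' x)\<^sup>2 * D2 x" using \<phi>x h by (simp add: T_def)
    then show ?thesis using that[of x] x0 Bh by simp
  next
    case False
    define df where "df m = (if m = 0 then g else if m = 1 then D else D2)" for m :: nat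
    have "\<exists>t. (if \<phi> x < x then \<phi> x < t \<and> t < x else x < t \<and> t < \<phi> x) \<and>
       g (\<phi> x) = (\<Sum>m<2. df m x / fact m * (\<phi> x - x) ^ m) + df 2 t / fact 2 * (\<phi> x - x) ^ 2"
    proof (rule Taylor[where a = "3 / 4 * x" and b = "5 / 4 * x"])
      show "\<forall>m t. m < 2 \<and> 3 / 4 * x \<le> t \<and> t \<le> 5 / 4 * x \<longrightarrow> (df m has_real_derivative df (Suc m) t) (at t)"
        using x0 by (auto simp: df_def less_2_cases_iff intro!: g_deriv' D_deriv)
    qed (use False d xB x0 in \<open>auto simp: df_def abs_le_iff\<close>)
    then obtain t where t: "if \<phi> x < x then \<phi> x < t \<and> t < x else x < t \<and> t < \<phi> x"
      "g (\<phi> x) = (\<Sum>m<2. df m x / fact m * (\<phi> x - x) ^ m) + df 2 t / fact 2 * (\<phi> x - x) ^ 2" by blast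
    have "T x = 1 / 2 * h\<^sup>2 * (G' x)\<^sup>2 * D2 t"
      using t(2) unfolding T_def \<phi>x by (simp add: df_def numeral_2_eq_2 power_mult_distrib algebra_simps)
    moreover have "\<bar>t - x\<bar> \<le> B * h" using t(1) d by (auto split: if_splits)
    ultimately show ?thesis using that[of t] xB by (auto simp: abs_le_iff)
  qed
qed

text \<open>No singularity is left beyond 1: g'' grows at most like x^3, the weight makes this
  x^(\<delta>+2), and the Gaussian beats both this power and the exponential of the at most linear
  growth of -\<beta> G.\<close>

lemma T_far:
  assumes x: "1 \<le> x"
  shows "\<bar>\<rho> x * T x\<bar> \<le> \<beta> * exp (- \<beta> * G 0) * (B\<^sup>2 * (2 * (\<beta> * (C1 + 1) + 2 + 4 * c))) * N * h\<^sup>2 * (x powr (\<delta> + 2) * exp (\<beta> * B * x - c * x\<^sup>2))"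
proof -
  have "\<kappa> * h \<le> (5 * B + 1) * h" using B(1) h by (intro mult_right_mono) (auto simp: \<kappa>_def)
  then have "\<kappa> * h \<le> x" using h x by linarith
  then obtain \<xi> where \<xi>: "3 / 4 * x \<le> \<xi>" "\<xi> \<le> 5 / 4 * x" "T x = 1 / 2 * h\<^sup>2 * (G' x)\<^sup>2 * D2 \<xi>"
    by (rule T_Taylor)
  have x0: "x > 0" "\<xi> > 0" using x \<xi> by auto
  have "x powr (1 - \<delta>) \<le> 1" using x \<delta> powr_mono[of "1 - \<delta>" 0 x] by simp
  moreover have "1 \<le> x\<^sup>2" using x by (simp add: one_le_power)
  ultimately have "\<omega> x \<le> 2 * x\<^sup>2" unfolding \<omega>_def by linarith
  then have w: "\<omega> \<xi> \<le> 4 * x\<^sup>2" using \<omega>_scale(2)[of x \<xi>] x0 \<xi> by linarith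
  have f: "\<bar>(\<delta> - 1) / \<xi> - 2 * c * \<xi>\<bar> \<le> 2 * x + 4 * c * x"
  proof -
    have "(\<delta> - 1) / \<xi> \<le> 1 / (3 / 4 * x)" using \<delta> \<xi> x0 by (intro frac_le) auto
    also have "\<dots> \<le> 2 * x" using x mult_mono[of 1 x 1 x] by (simp add: field_simps)
    finally have "(\<delta> - 1) / \<xi> \<le> 2 * x" .
    moreover have "0 \<le> (\<delta> - 1) / \<xi>" using \<delta> x0 by simp
    moreover have "2 * c * \<xi> \<le> 4 * c * x" using \<xi> x0 c_pos by (simp add: mult_left_mono)
    moreover have "0 \<le> 2 * c * \<xi>" using x0 c_pos by simp
    moreover have "0 \<le> 4 * c * x" "0 \<le> 2 * x" using x0 c_pos by auto
    ultimately show ?thesis unfolding abs_le_iff by linarith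
  qed
  have "\<bar>D2 \<xi>\<bar> \<le> \<beta> * \<bar>q \<xi>\<bar> + \<bar>D \<xi>\<bar> * \<bar>(\<delta> - 1) / \<xi> - 2 * c * \<xi>\<bar>"
    using abs_triangle_ineq4[of "\<beta> * q \<xi>" "D \<xi> * ((\<delta> - 1) / \<xi> - 2 * c * \<xi>)"] \<beta>
    by (simp add: D2_def abs_mult)
  also have "\<dots> \<le> \<beta> * ((C1 + 1) * N * (4 * x\<^sup>2)) + N * (4 * x\<^sup>2) * (2 * x + 4 * c * x)"
  proof (intro add_mono mult_mono mult_left_mono)
    show "\<bar>q \<xi>\<bar> \<le> (C1 + 1) * N * (4 * x\<^sup>2)"
      using q_le_N[OF x0(2)] w mult_left_mono[OF w, of "(C1 + 1) * N"] constants N_nonneg by (smt (verit) mult_nonneg_nonneg)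
    show "\<bar>D \<xi>\<bar> \<le> N * (4 * x\<^sup>2)"
      using D_le_N[OF x0(2)] mult_left_mono[OF w N_nonneg] by linarith
  qed (use f \<beta> N_nonneg in auto)
  also have "\<dots> \<le> 4 * (\<beta> * (C1 + 1) + 2 + 4 * c) * N * x ^ 3"
  proof -
    have "x\<^sup>2 \<le> x ^ 3" using x by (intro power_increasing) auto
    then have "\<beta> * (C1 + 1) * N * x\<^sup>2 \<le> \<beta> * (C1 + 1) * N * x ^ 3"
      using \<beta> constants N_nonneg by (intro mult_left_mono mult_nonneg_nonneg) auto
    then show ?thesis by (simp add: algebra_simps power2_eq_square power3_eq_cube)
  qed
  finally have D2: "\<bar>D2 \<xi>\<bar> \<le> 4 * (\<beta> * (C1 + 1) + 2 + 4 * c) * N * x ^ 3" .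
  have g2: "(G' x)\<^sup>2 \<le> B\<^sup>2" using power_mono[OF B(2)[of x], of 2] x by simp
  have "\<bar>T x\<bar> = 1 / 2 * h\<^sup>2 * ((G' x)\<^sup>2 * \<bar>D2 \<xi>\<bar>)" unfolding \<xi>(3) by (simp add: abs_mult)
  also have "\<dots> \<le> 1 / 2 * h\<^sup>2 * (B\<^sup>2 * (4 * (\<beta> * (C1 + 1) + 2 + 4 * c) * N * x ^ 3))"
    using g2 D2 by (intro mult_left_mono mult_mono) auto
  also have "\<dots> = B\<^sup>2 * (2 * (\<beta> * (C1 + 1) + 2 + 4 * c)) * N * h\<^sup>2 * x ^ 3" by simp
  finally have Tx: "\<bar>T x\<bar> \<le> B\<^sup>2 * (2 * (\<beta> * (C1 + 1) + 2 + 4 * c)) * N * h\<^sup>2 * x ^ 3" .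
  have rx: "r x \<ge> 0" using r_pos[of x] x0 by simp
  have "\<bar>\<rho> x * T x\<bar> = \<beta> * exp (- \<beta> * G x) * (r x * \<bar>T x\<bar>)"
    using \<beta> rx by (simp add: \<rho>_eq abs_mult)
  also have "\<dots> \<le> \<beta> * (exp (- \<beta> * G 0) * exp (\<beta> * B * x)) * (r x * (B\<^sup>2 * (2 * (\<beta> * (C1 + 1) + 2 + 4 * c)) * N * h\<^sup>2 * x ^ 3))"
  proof (rule mult_mono[OF _ mult_left_mono[OF Tx rx]])
    show "\<beta> * exp (- \<beta> * G x) \<le> \<beta> * (exp (- \<beta> * G 0) * exp (\<beta> * B * x))"
      using exp_G_le[of x] x0 \<beta> by (intro mult_left_mono) auto
  qed (use \<beta> rx in auto)
  also have "\<dots> = \<beta> * exp (- \<beta> * G 0) * (B\<^sup>2 * (2 * (\<beta> * (C1 + 1) + 2 + 4 * c))) * N * h\<^sup>2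
      * ((x powr (\<delta> - 1) * x ^ 3) * (exp (\<beta> * B * x) * exp (- c * x\<^sup>2)))" by (simp add: r_eq)
  also have "x powr (\<delta> - 1) * x ^ 3 = x powr (\<delta> + 2)"
    using x0 by (simp add: powr_add[symmetric] powr_numeral[symmetric] add.commute del: powr_numeral)
  also have "exp (\<beta> * B * x) * exp (- c * x\<^sup>2) = exp (\<beta> * B * x - c * x\<^sup>2)" by (simp add: exp_add[symmetric])
  finally show ?thesis .
qed

end

section \<open>The singular weight at nearby points\<close>

context drift_setting
begin

lemma inverse_powr_half: "(3 / 4 :: real) powr (- \<delta>) \<le> 2"
proof -
  have "(3 / 4 :: real) powr (- \<delta>) \<le> (3 / 4) powr (- 2)" using \<delta> by (intro powr_mono') auto
  also have "\<dots> = 16 / 9"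
  proof -
    have "(3 / 4 :: real) powr 2 = 9 / 16" by (simp add: power2_eq_square)
    moreover have "(3 / 4 :: real) powr (- 2) = inverse ((3 / 4) powr 2)" by (rule powr_minus)
    ultimately show ?thesis by (simp only:) simp
  qed
  finally show ?thesis by simp
qed

lemma inverse_k_le: "0 < x \<Longrightarrow> 3 / 4 * x \<le> y \<Longrightarrow> y \<le> 2 \<Longrightarrow> 1 / k y \<le> 2 * exp (4 * c) * x powr (- \<delta>)"
proof -
  assume x: "0 < x" "3 / 4 * x \<le> y" "y \<le> 2"
  have y: "y > 0" using x by linarith
  have "1 / k y = y powr (- \<delta>) * exp (c * y\<^sup>2)"
    unfolding k_eq[OF y] by (simp add: powr_minus exp_minus field_simps)
  also have "\<dots> \<le> (2 * x powr (- \<delta>)) * exp (4 * c)"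
  proof (rule mult_mono)
    have "y powr (- \<delta>) \<le> (3 / 4 * x) powr (- \<delta>)" using x y \<delta> by (intro powr_mono2') auto
    also have "\<dots> = (3 / 4) powr (- \<delta>) * x powr (- \<delta>)" by (rule powr_mult)
    also have "\<dots> \<le> 2 * x powr (- \<delta>)" using inverse_powr_half by (intro mult_right_mono) auto
    finally show "y powr (- \<delta>) \<le> 2 * x powr (- \<delta>)" .
    have "y\<^sup>2 \<le> 2\<^sup>2" using x y by (intro power_mono) auto
    then show "exp (c * y\<^sup>2) \<le> exp (4 * c)" using c_pos by simp
  qed auto
  finally show ?thesis by (simp add: mult_ac)
qed

lemma k_pos: "y > 0 \<Longrightarrow> k y > 0" using r_pos by (simp add: k_def)

text \<open>Taylor's formula evaluates g'' at an unknown point \<xi>, whereas the weight stands at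
  x; this lemma pays for moving one to the other. The derivative of 1/k is of order x^(\<delta>-1)
  x^(-2\<delta>) = x^(-\<delta>-1).\<close>

lemma inverse_k_increment:
  assumes x: "0 < x" "x \<le> 1" and y: "3 / 4 * x \<le> y" "y \<le> 5 / 4 * x"
  shows "\<bar>1 / k y - 1 / k x\<bar> \<le> (8 * exp (8 * c) * (2 + 8 * c)) * \<bar>y - x\<bar> * x powr (- \<delta> - 1)"
proof -
  have main: "\<bar>1 / k v - 1 / k u\<bar> \<le> (8 * exp (8 * c) * (2 + 8 * c)) * (v - u) * x powr (- \<delta> - 1)"
    if uv: "u < v" "3 / 4 * x \<le> u" "v \<le> 5 / 4 * x" for u v
  proof -
    have pos: "z > 0" if "u \<le> z" for z using that uv x by linarith
    have d: "((\<lambda>y. 1 / k y) has_real_derivative - (r z * (\<delta> - 2 * c * z\<^sup>2)) / (k z * k z)) (at z)" if "z > 0" for z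
      using k_pos[OF that] k_deriv[OF that] by (auto intro!: derivative_eq_intros)
    have cont: "continuous_on {u..v} (\<lambda>y. 1 / k y)"
    proof (intro continuous_at_imp_continuous_on ballI)
      fix z assume "z \<in> {u..v}"
      then show "isCont (\<lambda>y. 1 / k y) z" by (intro DERIV_isCont[OF d[OF pos]]) simp
    qed
    have d': "((\<lambda>y. 1 / k y) has_real_derivative - (r z * (\<delta> - 2 * c * z\<^sup>2)) / (k z * k z)) (at z)" if "u < z" "z < v" for z
      using d pos that by simp
    obtain z where z: "u < z" "z < v" "1 / k v - 1 / k u = (v - u) * (- (r z * (\<delta> - 2 * c * z\<^sup>2)) / (k z * k z))"
      by (rule mean_value_interior[OF uv(1) cont d'])
    have z0: "z > 0" and z2: "z \<le> 2" "z \<le> 2 * x" "3 / 4 * x \<le> z" using pos[of z] z uv x by auto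
    have zz: "z\<^sup>2 \<le> 4" using power_mono[of z 2 2] z0 z2 by simp
    have "c * z\<^sup>2 \<le> c * 4" using zz c_pos by (intro mult_left_mono) auto
    then have f: "\<bar>\<delta> - 2 * c * z\<^sup>2\<bar> \<le> 2 + 8 * c" using \<delta> c_pos zero_le_power2[of z] mult_nonneg_nonneg[of c "z\<^sup>2"]
      unfolding abs_le_iff by linarith
    have rz: "r z \<le> 2 * x powr (\<delta> - 1)"
    proof -
      have "z powr (\<delta> - 1) \<le> (2 * x) powr (\<delta> - 1)" using z0 z2 \<delta> by (intro powr_mono2) auto
      also have "\<dots> = 2 powr (\<delta> - 1) * x powr (\<delta> - 1)" by (rule powr_mult)
      also have "\<dots> \<le> 2 * x powr (\<delta> - 1)" using powr_le_2[of 2] by (intro mult_right_mono) auto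
      finally show ?thesis using r_le[of z] z0 by linarith
    qed
    have kz: "1 / k z \<le> 2 * exp (4 * c) * x powr (- \<delta>)" "1 / k z \<ge> 0"
      using inverse_k_le[OF x(1) z2(3,1)] k_pos[OF z0] by auto
    have "\<bar>1 / k v - 1 / k u\<bar> = (v - u) * (r z * \<bar>\<delta> - 2 * c * z\<^sup>2\<bar> * ((1 / k z) * (1 / k z)))"
      unfolding z(3) using uv r_pos[OF z0] k_pos[OF z0] by (simp add: abs_mult)
    also have "\<dots> \<le> (v - u) * ((2 * x powr (\<delta> - 1)) * (2 + 8 * c) * ((2 * exp (4 * c) * x powr (- \<delta>)) * (2 * exp (4 * c) * x powr (- \<delta>))))"
      using uv rz f kz r_pos[OF z0] c_pos by (intro mult_left_mono mult_mono mult_nonneg_nonneg) auto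
    also have "\<dots> = (8 * (exp (4 * c) * exp (4 * c)) * (2 + 8 * c)) * (v - u) * (x powr (\<delta> - 1) * (x powr (- \<delta>) * x powr (- \<delta>)))"
      by (simp add: mult_ac)
    also have "exp (4 * c) * exp (4 * c) = exp (8 * c)" by (simp add: exp_add[symmetric])
    also have "x powr (\<delta> - 1) * (x powr (- \<delta>) * x powr (- \<delta>)) = x powr (- \<delta> - 1)"
      using x by (simp add: powr_add[symmetric])
    finally show ?thesis .
  qed
  consider "x = y" | "x < y" | "y < x" by linarith
  then show ?thesis
  proof cases
    case 2
    then show ?thesis using main[of x y] x y by simp
  next
    case 3
    then show ?thesis using main[of y x] x y by (simp add: abs_minus_commute)
  qed simp
qed

text \<open>One summand for each of the error terms \<open>t1\<close> to \<open>t4\<close> in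
  \<open>D2_mid\<close>.\<close>

definition Km :: real where
  "Km = 2 * \<beta> * (C1 + 1) * 2 + 2 * c * 8 + 2 * exp (4 * c) * 2 * KF + 8 * exp (8 * c) * (2 + 8 * c) * B"

lemma Km_nonneg: "Km \<ge> 0"
  unfolding Km_def using \<beta> c_pos constants KF_nonneg B(1)
  by (intro add_nonneg_nonneg mult_nonneg_nonneg) auto

end

context resolvent_instance
begin

text \<open>\<open>F 0 / x\<close> is the source of the logarithm.\<close>

lemma D2_mid:
  assumes x: "\<kappa> * h \<le> x" "x \<le> 1" and \<xi>: "3 / 4 * x \<le> \<xi>" "\<xi> \<le> 5 / 4 * x" "\<bar>\<xi> - x\<bar> \<le> B * h"
  shows "\<bar>r x * D2 \<xi> + (\<delta> - 1) * F 0 / x\<bar> \<le> Km * N * (1 + h / x\<^sup>2)"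
proof -
  have x0: "x > 0"
  proof -
    have "\<kappa> * h = 4 * (B * h) + h" by (simp add: \<kappa>_def algebra_simps)
    then show ?thesis using x h(1) Bh by linarith
  qed
  have \<xi>0: "\<xi> > 0" "\<xi> \<le> 2" "\<xi> \<le> 2 * x" using x0 \<xi> x by auto
  have rx: "0 \<le> r x" "r x \<le> x powr (\<delta> - 1)" using r_le[of x] r_pos[of x] x0 by auto
  have w: "r x * \<omega> \<xi> \<le> 4"
  proof -
    have "r x * \<omega> \<xi> \<le> x powr (\<delta> - 1) * (2 * \<omega> x)"
      using rx \<omega>_scale(2)[of x \<xi>] x0 \<xi> \<omega>_nonneg by (intro mult_mono) auto
    also have "x powr (\<delta> - 1) * (2 * \<omega> x) = 2 * (x powr (\<delta> - 1) * \<omega> x)" by simp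
    also have "\<dots> \<le> 2 * 2" using r_\<omega>_le(2)[OF x0 x(2)] by (rule mult_left_mono) simp
    also have "(2 * 2 :: real) = 4" by simp
    finally show ?thesis .
  qed
  have h1: "h / x\<^sup>2 \<ge> 0" using h by simp
  have t1: "r x * \<bar>\<beta> * q \<xi>\<bar> \<le> 2 * \<beta> * (C1 + 1) * 2 * N"
  proof -
    have "r x * \<bar>\<beta> * q \<xi>\<bar> = \<beta> * (r x * \<bar>q \<xi>\<bar>)" using \<beta> by (simp add: abs_mult)
    also have "\<dots> \<le> \<beta> * (r x * ((C1 + 1) * N * \<omega> \<xi>))"
      using q_le_N[OF \<xi>0(1)] rx \<beta> by (intro mult_left_mono) auto
    also have "\<dots> = \<beta> * (C1 + 1) * N * (r x * \<omega> \<xi>)" by simp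
    also have "\<dots> \<le> \<beta> * (C1 + 1) * N * 4"
      using w \<beta> constants N_nonneg by (intro mult_left_mono mult_nonneg_nonneg) auto
    finally show ?thesis by (simp add: algebra_simps)
  qed
  have t2: "r x * \<bar>D \<xi> * (2 * c * \<xi>)\<bar> \<le> 2 * c * 8 * N"
  proof -
    have "r x * \<bar>D \<xi> * (2 * c * \<xi>)\<bar> = (r x * \<bar>D \<xi>\<bar>) * (2 * c * \<xi>)" using c_pos \<xi>0 by (simp add: abs_mult)
    also have "\<dots> \<le> (r x * (N * \<omega> \<xi>)) * (2 * c * 2)"
      using D_le_N[OF \<xi>0(1)] rx c_pos \<xi>0 N_nonneg \<omega>_nonneg by (intro mult_mono mult_left_mono mult_nonneg_nonneg) auto
    also have "\<dots> = N * (2 * c * 2) * (r x * \<omega> \<xi>)" by simp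
    also have "\<dots> \<le> N * (2 * c * 2) * 4" using w c_pos N_nonneg by (intro mult_left_mono) auto
    finally show ?thesis by (simp add: mult_ac)
  qed
  \<comment> \<open>The flux is Lipschitz at 0, which gains a factor x and cancels the 1/x of the
    weights.\<close>
  have t3: "r x * \<bar>(F \<xi> - F 0) * (1 / k \<xi>)\<bar> \<le> 2 * exp (4 * c) * 2 * KF * N"
  proof -
    have k\<xi>: "0 \<le> 1 / k \<xi>" "1 / k \<xi> \<le> 2 * exp (4 * c) * x powr (- \<delta>)"
      using inverse_k_le[OF x0 \<xi>(1) \<xi>0(2)] k_pos[OF \<xi>0(1)] by auto
    have Fx: "\<bar>F \<xi> - F 0\<bar> \<le> 2 * x * (KF * N)"
    proof -
      have "\<xi> * (KF * N) \<le> 2 * x * (KF * N)" using \<xi>0 KF_nonneg N_nonneg by (intro mult_right_mono) auto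
      then show ?thesis using F_increment_N[OF \<xi>0(1,2)] by linarith
    qed
    have "r x * \<bar>(F \<xi> - F 0) * (1 / k \<xi>)\<bar> = r x * (\<bar>F \<xi> - F 0\<bar> * (1 / k \<xi>))"
      using k\<xi>(1) by (simp only: abs_mult abs_of_nonneg)
    also have "\<dots> \<le> x powr (\<delta> - 1) * ((2 * x * (KF * N)) * (2 * exp (4 * c) * x powr (- \<delta>)))"
      using rx Fx k\<xi> x0 KF_nonneg N_nonneg by (intro mult_mono mult_nonneg_nonneg) auto
    also have "\<dots> = (2 * exp (4 * c) * 2 * KF * N) * (x powr (\<delta> - 1) * (x * x powr (- \<delta>)))" by simp
    also have "x powr (\<delta> - 1) * (x * x powr (- \<delta>)) = 1"
    proof -
      have "x powr (1 - \<delta>) = x * x powr (- \<delta>)" using powr_Suc_exponent[OF x0, of "1 - \<delta>"] by simp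
      moreover have "x powr (\<delta> - 1) * x powr (1 - \<delta>) = 1" using x0 by (simp add: powr_add[symmetric])
      ultimately show ?thesis by (simp only:)
    qed
    finally show ?thesis by simp
  qed
  \<comment> \<open>The shift from x to \<xi> is at most B h and costs a further power of x, whence
    h/x^2.\<close>
  have t4: "r x * \<bar>F 0 * (1 / k \<xi> - 1 / k x)\<bar> \<le> 8 * exp (8 * c) * (2 + 8 * c) * B * N * (h / x\<^sup>2)"
  proof -
    let ?Q = "8 * exp (8 * c) * (2 + 8 * c)"
    have Q: "?Q \<ge> 0" using c_pos by simp
    have "\<bar>1 / k \<xi> - 1 / k x\<bar> \<le> ?Q * \<bar>\<xi> - x\<bar> * x powr (- \<delta> - 1)"
      by (rule inverse_k_increment[OF x0 x(2) \<xi>(1,2)])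
    also have "\<dots> \<le> ?Q * (B * h) * x powr (- \<delta> - 1)" using \<xi>(3) Q by (intro mult_right_mono mult_left_mono) auto
    finally have fk: "\<bar>F 0\<bar> * \<bar>1 / k \<xi> - 1 / k x\<bar> \<le> N * (?Q * (B * h) * x powr (- \<delta> - 1))"
      using N_bounds(2) N_nonneg by (intro mult_mono) auto
    have "r x * \<bar>F 0 * (1 / k \<xi> - 1 / k x)\<bar> \<le> x powr (\<delta> - 1) * (N * (?Q * (B * h) * x powr (- \<delta> - 1)))"
      unfolding abs_mult using rx by (intro mult_mono[OF rx(2) fk]) auto
    also have "\<dots> = ?Q * B * N * (h * (x powr (\<delta> - 1) * x powr (- \<delta> - 1)))" by (simp only: mult_ac)
    also have "h * (x powr (\<delta> - 1) * x powr (- \<delta> - 1)) = h / x\<^sup>2"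
    proof -
      have "x powr (\<delta> - 1) * x powr (- \<delta> - 1) = x powr (- 2)" by (simp add: powr_add[symmetric])
      also have "\<dots> = 1 / x\<^sup>2" using x0 by (simp add: powr_minus divide_inverse)
      finally show ?thesis by simp
    qed
    finally show ?thesis .
  qed
  have kx: "r x / k x = 1 / x" using r_pos[OF x0] by (simp add: k_def)
  \<comment> \<open>F(\<xi>)/k(\<xi>) is replaced by F(0)/k(x) in two moves, first in the flux and
    then in the weight. What remains is r(x)/k(x) = 1/x times the flux at 0.\<close>
  have eq: "r x * D2 \<xi> + (\<delta> - 1) * F 0 / x
    = r x * (\<beta> * q \<xi>) + r x * (D \<xi> * (2 * c * \<xi>))
      - (\<delta> - 1) * (r x * ((F \<xi> - F 0) * (1 / k \<xi>)) + r x * (F 0 * (1 / k \<xi> - 1 / k x)))"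
  proof -
    have 1: "D \<xi> * ((\<delta> - 1) / \<xi>) = (\<delta> - 1) * (F \<xi> * (1 / k \<xi>))"
      using \<xi>0 by (simp add: D_def k_def mult.commute)
    have 2: "(\<delta> - 1) * F 0 / x = (\<delta> - 1) * (r x * (F 0 * (1 / k x)))"
      using kx by (metis divide_inverse mult.commute mult.left_commute mult_1 times_divide_eq_right)
    have "D2 \<xi> = \<beta> * q \<xi> - (\<delta> - 1) * (F \<xi> * (1 / k \<xi>)) + D \<xi> * (2 * c * \<xi>)"
      unfolding D2_def right_diff_distrib 1 by simp
    moreover have "R * (Q - d * (F1 * k1) + P) + d * (R * (F2 * k2))
        = R * Q + R * P - d * (R * ((F1 - F2) * k1) + R * (F2 * (k1 - k2)))" for R Q P d F1 F2 k1 k2 :: real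
      by (simp add: algebra_simps)
    ultimately show ?thesis unfolding 2 by (simp only:)
  qed
  have d1: "\<bar>u + v - (\<delta> - 1) * (s + t)\<bar> \<le> \<bar>u\<bar> + \<bar>v\<bar> + \<bar>s\<bar> + \<bar>t\<bar>" for u v s t
  proof -
    define w where "w = (\<delta> - 1) * (s + t)"
    have "\<bar>w\<bar> = (\<delta> - 1) * \<bar>s + t\<bar>" using \<delta> by (simp add: w_def abs_mult)
    also have "\<dots> \<le> 1 * \<bar>s + t\<bar>" using \<delta> by (intro mult_right_mono) auto
    finally have "\<bar>u + v - w\<bar> \<le> \<bar>u\<bar> + \<bar>v\<bar> + \<bar>s\<bar> + \<bar>t\<bar>" by (smt (verit))
    then show ?thesis by (simp only: w_def)
  qed
  have ar: "\<bar>r x * u\<bar> = r x * \<bar>u\<bar>" for u using rx by (simp add: abs_mult)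
  have "\<bar>r x * D2 \<xi> + (\<delta> - 1) * F 0 / x\<bar>
    \<le> 2 * \<beta> * (C1 + 1) * 2 * N + 2 * c * 8 * N + 2 * exp (4 * c) * 2 * KF * N + 8 * exp (8 * c) * (2 + 8 * c) * B * N * (h / x\<^sup>2)"
    unfolding eq
    by (rule order_trans[OF d1 add_mono[OF add_mono[OF add_mono[OF t1[folded ar] t2[folded ar]] t3[folded ar]] t4[folded ar]]])
  also have "\<dots> \<le> Km * N * (1 + h / x\<^sup>2)"
  proof -
    have gen: "a1 * n + a2 * n + a3 * n + a4 * n * e \<le> (a1 + a2 + a3 + a4) * n * (1 + e)"
      if "a1 \<ge> 0" "a2 \<ge> 0" "a3 \<ge> 0" "a4 \<ge> 0" "n \<ge> 0" "e \<ge> 0" for a1 a2 a3 a4 n e :: real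
    proof -
      have "(a1 + a2 + a3 + a4) * n * (1 + e) = a1 * n + a2 * n + a3 * n + a4 * n * e + (a4 * n + (a1 + a2 + a3) * n * e)"
        by (simp add: algebra_simps)
      moreover have "a4 * n + (a1 + a2 + a3) * n * e \<ge> 0" using that by auto
      ultimately show ?thesis by linarith
    qed
    show ?thesis unfolding Km_def
      using \<beta> c_pos constants KF_nonneg B(1) N_nonneg h1
      by (intro gen mult_nonneg_nonneg add_nonneg_nonneg) auto
  qed
  finally show ?thesis .
qed

text \<open>The preceding estimate multiplied by H, with H frozen at 0 in the main term. The error
  is harmless because h/x^2 integrates over [\<kappa> h, 1] to at most h/(\<kappa> h), which is at
  most 1.\<close>

lemma T_mid:
  assumes x: "\<kappa> * h \<le> x" "x \<le> 1"
  shows "\<bar>\<rho> x * T x + 1 / 2 * (\<delta> - 1) * F 0 * H 0 * h\<^sup>2 / x\<bar> \<le> (\<beta> * E0 * B\<^sup>2 * Km + KH) * N * h\<^sup>2 * (1 + h / x\<^sup>2)"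
proof -
  obtain \<xi> where \<xi>: "3 / 4 * x \<le> \<xi>" "\<xi> \<le> 5 / 4 * x" "\<bar>\<xi> - x\<bar> \<le> B * h" "T x = 1 / 2 * h\<^sup>2 * (G' x)\<^sup>2 * D2 \<xi>"
    by (rule T_Taylor[OF x(1)])
  have x0: "x > 0"
  proof -
    have "\<kappa> * h = 4 * (B * h) + h" by (simp add: \<kappa>_def algebra_simps)
    then show ?thesis using x h(1) Bh by linarith
  qed
  have h1: "h / x\<^sup>2 \<ge> 0" using h by simp
  define e where "e = r x * D2 \<xi> + (\<delta> - 1) * F 0 / x"
  have e: "\<bar>e\<bar> \<le> Km * N * (1 + h / x\<^sup>2)" unfolding e_def by (rule D2_mid[OF x \<xi>(1-3)])
  have "\<rho> x * T x = 1 / 2 * h\<^sup>2 * (H x * (r x * D2 \<xi>))"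
    unfolding \<xi>(4) \<rho>_eq H_def by (simp add: mult_ac)
  also have "r x * D2 \<xi> = e - (\<delta> - 1) * F 0 / x" by (simp add: e_def)
  finally have "\<rho> x * T x + 1 / 2 * (\<delta> - 1) * F 0 * H 0 * h\<^sup>2 / x
    = 1 / 2 * h\<^sup>2 * (H x * e - (\<delta> - 1) * F 0 * ((H x - H 0) / x))"
    by (simp add: algebra_simps diff_divide_distrib)
  also have "\<bar>\<dots>\<bar> = 1 / 2 * h\<^sup>2 * \<bar>H x * e - (\<delta> - 1) * F 0 * ((H x - H 0) / x)\<bar>"
    by (simp add: abs_mult)
  also have "\<dots> \<le> 1 / 2 * h\<^sup>2 * (\<beta> * E0 * B\<^sup>2 * (Km * N * (1 + h / x\<^sup>2)) + N * KH)"
  proof (rule mult_left_mono)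
    have "\<bar>H x * e\<bar> \<le> \<beta> * E0 * B\<^sup>2 * (Km * N * (1 + h / x\<^sup>2))"
      unfolding abs_mult using H_bounds(1)[of x] x0 x e \<beta> E0_pos by (intro mult_mono mult_nonneg_nonneg) auto
    moreover have "\<bar>(\<delta> - 1) * F 0 * ((H x - H 0) / x)\<bar> \<le> N * KH"
    proof -
      have "\<bar>(H x - H 0) / x\<bar> \<le> KH" using H_bounds(2)[of x] x0 x by (simp add: abs_divide divide_le_eq)
      moreover have "\<bar>(\<delta> - 1) * F 0\<bar> \<le> 1 * N"
        unfolding abs_mult using \<delta> N_bounds(2) by (intro mult_mono) auto
      ultimately show ?thesis using N_nonneg by (subst abs_mult) (intro mult_mono, auto)
    qed
    ultimately show "\<bar>H x * e - (\<delta> - 1) * F 0 * ((H x - H 0) / x)\<bar>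
      \<le> \<beta> * E0 * B\<^sup>2 * (Km * N * (1 + h / x\<^sup>2)) + N * KH" by linarith
  qed simp
  also have "\<dots> \<le> (\<beta> * E0 * B\<^sup>2 * Km + KH) * N * h\<^sup>2 * (1 + h / x\<^sup>2)"
  proof -
    have gen: "1 / 2 * s * (a1 * (a2 * n * (1 + e)) + n * a3) \<le> (a1 * a2 + a3) * n * s * (1 + e)"
      if "a1 \<ge> 0" "a2 \<ge> 0" "a3 \<ge> 0" "n \<ge> 0" "e \<ge> 0" "s \<ge> 0" for a1 a2 a3 n e s :: real
    proof -
      have "(a1 * a2 + a3) * n * s * (1 + e) - 1 / 2 * s * (a1 * (a2 * n * (1 + e)) + n * a3)
        = 1 / 2 * (a1 * a2 * n * s * (1 + e)) + 1 / 2 * (a3 * n * s) + a3 * n * s * e"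
        by (simp add: algebra_simps)
      moreover have "\<dots> \<ge> 0" using that by auto
      ultimately show ?thesis by linarith
    qed
    show ?thesis
      using \<beta> E0_pos Km_nonneg KH_nonneg N_nonneg h1 by (intro gen) auto
  qed
  finally show ?thesis .
qed

end

section \<open>Integration of the remainder against the target density\<close>

lemma set_borel_measurable_continuous_open:
  fixes f :: "real \<Rightarrow> real"
  assumes "continuous_on {0<..} f"
  shows "set_borel_measurable lborel {0<..} f"
  unfolding set_borel_measurable_def
  using borel_measurable_continuous_on_indicator[OF _ assms] by auto

context drift_setting
begin

definition KW :: real where
  "KW = (LBINT x:{1<..}. x powr (\<delta> + 2) * exp (\<beta> * B * x - c * x\<^sup>2))"

lemma KW_integrable: "set_integrable lborel {0<..} (\<lambda>x. x powr (\<delta> + 2) * exp (\<beta> * B * x - c * x\<^sup>2))"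
proof -
  have e: "\<delta> + 3 - 1 = \<delta> + 2" "\<delta> + 3 > 0" using \<delta> by simp_all
  show ?thesis using gaussian_powr_integrable[OF e(2) c_pos, of "\<beta> * B"] by (simp only: e(1))
qed

text \<open>The summands stem from the near, the middle and the far region; the one with ln \<kappa>
  arises because the integral of 1/x starts at \<kappa> h and not at h.\<close>

definition KT :: real where
  "KT = \<beta> * E0 * (2 * K1 * (5 * B + 1) + 2 * B) * \<kappa> + (\<beta> * E0 * B\<^sup>2 * Km + KH) * 2
      + \<beta> * exp (- \<beta> * G 0) * (B\<^sup>2 * (2 * (\<beta> * (C1 + 1) + 2 + 4 * c))) * KW + \<beta> * E0 * B\<^sup>2 * ln \<kappa>"

lemma \<kappa>_ge_1: "\<kappa> \<ge> 1" using B(1) by (simp add: \<kappa>_def)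

lemma \<rho>_continuous: "continuous_on {0<..} \<rho>"
  unfolding \<rho>_def[abs_def]
  by (intro continuous_intros continuous_on_subset[OF G_continuous]) auto

text \<open>The factor x^(\<delta>-1) of \<rho> cancels the singularity of \<open>\<omega>\<close>.
  Hence g' and L g, both dominated by \<open>\<omega>\<close>, are integrable against the target
  although they may be unbounded at 0.\<close>

lemma \<rho>_\<omega>_integrable: "set_integrable lborel {0<..} (\<lambda>x. \<rho> x * \<omega> x)"
proof (rule set_integrable_bound)
  let ?e = "\<lambda>x. exp (\<beta> * B * x - c * x\<^sup>2)"
  have "set_integrable lborel {0<..} (\<lambda>x. x powr 0 * ?e x)" "set_integrable lborel {0<..} (\<lambda>x. x powr (\<delta> + 1) * ?e x)"
  proof -
    have e: "\<delta> + 2 - 1 = \<delta> + 1" "\<delta> + 2 > 0" using \<delta> by simp_all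
    show "set_integrable lborel {0<..} (\<lambda>x. x powr 0 * ?e x)"
      using gaussian_powr_integrable[OF zero_less_one c_pos, of "\<beta> * B"] by (simp only: diff_self)
    show "set_integrable lborel {0<..} (\<lambda>x. x powr (\<delta> + 1) * ?e x)"
      using gaussian_powr_integrable[OF e(2) c_pos, of "\<beta> * B"] by (simp only: e(1))
  qed
  then show "set_integrable lborel {0<..} (\<lambda>x. \<beta> * exp (- \<beta> * G 0) * (x powr 0 * ?e x + x powr (\<delta> + 1) * ?e x))"
    by (intro set_integrable_mult_right set_integral_add)
  have "continuous_on {0<..} (\<lambda>x. \<rho> x * \<omega> x)"
    unfolding \<omega>_def by (intro continuous_intros \<rho>_continuous) auto
  then show "set_borel_measurable lborel {0<..} (\<lambda>x. \<rho> x * \<omega> x)" by (rule set_borel_measurable_continuous_open)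
  show "AE x in lborel. x \<in> {0<..} \<longrightarrow> norm (\<rho> x * \<omega> x)
      \<le> norm (\<beta> * exp (- \<beta> * G 0) * (x powr 0 * ?e x + x powr (\<delta> + 1) * ?e x))"
  proof (intro AE_I2 impI)
    fix x :: real assume "x \<in> {0<..}"
    then have x: "x > 0" by simp
    have "x powr (\<delta> - 1) * x\<^sup>2 = x powr (\<delta> + 1)"
      using x by (simp add: powr_add[symmetric] powr_numeral[symmetric] add.commute del: powr_numeral)
    then have "x powr (\<delta> - 1) * \<omega> x = 1 + x powr (\<delta> + 1)" using powr_\<omega>[OF x] by simp
    then have "\<rho> x * \<omega> x = \<beta> * exp (- \<beta> * G x) * (exp (- c * x\<^sup>2) * (1 + x powr (\<delta> + 1)))"
      unfolding \<rho>_eq r_eq by (simp add: mult_ac)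
    also have "\<dots> \<le> \<beta> * (exp (- \<beta> * G 0) * exp (\<beta> * B * x)) * (exp (- c * x\<^sup>2) * (1 + x powr (\<delta> + 1)))"
      using exp_G_le[of x] x \<beta> by (intro mult_right_mono mult_left_mono) auto
    also have "\<dots> = \<beta> * exp (- \<beta> * G 0) * ((exp (\<beta> * B * x) * exp (- c * x\<^sup>2)) * (1 + x powr (\<delta> + 1)))" by simp
    also have "exp (\<beta> * B * x) * exp (- c * x\<^sup>2) = ?e x" by (simp add: exp_add[symmetric])
    finally have le: "\<rho> x * \<omega> x \<le> \<beta> * exp (- \<beta> * G 0) * (?e x * (1 + x powr (\<delta> + 1)))" .
    have eq: "x powr 0 * ?e x + x powr (\<delta> + 1) * ?e x = ?e x * (1 + x powr (\<delta> + 1))"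
      using x by (simp add: algebra_simps)
    have "norm (\<rho> x * \<omega> x) = \<rho> x * \<omega> x" using \<rho>_nonneg[of x] \<omega>_nonneg[of x] by simp
    then show "norm (\<rho> x * \<omega> x) \<le> norm (\<beta> * exp (- \<beta> * G 0) * (x powr 0 * ?e x + x powr (\<delta> + 1) * ?e x))"
      unfolding eq real_norm_def using le by linarith
  qed
qed

lemma \<rho>_dominated_integrable:
  assumes "continuous_on {0<..} u" "\<And>x. x > 0 \<Longrightarrow> \<bar>u x\<bar> \<le> C * \<omega> x"
  shows "set_integrable lborel {0<..} (\<lambda>x. \<rho> x * u x)"
proof (rule set_integrable_bound)
  show "set_integrable lborel {0<..} (\<lambda>x. C * (\<rho> x * \<omega> x))"
    using \<rho>_\<omega>_integrable by (rule set_integrable_mult_right)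
  show "set_borel_measurable lborel {0<..} (\<lambda>x. \<rho> x * u x)"
    by (intro set_borel_measurable_continuous_open continuous_on_mult \<rho>_continuous assms)
  show "AE x in lborel. x \<in> {0<..} \<longrightarrow> norm (\<rho> x * u x) \<le> norm (C * (\<rho> x * \<omega> x))"
  proof (intro AE_I2 impI)
    fix x :: real assume "x \<in> {0<..}"
    then have "\<rho> x * \<bar>u x\<bar> \<le> \<rho> x * (C * \<omega> x)" using assms(2)[of x] \<rho>_nonneg by (intro mult_left_mono) auto
    also have "\<dots> \<le> \<bar>\<rho> x * (C * \<omega> x)\<bar>" by simp
    finally show "norm (\<rho> x * u x) \<le> norm (C * (\<rho> x * \<omega> x))"
      using \<rho>_nonneg[of x] by (simp add: abs_mult mult_ac)
  qed
qed

end

context resolvent_instance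
begin

lemma continuity:
  "continuous_on {0<..} D" "continuous_on {0<..} q" "continuous_on {0<..} G'" "continuous_on {0<..} T"
proof -
  have s: "continuous_on {0<..} u" if "continuous_on {0..} u" for u :: "real \<Rightarrow> real"
    by (rule continuous_on_subset[OF that]) auto
  show D: "continuous_on {0<..} D"
    using D_deriv by (intro continuous_at_imp_continuous_on) (auto intro: DERIV_isCont)
  show "continuous_on {0<..} q" unfolding q_def[abs_def] using h by (intro continuous_intros s f g) auto
  show G': "continuous_on {0<..} G'" by (rule s[OF G'_continuous])
  have "continuous_on {0..} (\<lambda>x. g (\<phi> x))"
    by (rule continuous_on_compose2[OF g(2) \<phi>_continuous]) (use \<phi>(2) in auto)
  then show "continuous_on {0<..} T"
    unfolding T_def[abs_def] by (intro continuous_intros s D G' g) auto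
qed

text \<open>The measure \<open>\<pi>\<close> is invariant for \<open>L - G' d/dx\<close>; the right-hand side is the contribution of the atom.\<close>

lemma integral_generator:
  "set_integrable lborel {0<..} (\<lambda>x. \<rho> x * (q x - G' x * D x))"
  "(LBINT x:{0<..}. \<rho> x * (q x - G' x * D x)) = - exp (- \<beta> * G 0) * F 0"
proof -
  show int: "set_integrable lborel {0<..} (\<lambda>x. \<rho> x * (q x - G' x * D x))"
  proof (rule \<rho>_dominated_integrable)
    show "continuous_on {0<..} (\<lambda>x. q x - G' x * D x)" by (intro continuous_intros continuity)
    show "\<bar>q x - G' x * D x\<bar> \<le> ((C1 + 1) * N + B * N) * \<omega> x" if x: "x > 0" for x
    proof -
      have "\<bar>G' x * D x\<bar> \<le> B * (N * \<omega> x)"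
        unfolding abs_mult using B(2)[of x] D_le_N[OF x] B(1) x by (intro mult_mono) auto
      then show ?thesis using q_le_N[OF x] by (simp add: distrib_right)
    qed
  qed
  \<comment> \<open>With the factor exp(-\<beta> G) the flux becomes an antiderivative:
    differentiating the exponential yields the drift term -G' g' with the right weight. At infinity
    the Gaussian in F = r g' makes it vanish.\<close>
  let ?Y = "\<lambda>x. exp (- \<beta> * G x) * F x"
  have "(LBINT x:{0<..}. \<rho> x * (q x - G' x * D x)) = 0 - ?Y 0"
  proof (rule FTC_positive_half_line[OF _ _ int])
    fix x :: real assume x: "x > 0"
    have "(?Y has_real_derivative exp (- \<beta> * G x) * (- \<beta> * G' x) * F x + (\<beta> * r x * q x) * exp (- \<beta> * G x)) (at x)"
      using F_deriv[OF x] by (auto intro!: derivative_eq_intros G_deriv[OF x] simp: q_def)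
    also have "exp (- \<beta> * G x) * (- \<beta> * G' x) * F x + (\<beta> * r x * q x) * exp (- \<beta> * G x) = \<rho> x * (q x - G' x * D x)"
      using r_pos[OF x] by (simp add: \<rho>_eq D_def algebra_simps)
    finally show "(?Y has_real_derivative \<rho> x * (q x - G' x * D x)) (at x)" .
    have "continuous_on {0<..} (\<lambda>x. \<rho> x * (q x - G' x * D x))"
      by (intro continuous_intros continuity \<rho>_continuous)
    then show "isCont (\<lambda>x. \<rho> x * (q x - G' x * D x)) x"
      using x by (simp add: continuous_on_eq_continuous_at)
  next
    have "continuous_on {0..} ?Y" by (intro continuous_intros G_continuous F_continuous)
    then show "(?Y \<longlongrightarrow> ?Y 0) (at_right 0)"
      by (auto simp: continuous_on intro: tendsto_within_subset[of _ _ _ "{0..}"])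
    show "(?Y \<longlongrightarrow> 0) at_top"
    proof (rule Lim_null_comparison)
      show "\<forall>\<^sub>F x in at_top. norm (?Y x) \<le> exp (- \<beta> * G 0) * (2 * N) * (x ^ 3 * exp (\<beta> * B * x - c * x\<^sup>2))"
        using eventually_ge_at_top[of 1]
      proof eventually_elim
        case (elim x)
        have x: "x > 0" using elim by simp
        have w: "\<omega> x \<le> 2 * x\<^sup>2"
        proof -
          have "x powr (1 - \<delta>) \<le> 1" using elim \<delta> powr_mono[of "1 - \<delta>" 0 x] by simp
          moreover have "1 \<le> x\<^sup>2" using elim by (simp add: one_le_power)
          ultimately show ?thesis unfolding \<omega>_def by linarith
        qed
        have rx: "r x \<le> x * exp (- c * x\<^sup>2)" unfolding r_eq
          using elim \<delta> powr_mono[of "\<delta> - 1" 1 x] by (intro mult_right_mono) auto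
        have "\<bar>F x\<bar> = r x * \<bar>D x\<bar>" using r_pos[OF x] by (simp add: D_def abs_mult)
        also have "\<dots> \<le> (x * exp (- c * x\<^sup>2)) * (N * (2 * x\<^sup>2))"
        proof (rule mult_mono[OF rx])
          show "\<bar>D x\<bar> \<le> N * (2 * x\<^sup>2)" using D_le_N[OF x] mult_left_mono[OF w N_nonneg] by linarith
        qed (use x in auto)
        finally have Fx: "\<bar>F x\<bar> \<le> (x * exp (- c * x\<^sup>2)) * (N * (2 * x\<^sup>2))" .
        have "norm (?Y x) \<le> (exp (- \<beta> * G 0) * exp (\<beta> * B * x)) * ((x * exp (- c * x\<^sup>2)) * (N * (2 * x\<^sup>2)))"
          unfolding real_norm_def abs_mult using exp_G_le[of x] x by (intro mult_mono Fx) auto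
        also have "\<dots> = exp (- \<beta> * G 0) * (2 * N) * (x ^ 3 * (exp (\<beta> * B * x) * exp (- c * x\<^sup>2)))"
          by (simp add: power2_eq_square power3_eq_cube mult_ac)
        also have "exp (\<beta> * B * x) * exp (- c * x\<^sup>2) = exp (\<beta> * B * x - c * x\<^sup>2)" by (simp add: exp_add[symmetric])
        finally show ?case .
      qed
      have "((\<lambda>x. x ^ 3 * exp (k * x - c * x\<^sup>2)) \<longlongrightarrow> 0) at_top" for k using c_pos by real_asymp
      from tendsto_mult[OF tendsto_const this]
      show "((\<lambda>x. exp (- \<beta> * G 0) * (2 * N) * (x ^ 3 * exp (\<beta> * B * x - c * x\<^sup>2))) \<longlongrightarrow> 0) at_top" by fastforce
    qed
  qed
  then show "(LBINT x:{0<..}. \<rho> x * (q x - G' x * D x)) = - exp (- \<beta> * G 0) * F 0" by simp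
qed

text \<open>\<open>M\<close> is the main term of order 1/x on [\<kappa> h, 1], and N times
  \<open>E\<close> is an envelope for the difference from \<open>M\<close> on all three regions. The
  integral of 1/x over [\<kappa> h, 1] is |ln h| - ln \<kappa>.\<close>

lemma T_integral:
  "set_integrable lborel {0<..} (\<lambda>x. \<rho> x * T x)"
  "\<bar>(LBINT x:{0<..}. \<rho> x * T x) + 1 / 2 * (\<delta> - 1) * F 0 * H 0 * h\<^sup>2 * \<bar>ln h\<bar>\<bar> \<le> KT * N * h\<^sup>2"
proof -
  define a where "a = \<kappa> * h"
  define C0 where "C0 = 1 / 2 * (\<delta> - 1) * F 0 * H 0 * h\<^sup>2"
  define k1 where "k1 = \<beta> * E0 * (2 * K1 * (5 * B + 1) + 2 * B)"
  define k2 where "k2 = \<beta> * E0 * B\<^sup>2 * Km + KH"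
  define k3 where "k3 = \<beta> * exp (- \<beta> * G 0) * (B\<^sup>2 * (2 * (\<beta> * (C1 + 1) + 2 + 4 * c)))"
  define W where "W x = x powr (\<delta> + 2) * exp (\<beta> * B * x - c * x\<^sup>2)" for x
  define M where "M x = - C0 * (1 / x * indicator {a..1} x)" for x :: real
  define E where "E x = k1 * h * indicator {0<..<a} x + k2 * h\<^sup>2 * ((1 + h / x\<^sup>2) * indicator {a..1} x)
     + k3 * h\<^sup>2 * (indicator {1<..} x * W x)" for x :: real
  have k: "k1 \<ge> 0" "k2 \<ge> 0" "k3 \<ge> 0"
    using \<beta> E0_pos constants B(1) Km_nonneg KH_nonneg c_pos by (auto simp: k1_def k2_def k3_def)
  have a: "0 < a" "a \<le> 1" "h \<le> a"
  proof -
    have "a = 4 * (B * h) + h" by (simp add: a_def \<kappa>_def algebra_simps)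
    then show "0 < a" "a \<le> 1" "h \<le> a" using h Bh by linarith+
  qed
  have hM: "has_bochner_integral lborel M (- C0 * (0 - ln a))"
  proof -
    have "has_bochner_integral lborel (\<lambda>x. 1 / x * indicator {a..1} x) (ln 1 - ln a)"
      using a by (intro has_bochner_integral_FTC_Icc_real) (auto intro!: derivative_eq_intros)
    then show ?thesis unfolding M_def by (intro has_bochner_integral_mult_right) auto
  qed
  have hE2: "has_bochner_integral lborel (\<lambda>x. (1 + h / x\<^sup>2) * indicator {a..1} x) ((1 - h / 1) - (a - h / a))"
    using a by (intro has_bochner_integral_FTC_Icc_real)
      (auto intro!: derivative_eq_intros continuous_intros simp: power2_eq_square)
  have hE1: "has_bochner_integral lborel (indicator {0<..<a} :: real \<Rightarrow> real) a"
    using has_bochner_integral_indicator[of "{0<..<a}" lborel] a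
    by (simp add: has_bochner_integral_iff)
  have iW: "integrable lborel (\<lambda>x. indicator {1<..} x * W x)"
    using set_integrable_subset[OF KW_integrable, of "{1<..}"] by (auto simp: set_integrable_def W_def)
  have hE3: "has_bochner_integral lborel (\<lambda>x. indicator {1<..} x * W x) KW"
    using iW by (simp add: has_bochner_integral_iff KW_def set_lebesgue_integral_def W_def)
  have hE: "has_bochner_integral lborel E (k1 * h * a + k2 * h\<^sup>2 * ((1 - h / 1) - (a - h / a)) + k3 * h\<^sup>2 * KW)"
    unfolding E_def
    by (intro has_bochner_integral_add has_bochner_integral_mult_right hE1 hE2 hE3)
  have bound: "\<bar>indicator {0<..} x * (\<rho> x * T x) - M x\<bar> \<le> N * E x" for x
  proof -
    consider "x \<le> 0" | "0 < x" "x < a" | "a \<le> x" "x \<le> 1" | "1 < x" by linarith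
    then show ?thesis
    proof cases
      case 1
      then show ?thesis using a by (simp add: M_def E_def)
    next
      case 2
      then show ?thesis using T_near[of x] a by (simp add: M_def E_def a_def k1_def mult_ac)
    next
      case 3
      then show ?thesis using T_mid[of x] a by (simp add: M_def E_def a_def C0_def k2_def mult_ac)
    next
      case 4
      then show ?thesis using T_far[of x] a by (simp add: M_def E_def k3_def W_def mult_ac)
    qed
  qed
  let ?u = "\<lambda>x. indicator {0<..} x * (\<rho> x * T x)"
  have iM: "integrable lborel M" and iE: "integrable lborel E" using hM hE by (auto simp: has_bochner_integral_iff)
  have mu: "?u \<in> borel_measurable lborel"
    using set_borel_measurable_continuous_open[OF continuous_on_mult[OF \<rho>_continuous continuity(4)]]
    by (simp add: set_borel_measurable_def)
  have iD: "integrable lborel (\<lambda>x. ?u x - M x)"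
  proof (rule Bochner_Integration.integrable_bound)
    show "integrable lborel (\<lambda>x. N * E x)" using iE by simp
    show "AE x in lborel. norm (?u x - M x) \<le> norm (N * E x)"
      using bound by (intro AE_I2) (metis abs_ge_self order_trans real_norm_def)
    show "(\<lambda>x. ?u x - M x) \<in> borel_measurable lborel" using mu iM by auto
  qed
  have iu: "integrable lborel ?u" using Bochner_Integration.integrable_add[OF iD iM] by simp
  then show "set_integrable lborel {0<..} (\<lambda>x. \<rho> x * T x)" by (simp add: set_integrable_def)
  have "\<bar>(\<integral>x. ?u x \<partial>lborel) - (\<integral>x. M x \<partial>lborel)\<bar> = \<bar>\<integral>x. ?u x - M x \<partial>lborel\<bar>"
    using iu iM by simp
  also have "\<dots> \<le> (\<integral>x. N * E x \<partial>lborel)"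
    using Bochner_Integration.integral_norm_bound_integral[OF iD, of "\<lambda>x. N * E x"] iE bound by simp
  also have "\<dots> = N * (k1 * h * a + k2 * h\<^sup>2 * ((1 - h / 1) - (a - h / a)) + k3 * h\<^sup>2 * KW)"
    using hE by (simp add: has_bochner_integral_iff)
  also have "\<dots> \<le> N * (k1 * \<kappa> * h\<^sup>2 + k2 * h\<^sup>2 * 2 + k3 * h\<^sup>2 * KW)"
  proof (intro mult_left_mono add_mono order_refl N_nonneg)
    show "k1 * h * a \<le> k1 * \<kappa> * h\<^sup>2" by (simp add: a_def power2_eq_square)
    have "h / a \<le> 1" using a h by simp
    then show "(1 - h / 1) - (a - h / a) \<le> 2" using a h by linarith
    show "0 \<le> k2 * h\<^sup>2" "0 \<le> k3 * h\<^sup>2" using k by simp_all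
  qed
  finally have 1: "\<bar>(\<integral>x. ?u x \<partial>lborel) - (\<integral>x. M x \<partial>lborel)\<bar> \<le> N * (k1 * \<kappa> * h\<^sup>2 + k2 * h\<^sup>2 * 2 + k3 * h\<^sup>2 * KW)" .
  have lnh: "\<bar>ln h\<bar> = - ln h" using h Bh by simp
  \<comment> \<open>Replacing the lower limit \<kappa> h by h changes the logarithm by ln \<kappa>,
    a constant that goes into the error.\<close>
  have "ln a = ln \<kappa> + ln h" unfolding a_def using \<kappa>_ge_1 h by (intro ln_mult_pos) auto
  then have M: "(\<integral>x. M x \<partial>lborel) = C0 * ln \<kappa> - C0 * \<bar>ln h\<bar>"
    using hM lnh by (simp add: has_bochner_integral_iff algebra_simps)
  have C0: "\<bar>C0 * ln \<kappa>\<bar> \<le> N * (\<beta> * E0 * B\<^sup>2 * ln \<kappa> * h\<^sup>2)"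
  proof -
    have "\<bar>C0\<bar> = 1 / 2 * ((\<delta> - 1) * (\<bar>F 0\<bar> * \<bar>H 0\<bar>)) * h\<^sup>2" using \<delta> by (simp add: C0_def abs_mult)
    also have "\<dots> \<le> 1 * (1 * (N * (\<beta> * E0 * B\<^sup>2))) * h\<^sup>2"
      using \<delta> N_bounds(2) H_bounds(1)[of 0] N_nonneg \<beta> E0_pos
      by (intro mult_right_mono mult_mono) auto
    finally have "\<bar>C0\<bar> \<le> N * (\<beta> * E0 * B\<^sup>2) * h\<^sup>2" by simp
    then have "\<bar>C0\<bar> * ln \<kappa> \<le> N * (\<beta> * E0 * B\<^sup>2) * h\<^sup>2 * ln \<kappa>" using \<kappa>_ge_1 by (intro mult_right_mono) auto
    then show ?thesis using \<kappa>_ge_1 by (simp add: abs_mult mult_ac)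
  qed
  have "\<bar>(\<integral>x. ?u x \<partial>lborel) + C0 * \<bar>ln h\<bar>\<bar> \<le> N * (k1 * \<kappa> * h\<^sup>2 + k2 * h\<^sup>2 * 2 + k3 * h\<^sup>2 * KW) + N * (\<beta> * E0 * B\<^sup>2 * ln \<kappa> * h\<^sup>2)"
    using 1 C0 unfolding M by linarith
  also have "\<dots> = KT * N * h\<^sup>2" unfolding KT_def k1_def[symmetric] k2_def[symmetric] k3_def[symmetric]
    by (simp add: algebra_simps)
  finally show "\<bar>(LBINT x:{0<..}. \<rho> x * T x) + 1 / 2 * (\<delta> - 1) * F 0 * H 0 * h\<^sup>2 * \<bar>ln h\<bar>\<bar> \<le> KT * N * h\<^sup>2"
    unfolding C0_def by (simp add: set_lebesgue_integral_def)
qed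

text \<open>By the definition of \<open>T\<close>, f - g \<circ> \<phi> = -T - h (L g - G' g'). The
  integral of the second part is a multiple of the flux at 0 and, by the stickiness condition,
  cancels the contribution of the atom exactly; only the integral of \<open>T\<close> survives. In
  its main term the flux at 0 is turned back into f(0) - g(\<phi>(0)).\<close>

theorem core_estimate:
  "\<bar>exp (- \<beta> * G 0) / \<mu> * (f 0 - g (\<phi> 0)) + (LBINT x:{0<..}. \<rho> x * (f x - g (\<phi> x)))
     + 1 / 2 * (\<delta> - 1) * \<beta> * (G' 0)\<^sup>2 * (exp (- \<beta> * G 0) / \<mu>) * (f 0 - g (\<phi> 0)) * (h * \<bar>ln h\<bar>)\<bar>
   \<le> KT * K3 * (h * A)"
proof -
  have dec: "\<rho> x * (f x - g (\<phi> x)) = - 1 * (\<rho> x * T x) - h * (\<rho> x * (q x - G' x * D x))" for x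
  proof -
    have "h * (\<rho> x * (q x - G' x * D x)) = \<rho> x * (h * q x - h * G' x * D x)" by (simp add: algebra_simps)
    moreover have "h * q x = g x - f x" using h by (simp add: q_def)
    ultimately show ?thesis by (simp only: T_def) (simp add: algebra_simps)
  qed
  have "(LBINT x:{0<..}. \<rho> x * (f x - g (\<phi> x))) = - (LBINT x:{0<..}. \<rho> x * T x) - h * (LBINT x:{0<..}. \<rho> x * (q x - G' x * D x))"
  proof -
    have i: "set_integrable lborel {0<..} (\<lambda>x. - 1 * (\<rho> x * T x))"
      "set_integrable lborel {0<..} (\<lambda>x. h * (\<rho> x * (q x - G' x * D x)))"
      by (intro set_integrable_mult_right T_integral(1) integral_generator(1))+
    show ?thesis unfolding dec using set_integral_diff(2)[OF i] set_integral_uminus[OF T_integral(1)]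
      by (simp only: set_integral_mult_right mult_minus1)
  qed
  then have I: "exp (- \<beta> * G 0) / \<mu> * (f 0 - g (\<phi> 0)) + (LBINT x:{0<..}. \<rho> x * (f x - g (\<phi> x))) = - (LBINT x:{0<..}. \<rho> x * T x)"
  proof -
    have "h * (- exp (- \<beta> * G 0) * F 0) = exp (- \<beta> * G 0) / \<mu> * (f 0 - g (\<phi> 0))"
      using h \<mu> unfolding F_0_le(2) by (simp add: right_diff_distrib diff_divide_distrib)
    moreover assume "(LBINT x:{0<..}. \<rho> x * (f x - g (\<phi> x)))
      = - (LBINT x:{0<..}. \<rho> x * T x) - h * (LBINT x:{0<..}. \<rho> x * (q x - G' x * D x))"
    ultimately show ?thesis unfolding integral_generator(2) by linarith
  qed
  have C: "1 / 2 * (\<delta> - 1) * \<beta> * (G' 0)\<^sup>2 * (exp (- \<beta> * G 0) / \<mu>) * (f 0 - g (\<phi> 0)) * (h * \<bar>ln h\<bar>)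
     = - (1 / 2 * (\<delta> - 1) * F 0 * H 0 * h\<^sup>2 * \<bar>ln h\<bar>)"
    using h \<mu> unfolding H_def F_0_le(2) by (simp add: field_simps power2_eq_square)
  have "\<bar>- (LBINT x:{0<..}. \<rho> x * T x) + - (1 / 2 * (\<delta> - 1) * F 0 * H 0 * h\<^sup>2 * \<bar>ln h\<bar>)\<bar> \<le> KT * N * h\<^sup>2"
    using T_integral(2) by (simp add: abs_le_iff)
  also have "KT * N * h\<^sup>2 = KT * K3 * (h * A)" using h by (simp add: N_def power2_eq_square)
  finally show ?thesis unfolding I C .
qed

end

section \<open>Stationary distributions\<close>

definition markov_op :: "(real \<Rightarrow> real measure) \<Rightarrow> (real \<Rightarrow> real) \<Rightarrow> real \<Rightarrow> real" where
  "markov_op K \<psi> x = (\<integral>y. \<psi> y \<partial>K x)"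

lemma kernel_pow_space:
  assumes K: "K \<in> measurable half_line (prob_algebra half_line)" and x: "x \<ge> 0"
  shows "kernel_pow K n x \<in> space (prob_algebra half_line)"
proof (induction n)
  case 0
  then show ?case using x by (simp add: space_prob_algebra prob_space_return)
next
  case (Suc n)
  then show ?case using prob_space_bind'[OF Suc K] sets_bind'[OF Suc K] by (simp add: space_prob_algebra)
qed

lemma kernel_space: "K \<in> measurable half_line (prob_algebra half_line) \<Longrightarrow> x \<ge> 0 \<Longrightarrow> K x \<in> space (prob_algebra half_line)"
  by (rule measurable_space) auto

lemma prob_algebra_integral:
  fixes \<psi> :: "real \<Rightarrow> real"
  assumes "\<nu> \<in> space (prob_algebra half_line)" and \<psi>: "\<psi> \<in> borel_measurable half_line" "\<And>x. x \<ge> 0 \<Longrightarrow> \<bar>\<psi> x\<bar> \<le> C"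
  shows "integrable \<nu> \<psi>" "\<bar>\<integral>y. \<psi> y \<partial>\<nu>\<bar> \<le> C"
proof -
  have \<nu>: "prob_space \<nu>" "sets \<nu> = sets half_line" using assms(1) by (auto simp: space_prob_algebra)
  interpret prob_space \<nu> by (rule \<nu>(1))
  show i: "integrable \<nu> \<psi>"
    by (rule half_line_integrable_bounded[OF finite_measure_axioms \<nu>(2) \<psi>(1)]) (rule \<psi>(2))
  have sp: "space \<nu> = {0..}" using sets_eq_imp_space_eq[OF \<nu>(2)] by simp
  have "\<bar>\<integral>y. \<psi> y \<partial>\<nu>\<bar> \<le> (\<integral>y. \<bar>\<psi> y\<bar> \<partial>\<nu>)" by (rule integral_abs_bound)
  also have "\<dots> \<le> (\<integral>y. C \<partial>\<nu>)" using i \<psi>(2) sp by (intro integral_mono) auto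
  finally show "\<bar>\<integral>y. \<psi> y \<partial>\<nu>\<bar> \<le> C" by (simp add: prob_space)
qed

lemma markov_op_measurable:
  assumes "K \<in> measurable half_line (prob_algebra half_line)" "\<psi> \<in> borel_measurable half_line"
  shows "markov_op K \<psi> \<in> borel_measurable half_line"
  unfolding markov_op_def[abs_def]
  using measurable_compose[OF measurable_prob_algebraD[OF assms(1)] integral_measurable_subprob_algebra[OF assms(2)]] .

lemma markov_op_bound:
  assumes "K \<in> measurable half_line (prob_algebra half_line)" "\<psi> \<in> borel_measurable half_line"
    "\<And>x. x \<ge> 0 \<Longrightarrow> \<bar>\<psi> x\<bar> \<le> C" "x \<ge> 0"
  shows "\<bar>markov_op K \<psi> x\<bar> \<le> C"
  unfolding markov_op_def
  by (rule prob_algebra_integral(2)[OF kernel_space[OF assms(1,4)] assms(2)]) (rule assms(3))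

lemma markov_op_pow:
  assumes K: "K \<in> measurable half_line (prob_algebra half_line)" and \<psi>: "\<psi> \<in> borel_measurable half_line"
    and C: "\<And>x. x \<ge> 0 \<Longrightarrow> \<bar>\<psi> x\<bar> \<le> C"
  shows "(markov_op K ^^ n) \<psi> \<in> borel_measurable half_line" "x \<ge> 0 \<Longrightarrow> \<bar>(markov_op K ^^ n) \<psi> x\<bar> \<le> C"
proof (induction n arbitrary: x)
  case 0
  { case 1 then show ?case using \<psi> by simp next case 2 then show ?case using C by simp }
next
  case (Suc n)
  { case 1 then show ?case using markov_op_measurable[OF K Suc.IH(1)] by simp
    next case 2 then show ?case by (simp add: markov_op_bound[OF K Suc.IH(1)] Suc.IH(2)) }
qed

text \<open>The last step of the chain is integrated first, so the induction must be over all test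
  functions: the hypothesis is applied to the image of \<psi> under the operator.\<close>

lemma integral_kernel_pow:
  assumes K: "K \<in> measurable half_line (prob_algebra half_line)" and \<psi>: "\<psi> \<in> borel_measurable half_line"
    and C: "\<And>x. x \<ge> 0 \<Longrightarrow> \<bar>\<psi> x\<bar> \<le> C" and x: "x \<ge> 0"
  shows "(\<integral>y. \<psi> y \<partial>kernel_pow K n x) = (markov_op K ^^ n) \<psi> x"
  using \<psi> C
proof (induction n arbitrary: \<psi>)
  case 0
  then show ?case using x by (simp add: integral_return)
next
  case (Suc n)
  note sp = kernel_pow_space[OF K x, of n]
  have \<nu>: "prob_space (kernel_pow K n x)" "sets (kernel_pow K n x) = sets half_line"
    using sp by (auto simp: space_prob_algebra)
  interpret prob_space "kernel_pow K n x" by (rule \<nu>(1))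
  have spc: "space (kernel_pow K n x) = {0..}" using sets_eq_imp_space_eq[OF \<nu>(2)] by simp
  have "(\<integral>y. \<psi> y \<partial>kernel_pow K (Suc n) x) = (\<integral>z. \<integral>y. \<psi> y \<partial>K z \<partial>kernel_pow K n x)"
    unfolding kernel_pow.simps
  proof (rule integral_bind[where K = half_line and B = C and B' = 1])
    show "\<psi> \<in> borel_measurable half_line" by (rule Suc.prems(1))
    show "\<bar>\<psi> y\<bar> \<le> C" if "y \<in> space half_line" for y using that Suc.prems(2) by simp
    show "K \<in> measurable (kernel_pow K n x) (subprob_algebra half_line)"
      using measurable_prob_algebraD[OF K] by (subst measurable_cong_sets[OF \<nu>(2) refl])
    show "finite_measure (kernel_pow K n x)" by (rule finite_measure_axioms)
    show "AE z in kernel_pow K n x. emeasure (K z) (space (K z)) \<le> ennreal 1"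
      using spc kernel_space[OF K] by (auto intro!: AE_I2 simp: space_prob_algebra prob_space.emeasure_space_1)
  qed
  also have "\<dots> = (\<integral>z. markov_op K \<psi> z \<partial>kernel_pow K n x)" by (simp add: markov_op_def)
  also have "\<dots> = (markov_op K ^^ n) (markov_op K \<psi>) x"
  proof (rule Suc.IH)
    show "markov_op K \<psi> \<in> borel_measurable half_line" by (rule markov_op_measurable[OF K Suc.prems(1)])
    show "\<bar>markov_op K \<psi> y\<bar> \<le> C" if "y \<ge> 0" for y
      using Suc.prems(2) that by (intro markov_op_bound[OF K Suc.prems(1)]) auto
  qed
  also have "\<dots> = (markov_op K ^^ Suc n) \<psi> x" by (simp add: funpow_swap1)
  finally show ?case .
qed

text \<open>Both follow from ln u <= u - 1 at u = 1/sqrt h. The first makes the square of h |log h|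
  an O(h), the second makes h |log h| small enough for a mixture weight.\<close>

lemma mult_ln_bounds:
  fixes h :: real
  assumes h: "0 < h" "h \<le> 1"
  shows "h * (ln h)\<^sup>2 \<le> 4" "h * \<bar>ln h\<bar> \<le> 2 * sqrt h"
proof -
  have s: "sqrt h > 0" using h by simp
  have "ln (1 / sqrt h) \<le> 1 / sqrt h - 1" using s by (intro ln_le_minus_one) auto
  moreover have "ln (1 / sqrt h) = - ln h / 2" using h by (simp add: ln_div ln_sqrt)
  ultimately have "- ln h \<le> 2 * (1 / sqrt h)" by simp
  then have l: "\<bar>ln h\<bar> \<le> 2 / sqrt h" using h by (simp add: abs_if)
  have "h * \<bar>ln h\<bar> \<le> h * (2 / sqrt h)" using l h by (intro mult_left_mono) auto
  also have "\<dots> = 2 * sqrt h" using h by (simp add: field_simps)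
  finally show "h * \<bar>ln h\<bar> \<le> 2 * sqrt h" .
  have "\<bar>ln h\<bar>\<^sup>2 \<le> (2 / sqrt h)\<^sup>2" using l by (intro power_mono) auto
  then have "(ln h)\<^sup>2 \<le> 4 / h" using h by (simp add: power_divide)
  then show "h * (ln h)\<^sup>2 \<le> 4" using h by (simp add: field_simps)
qed

section \<open>The target measure and its mixtures with the Dirac mass\<close>

context drift_setting
begin

definition w\<^sub>0 :: real where "w\<^sub>0 = exp (- \<beta> * G 0) / \<mu>"
definition Z :: real where "Z = w\<^sub>0 + (LBINT x:{0<..}. \<rho> x)"

lemma w0_pos: "w\<^sub>0 > 0" using \<mu> by (simp add: w\<^sub>0_def)

lemma \<rho>_integrable: "set_integrable lborel {0<..} \<rho>"
  using \<rho>_dominated_integrable[of "\<lambda>_. 1" 1] \<omega>_ge_1 by simp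

lemma \<rho>_integrable_closed: "set_integrable lborel {0..} \<rho>"
  using \<rho>_integrable by (simp add: set_integrable_closed_half_line)

lemma \<rho>_half_line: "\<rho> \<in> borel_measurable half_line"
proof -
  have "continuous_on {0..} \<rho>" unfolding \<rho>_def[abs_def] using \<delta>
    by (intro continuous_on_mult continuous_on_const continuous_on_powr_nonneg continuous_on_exp continuous_on_diff
        continuous_on_divide continuous_on_power continuous_on_id G_continuous continuous_on_minus) auto
  then show ?thesis unfolding half_line_def by (rule borel_measurable_continuous_on_restrict)
qed

lemma Z_pos: "Z > 0"
proof -
  have "(LBINT x:{0<..}. \<rho> x) \<ge> 0"
    unfolding set_lebesgue_integral_def using \<rho>_nonneg by (intro Bochner_Integration.integral_nonneg) auto
  then show ?thesis unfolding Z_def using w0_pos by linarith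
qed

lemma measure_unnormalised: "measure (target_unnormalised lam \<beta> \<mu> \<delta> G) {0..} = Z"
proof -
  have eq: "target_unnormalised lam \<beta> \<mu> \<delta> G = atom_plus_density w\<^sub>0 \<rho>"
    by (simp add: target_unnormalised_def w\<^sub>0_def \<rho>_def[abs_def])
  have i: "set_integrable lborel {0..} (\<lambda>x. \<rho> x * 1)" using \<rho>_integrable_closed by simp
  have "(\<integral>x. (1::real) \<partial>atom_plus_density w\<^sub>0 \<rho>) = w\<^sub>0 * 1 + (LBINT x:{0..}. \<rho> x * 1)"
    by (rule integral_atom_plus_density(2)[OF \<rho>_half_line \<rho>_nonneg less_imp_le[OF w0_pos] _ i]) simp
  then show ?thesis unfolding eq Z_def set_integral_closed_half_line[symmetric] by simp
qed

text \<open>Covers two measures at once: the target itself, with s = 1/Z and t = 0, and the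
  approximation (1 - k) \<pi> + k \<delta>_0, with s = (1 - k)/Z and t = k.\<close>

lemma mixture_density:
  assumes "0 \<le> s" "0 \<le> t"
  defines "m \<equiv> atom_plus_density (s * w\<^sub>0 + t) (\<lambda>x. s * \<rho> x)"
  shows "finite_measure m" "sets m = sets half_line"
    and "\<eta> \<in> borel_measurable half_line \<Longrightarrow> (\<And>x. x \<ge> 0 \<Longrightarrow> \<bar>\<eta> x\<bar> \<le> C) \<Longrightarrow>
      (\<integral>x. \<eta> x \<partial>m) = s * (w\<^sub>0 * \<eta> 0 + (LBINT x:{0<..}. \<rho> x * \<eta> x)) + t * \<eta> 0"
    and "\<eta> \<in> borel_measurable half_line \<Longrightarrow> (\<And>x. x \<ge> 0 \<Longrightarrow> \<bar>\<eta> x\<bar> \<le> C) \<Longrightarrow> set_integrable lborel {0<..} (\<lambda>x. \<rho> x * \<eta> x)"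
proof -
  have w: "s * w\<^sub>0 + t \<ge> 0" using assms w0_pos by simp
  have r: "(\<lambda>x. s * \<rho> x) \<in> borel_measurable half_line" using \<rho>_half_line by simp
  have rn: "s * \<rho> x \<ge> 0" for x using assms \<rho>_nonneg by simp
  show sm: "sets m = sets half_line" by (simp add: m_def)
  have int: "set_integrable lborel {0..} (\<lambda>x. \<rho> x * \<eta> x)"
    if \<eta>: "\<eta> \<in> borel_measurable half_line" "\<And>x. x \<ge> 0 \<Longrightarrow> \<bar>\<eta> x\<bar> \<le> C" for \<eta> C
  proof (rule set_integrable_bound)
    show "set_integrable lborel {0..} (\<lambda>x. C * \<rho> x)" using \<rho>_integrable_closed by (rule set_integrable_mult_right)
    have "(\<lambda>x. \<rho> x * \<eta> x) \<in> borel_measurable (restrict_space borel {0..})"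
      using \<rho>_half_line \<eta>(1) by (simp add: half_line_def)
    then show "set_borel_measurable lborel {0..} (\<lambda>x. \<rho> x * \<eta> x)"
      unfolding set_borel_measurable_def by (subst (asm) borel_measurable_restrict_space_iff) auto
    show "AE x in lborel. x \<in> {0..} \<longrightarrow> norm (\<rho> x * \<eta> x) \<le> norm (C * \<rho> x)"
    proof (intro AE_I2 impI)
      fix x :: real assume "x \<in> {0..}"
      then have "\<rho> x * \<bar>\<eta> x\<bar> \<le> \<rho> x * C" using \<eta>(2)[of x] \<rho>_nonneg[of x] by (intro mult_left_mono) auto
      also have "\<dots> \<le> \<bar>\<rho> x * C\<bar>" by simp
      finally show "norm (\<rho> x * \<eta> x) \<le> norm (C * \<rho> x)" using \<rho>_nonneg[of x] by (simp add: abs_mult mult.commute)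
    qed
  qed
  have I: "integrable m \<eta>" "(\<integral>x. \<eta> x \<partial>m) = (s * w\<^sub>0 + t) * \<eta> 0 + (LBINT x:{0..}. (s * \<rho> x) * \<eta> x)"
    if \<eta>: "\<eta> \<in> borel_measurable half_line" "\<And>x. x \<ge> 0 \<Longrightarrow> \<bar>\<eta> x\<bar> \<le> C" for \<eta> C
  proof -
    have i: "set_integrable lborel {0..} (\<lambda>x. (s * \<rho> x) * \<eta> x)"
      using set_integrable_mult_right[of s, OF int[of \<eta> C]] \<eta> by (simp add: mult.assoc)
    show "integrable m \<eta>" "(\<integral>x. \<eta> x \<partial>m) = (s * w\<^sub>0 + t) * \<eta> 0 + (LBINT x:{0..}. (s * \<rho> x) * \<eta> x)"
      unfolding m_def using integral_atom_plus_density[OF r rn w \<eta>(1) i] by auto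
  qed
  have "integrable m (\<lambda>_. 1 :: real)" by (rule I(1)[of _ 1]) auto
  then have "emeasure m (space m) < \<infinity>" by (simp add: integrable_iff_bounded)
  then show "finite_measure m" by (intro finite_measureI) auto
  assume \<eta>: "\<eta> \<in> borel_measurable half_line" "\<And>x. x \<ge> 0 \<Longrightarrow> \<bar>\<eta> x\<bar> \<le> C"
  show "set_integrable lborel {0<..} (\<lambda>x. \<rho> x * \<eta> x)"
    using int[OF \<eta>] by (simp add: set_integrable_closed_half_line)
  have "(LBINT x:{0..}. (s * \<rho> x) * \<eta> x) = s * (LBINT x:{0<..}. \<rho> x * \<eta> x)"
    unfolding set_integral_closed_half_line by (simp add: mult.assoc)
  then show "(\<integral>x. \<eta> x \<partial>m) = s * (w\<^sub>0 * \<eta> 0 + (LBINT x:{0<..}. \<rho> x * \<eta> x)) + t * \<eta> 0"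
    using I(2)[OF \<eta>] by (simp add: algebra_simps)
qed

lemma emeasure_scaled:
  assumes "0 \<le> s" "0 \<le> t" "X \<in> sets half_line"
  shows "emeasure (atom_plus_density (s * w\<^sub>0 + t) (\<lambda>x. s * \<rho> x)) X
    = ennreal s * emeasure (atom_plus_density w\<^sub>0 \<rho>) X + ennreal t * indicator X 0"
proof -
  have "(\<lambda>x. s * \<rho> x) \<in> borel_measurable half_line" using \<rho>_half_line by simp
  note e = emeasure_atom_plus_density[OF this assms(3)] emeasure_atom_plus_density[OF \<rho>_half_line assms(3)]
  have X: "X \<in> sets borel" "X \<subseteq> {0..}" using sets_half_lineD[OF assms(3)] by auto
  have "(\<lambda>x. \<rho> x * indicator X x) \<in> borel_measurable borel"
  proof -
    have "(\<lambda>x. indicator {0..} x *\<^sub>R \<rho> x) \<in> borel_measurable borel"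
      using \<rho>_half_line unfolding half_line_def by (subst (asm) borel_measurable_restrict_space_iff) auto
    then have "(\<lambda>x. (indicator {0..} x *\<^sub>R \<rho> x) * indicator X x) \<in> borel_measurable borel" using X by auto
    also have "(\<lambda>x. (indicator {0..} x *\<^sub>R \<rho> x) * indicator X x) = (\<lambda>x. \<rho> x * indicator X x)"
      using X by (auto simp: indicator_def fun_eq_iff)
    finally show ?thesis .
  qed
  then have m: "(\<lambda>x. ennreal (\<rho> x * indicator X x)) \<in> borel_measurable lborel" by simp
  have c: "ennreal u * indicator X x = ennreal (u * indicator X x)" for u and x :: real
    by (simp add: indicator_def)
  have "(\<integral>\<^sup>+x\<in>X. ennreal (s * \<rho> x) \<partial>lborel) = ennreal s * (\<integral>\<^sup>+x\<in>X. ennreal (\<rho> x) \<partial>lborel)"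
    using assms(1) m by (simp add: c nn_integral_cmult[symmetric] ennreal_mult' mult.assoc)
  moreover have "ennreal (s * w\<^sub>0 + t) = ennreal s * ennreal w\<^sub>0 + ennreal t"
    using assms w0_pos by (simp add: ennreal_plus ennreal_mult')
  ultimately show ?thesis by (simp add: e distrib_left distrib_right add_ac mult.assoc)
qed

lemma target_eq: "target lam \<beta> \<mu> \<delta> G = atom_plus_density (1 / Z * w\<^sub>0 + 0) (\<lambda>x. 1 / Z * \<rho> x)"
proof -
  have eq: "target_unnormalised lam \<beta> \<mu> \<delta> G = atom_plus_density w\<^sub>0 \<rho>"
    by (simp add: target_unnormalised_def w\<^sub>0_def \<rho>_def[abs_def])
  have t: "target lam \<beta> \<mu> \<delta> G = scale_measure (ennreal (1 / Z)) (atom_plus_density w\<^sub>0 \<rho>)"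
    by (simp add: target_def Let_def measure_unnormalised[unfolded eq] eq)
  show ?thesis
    unfolding t
  proof (rule measure_eqI)
    have z: "0 \<le> 1 / Z" using Z_pos by simp
    fix X assume "X \<in> sets (scale_measure (ennreal (1 / Z)) (atom_plus_density w\<^sub>0 \<rho>))"
    then have X: "X \<in> sets half_line" by simp
    show "emeasure (scale_measure (ennreal (1 / Z)) (atom_plus_density w\<^sub>0 \<rho>)) X
        = emeasure (atom_plus_density (1 / Z * w\<^sub>0 + 0) (\<lambda>x. 1 / Z * \<rho> x)) X"
      unfolding emeasure_scaled[OF z order_refl X] by simp
  qed simp
qed

lemma target_measure:
  "finite_measure (target lam \<beta> \<mu> \<delta> G)" "sets (target lam \<beta> \<mu> \<delta> G) = sets half_line"
  "measure (target lam \<beta> \<mu> \<delta> G) {0} = w\<^sub>0 / Z"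
  "\<eta> \<in> borel_measurable half_line \<Longrightarrow> (\<And>x. x \<ge> 0 \<Longrightarrow> \<bar>\<eta> x\<bar> \<le> C) \<Longrightarrow>
    (\<integral>x. \<eta> x \<partial>target lam \<beta> \<mu> \<delta> G) = (w\<^sub>0 * \<eta> 0 + (LBINT x:{0<..}. \<rho> x * \<eta> x)) / Z"
proof -
  have z: "0 \<le> 1 / Z" using Z_pos by simp
  note mix = mixture_density[OF z order_refl, folded target_eq]
  show "finite_measure (target lam \<beta> \<mu> \<delta> G)" "sets (target lam \<beta> \<mu> \<delta> G) = sets half_line"
    by (rule mix(1), rule mix(2))
  show I: "(\<integral>x. \<eta> x \<partial>target lam \<beta> \<mu> \<delta> G) = (w\<^sub>0 * \<eta> 0 + (LBINT x:{0<..}. \<rho> x * \<eta> x)) / Z"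
    if "\<eta> \<in> borel_measurable half_line" "\<And>x. x \<ge> 0 \<Longrightarrow> \<bar>\<eta> x\<bar> \<le> C" for \<eta> C
  proof -
    have "(\<integral>x. \<eta> x \<partial>target lam \<beta> \<mu> \<delta> G) = 1 / Z * (w\<^sub>0 * \<eta> 0 + (LBINT x:{0<..}. \<rho> x * \<eta> x)) + 0 * \<eta> 0"
      by (rule mix(3)[OF that])
    then show ?thesis by simp
  qed
  have s0: "{0} \<in> sets half_line" unfolding half_line_def by (auto simp: sets_restrict_space intro!: image_eqI[of _ _ "{0}"])
  have "(\<integral>x. indicator {0} x \<partial>target lam \<beta> \<mu> \<delta> G) = (w\<^sub>0 * 1 + (LBINT x:{0<..}. \<rho> x * indicator {0} x)) / Z"
    using I[of "indicator {0}" 1] s0 by (simp add: indicator_def)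
  also have "(LBINT x:{0<..}. \<rho> x * indicator {0} x) = 0"
    unfolding set_lebesgue_integral_def by (rule integral_eq_zero_AE) (auto simp: indicator_def)
  finally show "measure (target lam \<beta> \<mu> \<delta> G) {0} = w\<^sub>0 / Z"
    using sets_eq_imp_space_eq[OF mix(2)] by simp
qed

end

lemma half_line_measurable_continuous:
  fixes f :: "real \<Rightarrow> real"
  shows "continuous_on {0..} f \<Longrightarrow> f \<in> borel_measurable half_line"
  unfolding half_line_def by (rule borel_measurable_continuous_on_restrict)

context sticky_resolvent
begin

lemma resolvent_compose_measurable:
  assumes "continuous_on {0..} \<phi>" "\<And>x. x \<ge> 0 \<Longrightarrow> \<phi> x \<ge> 0"
  shows "(\<lambda>x. resolvent_kernel lam \<beta> \<mu> \<delta> h (\<phi> x)) \<in> measurable half_line (prob_algebra half_line)"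
proof -
  have "\<phi> \<in> measurable half_line half_line"
    unfolding half_line_def using half_line_measurable_continuous[OF assms(1)] assms(2)
    by (intro measurable_restrict_space2) (auto simp: half_line_def space_restrict_space)
  from measurable_compose[OF this resolvent_measurable] show ?thesis .
qed

end

section \<open>The expansion for continuous test functions\<close>

context drift_setting
begin

text \<open>To be used with m = \<pi>_h(\<eta>) and \<theta> = 1 - c h. The core estimate is applied
  with A = 2 to each partial sum; its constants do not depend on the number of terms, so the limit
  can be taken at the end. The condition on C/(1 - \<theta>) is the sum of the geometric series,
  which bounds all partial sums by O((1 + x^2)/h).\<close>

lemma stationary_expansion:
  fixes \<phi> \<eta> :: "real \<Rightarrow> real" and h m C \<theta> :: real
  defines "K \<equiv> \<lambda>x. resolvent_kernel lam \<beta> \<mu> \<delta> h (\<phi> x)"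
  assumes h: "h > 0" "(5 * B + 1) * h \<le> 1"
    and \<phi>: "\<phi> 0 = 0" "\<And>x. x \<ge> 0 \<Longrightarrow> \<phi> x \<ge> 0" "\<And>x. x \<ge> 0 \<Longrightarrow> \<bar>\<phi> x - x\<bar> \<le> B * h"
      "\<And>x. x \<ge> 0 \<Longrightarrow> x \<ge> B * h \<Longrightarrow> \<phi> x = x - h * G' x" "continuous_on {0..} \<phi>"
    and \<eta>: "continuous_on {0..} \<eta>" "\<And>x. x \<ge> 0 \<Longrightarrow> \<bar>\<eta> x\<bar> \<le> 1"
    and \<theta>: "0 \<le> \<theta>" "\<theta> < 1" "C \<ge> 0" "C / (1 - \<theta>) \<le> Cf * 2 / h"
    and conv: "\<And>x n. x \<ge> 0 \<Longrightarrow> \<bar>(markov_op K ^^ n) \<eta> x - m\<bar> \<le> C * (1 + x\<^sup>2) * \<theta> ^ n"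
  shows "\<bar>w\<^sub>0 * (\<eta> 0 - m) + (LBINT x:{0<..}. \<rho> x * (\<eta> x - m))
     + 1 / 2 * (\<delta> - 1) * \<beta> * (G' 0)\<^sup>2 * w\<^sub>0 * (\<eta> 0 - m) * (h * \<bar>ln h\<bar>)\<bar> \<le> KT * K3 * (h * 2)"
proof -
  interpret R: sticky_resolvent lam \<beta> \<mu> \<delta> h
    by unfold_locales (use lam \<beta> \<mu> \<delta> h in auto)
  have K: "K \<in> measurable half_line (prob_algebra half_line)"
    unfolding K_def by (rule R.resolvent_compose_measurable[OF \<phi>(5,2)])
  have Kop: "markov_op K \<psi> x = (\<integral>y. \<psi> y \<partial>resolvent_kernel lam \<beta> \<mu> \<delta> h (\<phi> x))" for \<psi> x
    by (simp add: markov_op_def K_def)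
  let ?u = "\<lambda>n. (markov_op K ^^ n) \<eta>"
  have u_bd: "\<bar>?u n x\<bar> \<le> 1" if "x \<ge> 0" for n x
    by (rule markov_op_pow(2)[OF K half_line_measurable_continuous[OF \<eta>(1)] _ that]) (rule \<eta>(2))
  \<comment> \<open>The iterates stay continuous: the resolvent equation gives continuity of the
    resolvent, and \<phi> is continuous.\<close>
  have u_cont: "continuous_on {0..} (?u n)" for n
  proof (induction n)
    case (Suc n)
    have b: "\<forall>x\<ge>0. \<bar>?u n x\<bar> \<le> 1" using u_bd by blast
    obtain F where "continuous_on {0..} (\<lambda>s. \<integral>y. ?u n y \<partial>resolvent_kernel lam \<beta> \<mu> \<delta> h s)"
      by (rule R.resolvent_equation[OF Suc b])
    then have "continuous_on {0..} (\<lambda>x. \<integral>y. ?u n y \<partial>resolvent_kernel lam \<beta> \<mu> \<delta> h (\<phi> x))"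
      by (rule continuous_on_compose2[OF _ \<phi>(5)]) (use \<phi>(2) in auto)
    moreover have "?u (Suc n) = (\<lambda>x. \<integral>y. ?u n y \<partial>resolvent_kernel lam \<beta> \<mu> \<delta> h (\<phi> x))"
      by (simp add: fun_eq_iff Kop)
    ultimately show ?case by (simp only:)
  qed (simp add: \<eta>)
  define z where "z N x = \<eta> x - ?u N x" for N x
  have z_bd: "\<bar>z N x\<bar> \<le> 2" if "x \<ge> 0" for N x
    using u_bd[OF that, of N] \<eta>(2)[OF that] by (auto simp: z_def abs_le_iff)
  have main: "\<bar>w\<^sub>0 * z N 0 + (LBINT x:{0<..}. \<rho> x * z N x)
     + 1 / 2 * (\<delta> - 1) * \<beta> * (G' 0)\<^sup>2 * w\<^sub>0 * z N 0 * (h * \<bar>ln h\<bar>)\<bar> \<le> KT * K3 * (h * 2)" for N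
  proof -
    define f where "f x = (\<Sum>n<N. ?u n x - m)" for x
    define g where "g s = (\<integral>y. f y \<partial>resolvent_kernel lam \<beta> \<mu> \<delta> h s)" for s
    have f_cont: "continuous_on {0..} f"
      unfolding f_def by (intro continuous_on_sum continuous_on_diff u_cont continuous_on_const)
    \<comment> \<open>Depends on \<open>N\<close>, but enters only as the qualitative bound
      \<open>Cb\<close>; the quantitative one is \<open>f_le\<close>.\<close>
    have f_bd: "\<forall>x\<ge>0. \<bar>f x\<bar> \<le> real N * (1 + \<bar>m\<bar>)"
    proof (intro allI impI)
      fix x :: real assume x: "x \<ge> 0"
      have "\<bar>f x\<bar> \<le> (\<Sum>n<N. \<bar>?u n x - m\<bar>)" unfolding f_def by (rule sum_abs)
      also have "\<dots> \<le> (\<Sum>n<N. 1 + \<bar>m\<bar>)"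
      proof (rule sum_mono)
        show "\<bar>?u n x - m\<bar> \<le> 1 + \<bar>m\<bar>" for n using u_bd[OF x, of n] by linarith
      qed
      finally show "\<bar>f x\<bar> \<le> real N * (1 + \<bar>m\<bar>)" by simp
    qed
    have f_le: "\<bar>f x\<bar> \<le> Cf * 2 * (1 + x\<^sup>2) / h" if x: "x \<ge> 0" for x
    proof -
      have "\<bar>f x\<bar> \<le> (\<Sum>n<N. \<bar>?u n x - m\<bar>)" unfolding f_def by (rule sum_abs)
      also have "\<dots> \<le> (\<Sum>n<N. C * (1 + x\<^sup>2) * \<theta> ^ n)" by (intro sum_mono conv x)
      also have "\<dots> = C * (1 + x\<^sup>2) * (\<Sum>n<N. \<theta> ^ n)" by (simp add: sum_distrib_left)
      also have "\<dots> \<le> C * (1 + x\<^sup>2) * (1 / (1 - \<theta>))"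
      proof (rule mult_left_mono)
        have "(\<Sum>n<N. \<theta> ^ n) = (1 - \<theta> ^ N) / (1 - \<theta>)" using \<theta> by (subst sum_gp_strict) auto
        also have "\<dots> \<le> 1 / (1 - \<theta>)" using \<theta> by (intro divide_right_mono) auto
        finally show "(\<Sum>n<N. \<theta> ^ n) \<le> 1 / (1 - \<theta>)" .
      qed (use \<theta> in simp)
      also have "\<dots> = C / (1 - \<theta>) * (1 + x\<^sup>2)" by simp
      also have "\<dots> \<le> Cf * 2 / h * (1 + x\<^sup>2)" using \<theta>(4) by (intro mult_right_mono) auto
      finally show ?thesis by simp
    qed
    have g\<phi>: "f x - g (\<phi> x) = z N x" if x: "x \<ge> 0" for x
    proof -
      have i: "integrable (K x) (?u n)" for n
        using prob_algebra_integral(1)[OF kernel_space[OF K x] half_line_measurable_continuous[OF u_cont]] u_bd by blast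
      have Kx: "prob_space (K x)" using kernel_space[OF K x] by (simp add: space_prob_algebra)
      interpret prob_space "K x" by (rule Kx)
      have "g (\<phi> x) = (\<integral>y. (\<Sum>n<N. ?u n y - m) \<partial>K x)" by (simp add: g_def f_def K_def)
      also have "\<dots> = (\<Sum>n<N. (\<integral>y. ?u n y - m \<partial>K x))"
        using i by (intro Bochner_Integration.integral_sum) auto
      also have "\<dots> = (\<Sum>n<N. ?u (Suc n) x - m)"
        using i by (intro sum.cong) (auto simp: markov_op_def prob_space)
      finally have "f x - g (\<phi> x) = (\<Sum>n<N. ?u n x - ?u (Suc n) x)"
        by (simp add: f_def sum_subtractf)
      also have "\<dots> = ?u 0 x - ?u N x" by (rule sum_lessThan_telescope')
      finally show ?thesis by (simp add: z_def)
    qed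
    obtain F where F: "continuous_on {0..} g" "\<And>x. x \<ge> 0 \<Longrightarrow> \<bar>g x\<bar> \<le> real N * (1 + \<bar>m\<bar>)"
      "\<And>x. x > 0 \<Longrightarrow> (g has_real_derivative F x / R.r x) (at x)"
      "\<And>x. x > 0 \<Longrightarrow> (F has_real_derivative speed_density lam \<beta> \<delta> x * ((g x - f x) / h)) (at x)"
      "continuous_on {0..} F" "F 0 = (g 0 - f 0) / (h * \<mu>)"
      unfolding g_def by (rule R.resolvent_equation[OF f_cont f_bd]) blast
    have rr: "R.r x = r x" "speed_density lam \<beta> \<delta> x = \<beta> * r x" for x
      by (simp_all add: R.r_def r_def speed_density_def)
    interpret I: resolvent_instance lam \<beta> \<mu> \<delta> B B1 Cf G G' h 2 "real N * (1 + \<bar>m\<bar>)" \<phi> f g F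
    proof unfold_locales
      show "\<bar>f x - g (\<phi> x)\<bar> \<le> 2" if "x \<ge> 0" for x using g\<phi>[OF that] z_bd[OF that] by simp
      show "\<bar>f x\<bar> \<le> real N * (1 + \<bar>m\<bar>)" if "x \<ge> 0" for x using f_bd that by blast
    qed (use h \<phi> f_cont f_le F in \<open>auto simp: rr\<close>)
    have "(LBINT x:{0<..}. \<rho> x * (f x - g (\<phi> x))) = (LBINT x:{0<..}. \<rho> x * z N x)"
      by (rule set_lebesgue_integral_cong) (auto simp: g\<phi>)
    then show ?thesis using I.core_estimate g\<phi>[of 0] by (simp add: w\<^sub>0_def)
  qed
  have u_lim: "(\<lambda>N. ?u N x) \<longlonglongrightarrow> m" if x: "x \<ge> 0" for x
  proof -
    have "(\<lambda>N. C * (1 + x\<^sup>2) * \<theta> ^ N) \<longlonglongrightarrow> C * (1 + x\<^sup>2) * 0"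
      using \<theta> by (intro tendsto_mult tendsto_const LIMSEQ_power_zero) simp
    then have "(\<lambda>N. ?u N x - m) \<longlonglongrightarrow> 0"
      by (intro Lim_null_comparison[OF always_eventually[of "\<lambda>N. norm (?u N x - m) \<le> C * (1 + x\<^sup>2) * \<theta> ^ N"]])
        (use conv[OF x] in auto)
    then show ?thesis by (simp add: LIM_zero_iff)
  qed
  have z_lim: "(\<lambda>N. z N x) \<longlonglongrightarrow> \<eta> x - m" if "x \<ge> 0" for x
    unfolding z_def by (intro tendsto_intros u_lim that)
  \<comment> \<open>The integrands converge pointwise and are dominated by 2 \<rho>.\<close>
  have int_lim: "(\<lambda>N. LBINT x:{0<..}. \<rho> x * z N x) \<longlonglongrightarrow> (LBINT x:{0<..}. \<rho> x * (\<eta> x - m))"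
    unfolding set_lebesgue_integral_def
  proof (rule integral_dominated_convergence[where w = "\<lambda>x. indicator {0<..} x *\<^sub>R (2 * \<rho> x)"])
    have c: "continuous_on {0<..} v \<Longrightarrow> (\<lambda>x. indicator {0<..} x *\<^sub>R (\<rho> x * v x)) \<in> borel_measurable lborel" for v
      using set_borel_measurable_continuous_open[OF continuous_on_mult[OF \<rho>_continuous]]
      by (auto simp: set_borel_measurable_def)
    have s: "continuous_on {0<..} v" if "continuous_on {0..} v" for v :: "real \<Rightarrow> real"
      by (rule continuous_on_subset[OF that]) auto
    show "(\<lambda>x. indicator {0<..} x *\<^sub>R (\<rho> x * (\<eta> x - m))) \<in> borel_measurable lborel"
      by (intro c continuous_on_diff continuous_on_const s \<eta>)
    show "(\<lambda>x. indicator {0<..} x *\<^sub>R (\<rho> x * z N x)) \<in> borel_measurable lborel" for N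
      unfolding z_def by (intro c continuous_on_diff s \<eta> u_cont)
    show "integrable lborel (\<lambda>x. indicator {0<..} x *\<^sub>R (2 * \<rho> x))"
      using set_integrable_mult_right[OF \<rho>_integrable, of 2] by (simp add: set_integrable_def)
    show "AE x in lborel. (\<lambda>N. indicator {0<..} x *\<^sub>R (\<rho> x * z N x)) \<longlonglongrightarrow> indicator {0<..} x *\<^sub>R (\<rho> x * (\<eta> x - m))"
    proof (intro AE_I2)
      fix x :: real
      show "(\<lambda>N. indicator {0<..} x *\<^sub>R (\<rho> x * z N x)) \<longlonglongrightarrow> indicator {0<..} x *\<^sub>R (\<rho> x * (\<eta> x - m))"
        using z_lim[of x] by (cases "x > 0") (auto intro!: tendsto_intros)
    qed
    show "AE x in lborel. norm (indicator {0<..} x *\<^sub>R (\<rho> x * z N x)) \<le> indicator {0<..} x *\<^sub>R (2 * \<rho> x)" for N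
    proof (intro AE_I2)
      fix x :: real
      have "x > 0 \<Longrightarrow> \<rho> x * \<bar>z N x\<bar> \<le> \<rho> x * 2" using z_bd[of x N] \<rho>_nonneg by (intro mult_left_mono) auto
      then show "norm (indicator {0<..} x *\<^sub>R (\<rho> x * z N x)) \<le> indicator {0<..} x *\<^sub>R (2 * \<rho> x)"
        using \<rho>_nonneg[of x] by (auto simp: indicator_def abs_mult mult.commute)
    qed
  qed
  have "(\<lambda>N. \<bar>w\<^sub>0 * z N 0 + (LBINT x:{0<..}. \<rho> x * z N x)
     + 1 / 2 * (\<delta> - 1) * \<beta> * (G' 0)\<^sup>2 * w\<^sub>0 * z N 0 * (h * \<bar>ln h\<bar>)\<bar>)
    \<longlonglongrightarrow> \<bar>w\<^sub>0 * (\<eta> 0 - m) + (LBINT x:{0<..}. \<rho> x * (\<eta> x - m))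
     + 1 / 2 * (\<delta> - 1) * \<beta> * (G' 0)\<^sup>2 * w\<^sub>0 * (\<eta> 0 - m) * (h * \<bar>ln h\<bar>)\<bar>"
    by (intro tendsto_rabs tendsto_add tendsto_mult tendsto_const z_lim int_lim order_refl)
  then show ?thesis by (rule LIMSEQ_le_const2) (use main in blast)
qed

end

text \<open>From B h on, the maximum with 0 and the cutoff are both inactive. Below B h the image
  lies between 0 and x + B h, and x itself is less than B h, so the displacement is at most B h in
  both directions.\<close>

lemma clamp_properties:
  fixes G' \<kappa> :: "real \<Rightarrow> real" and h B :: real
  assumes h: "h > 0" and B: "B \<ge> 0" "\<And>x. x \<ge> 0 \<Longrightarrow> \<bar>G' x\<bar> \<le> B" and G': "continuous_on {0..} G'"
    and \<kappa>: "\<exists>x\<ge>0. G' x \<noteq> 0 \<Longrightarrow> cutoff (h * B) \<kappa>"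
  defines "\<phi> \<equiv> clamp G' \<kappa> h"
  shows "\<phi> 0 = 0" "\<And>x. x \<ge> 0 \<Longrightarrow> \<phi> x \<ge> 0" "\<And>x. x \<ge> 0 \<Longrightarrow> \<bar>\<phi> x - x\<bar> \<le> B * h"
    "\<And>x. x \<ge> 0 \<Longrightarrow> x \<ge> B * h \<Longrightarrow> \<phi> x = x - h * G' x" "continuous_on {0..} \<phi>"
proof -
  have "\<phi> 0 = 0 \<and> (\<forall>x\<ge>0. \<phi> x \<ge> 0) \<and> (\<forall>x\<ge>0. \<bar>\<phi> x - x\<bar> \<le> B * h) \<and>
    (\<forall>x\<ge>0. x \<ge> B * h \<longrightarrow> \<phi> x = x - h * G' x) \<and> continuous_on {0..} \<phi>"
  proof (cases "\<forall>y\<ge>0. G' y = 0")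
    case True
    then have "\<phi> = (\<lambda>x. x)" by (simp add: \<phi>_def clamp_def fun_eq_iff)
    then show ?thesis using True h B by simp
  next
    case False
    then have cut: "cutoff (h * B) \<kappa>" using \<kappa> by blast
    have \<phi>: "\<phi> x = \<kappa> x * max (x - h * G' x) 0" for x
      unfolding \<phi>_def clamp_def if_not_P[OF False] ..
    have k: "\<And>x. x \<ge> 0 \<Longrightarrow> 0 \<le> \<kappa> x \<and> \<kappa> x \<le> 1" "\<And>x. x \<ge> h * B \<Longrightarrow> \<kappa> x = 1" "\<kappa> 0 = 0"
      using cut by (auto simp: cutoff_def)
    have kc: "continuous_on {0..} \<kappa>"
    proof -
      have "Ck 1 \<kappa>" using cut by (simp add: cutoff_def)
      then obtain D where "derivs_upto 1 \<kappa> D" by (auto simp: Ck_def)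
      then show ?thesis unfolding derivs_upto_def by (metis zero_le)
    qed
    have hG: "\<bar>h * G' x\<bar> \<le> B * h" if "x \<ge> 0" for x
      using B(2)[OF that] h by (simp add: abs_mult mult.commute)
    have eq: "\<phi> x = x - h * G' x" if "x \<ge> 0" "x \<ge> B * h" for x
      using hG[OF that(1)] that k(2)[of x] by (simp add: \<phi> mult.commute)
    have nn: "\<phi> x \<ge> 0" if "x \<ge> 0" for x using k(1)[OF that] by (simp add: \<phi>)
    have cl: "\<bar>\<phi> x - x\<bar> \<le> B * h" if x: "x \<ge> 0" for x
    proof (cases "x \<ge> B * h")
      case True
      then show ?thesis using eq[OF x True] hG[OF x] by simp
    next
      case False
      have "\<kappa> x * max (x - h * G' x) 0 \<le> 1 * (x + B * h)"
        using k(1)[OF x] hG[OF x] x False by (intro mult_mono) auto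
      then show ?thesis using nn[OF x] False by (simp add: \<phi>)
    qed
    have "continuous_on {0..} \<phi>"
      unfolding \<phi>[abs_def] by (intro continuous_intros kc G')
    then show ?thesis using eq nn cl k(3) by (simp add: \<phi>)
  qed
  then show "\<phi> 0 = 0" "\<And>x. x \<ge> 0 \<Longrightarrow> \<phi> x \<ge> 0" "\<And>x. x \<ge> 0 \<Longrightarrow> \<bar>\<phi> x - x\<bar> \<le> B * h"
    "\<And>x. x \<ge> 0 \<Longrightarrow> x \<ge> B * h \<Longrightarrow> \<phi> x = x - h * G' x" "continuous_on {0..} \<phi>"
    by blast+
qed

section \<open>From the expansion to the total variation bound\<close>

lemma Ckb_bounds:
  assumes "Ckb 2 f"
  shows "bounded (f ` {0..})" "continuous_on {0..} f" "\<exists>L\<ge>0. \<forall>x\<ge>0. \<bar>f x - f 0\<bar> \<le> L * x"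
proof -
  obtain D where D: "derivs_upto 2 f D" "\<forall>i\<le>2. bounded (D i ` {0..})" using assms by (auto simp: Ckb_def)
  then have D0: "D 0 = f" by (simp add: derivs_upto_def)
  show "bounded (f ` {0..})" using D(2) D0 by (metis zero_le)
  show c: "continuous_on {0..} f" using D(1) D0 unfolding derivs_upto_def by (metis zero_le)
  have d: "(f has_real_derivative D 1 x) (at x within {0..})" if "x \<ge> 0" for x
    using D(1) D0 that unfolding derivs_upto_def by (metis One_nat_def pos2)
  have "bounded (D 1 ` {0..})" using D(2) by simp
  then obtain L where L: "\<And>x. x \<ge> 0 \<Longrightarrow> \<bar>D 1 x\<bar> \<le> L" by (auto simp: bounded_iff)
  have L0: "L \<ge> 0" using L[of 0] by simp
  have "\<bar>f x - f 0\<bar> \<le> L * x" if "x \<ge> 0" for x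
  proof (cases "x = 0")
    case False
    with that have x: "x > 0" by simp
    have d': "(f has_real_derivative D 1 y) (at y)" if "0 < y" "y < x" for y
      using d[of y] that at_within_interior[of y "{0..}"] by simp
    have c': "continuous_on {0..x} f" by (rule continuous_on_subset[OF c]) auto
    obtain y where y: "0 < y" "y < x" "f x - f 0 = (x - 0) * D 1 y"
      by (rule mean_value_interior[OF x c' d'])
    then show ?thesis using L[of y] x by (simp add: abs_mult mult.commute)
  qed simp
  then show "\<exists>L\<ge>0. \<forall>x\<ge>0. \<bar>f x - f 0\<bar> \<le> L * x" using L0 by blast
qed

lemma sup_norm_upper:
  assumes "bounded (f ` {0..})" "x \<ge> 0"
  shows "\<bar>f x\<bar> \<le> sup_norm f"
proof -
  obtain K where "\<forall>y\<in>f ` {0..}. norm y \<le> K" using assms(1) unfolding bounded_iff by blast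
  then have "bdd_above ((\<lambda>x. \<bar>f x\<bar>) ` {0..})" by (auto intro!: bdd_aboveI[of _ K])
  then show ?thesis unfolding sup_norm_def using assms(2) by (intro cSUP_upper) auto
qed

text \<open>The expansion says that e = (P - m) + k (\<eta>(0) - m) is O(h), with m =
  \<pi>_h(\<eta>) in the last bracket where the theorem has P = \<pi>(\<eta>). The exchange costs k
  (P - m). Since P - m is itself at most |e| + 2 k, this is at most |e| + 2 k^2, and k^2 is
  O(h).\<close>

lemma (in drift_setting) continuous_test_estimate:
  fixes \<nu> :: "real measure" and \<eta> :: "real \<Rightarrow> real" and h k :: real
  defines "\<pi> \<equiv> target lam \<beta> \<mu> \<delta> G" and "m \<equiv> (\<integral>x. \<eta> x \<partial>\<nu>)" and "E \<equiv> KT * K3 * 2 / Z"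
  assumes h: "h > 0" "h \<le> 1" and k: "k = K_star lam \<beta> \<mu> \<delta> G G' * (h * \<bar>ln h\<bar>)" "k \<le> 1"
    and \<nu>: "\<nu> \<in> space (prob_algebra half_line)"
    and \<eta>: "continuous_on {0..} \<eta>" "\<And>x. x \<ge> 0 \<Longrightarrow> \<bar>\<eta> x\<bar> \<le> 1"
    and expansion: "\<bar>w\<^sub>0 * (\<eta> 0 - m) + (LBINT x:{0<..}. \<rho> x * (\<eta> x - m))
     + 1 / 2 * (\<delta> - 1) * \<beta> * (G' 0)\<^sup>2 * w\<^sub>0 * (\<eta> 0 - m) * (h * \<bar>ln h\<bar>)\<bar> \<le> KT * K3 * (h * 2)"
  shows "m - ((1 - k) * (\<integral>x. \<eta> x \<partial>\<pi>) + k * \<eta> 0) \<le> (2 * E + 8 * (K_star lam \<beta> \<mu> \<delta> G G')\<^sup>2) * h"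
proof -
  let ?K = "K_star lam \<beta> \<mu> \<delta> G G'"
  have \<eta>m: "\<eta> \<in> borel_measurable half_line" by (rule half_line_measurable_continuous[OF \<eta>(1)])
  have Ks: "?K = 1 / 2 * (\<delta> - 1) * \<beta> * (G' 0)\<^sup>2 * (w\<^sub>0 / Z)" by (simp add: K_star_def target_measure(3))
  have K0: "?K \<ge> 0" unfolding Ks using \<delta> \<beta> w0_pos Z_pos by simp
  have k0: "k \<ge> 0" unfolding k(1) using K0 h by (intro mult_nonneg_nonneg) auto
  have \<pi>\<eta>: "(\<integral>x. \<eta> x \<partial>\<pi>) = (w\<^sub>0 * \<eta> 0 + (LBINT x:{0<..}. \<rho> x * \<eta> x)) / Z"
    unfolding \<pi>_def by (rule target_measure(4)[OF \<eta>m, of 1]) (rule \<eta>(2))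
  have i: "set_integrable lborel {0<..} (\<lambda>x. \<rho> x * \<eta> x)"
    by (rule mixture_density(4)[OF order_refl order_refl \<eta>m, of 1]) (rule \<eta>(2))
  have "(LBINT x:{0<..}. \<rho> x * (\<eta> x - m)) = (LBINT x:{0<..}. \<rho> x * \<eta> x) - m * (LBINT x:{0<..}. \<rho> x)"
  proof -
    have "(LBINT x:{0<..}. \<rho> x * \<eta> x - m * \<rho> x) = (LBINT x:{0<..}. \<rho> x * \<eta> x) - (LBINT x:{0<..}. m * \<rho> x)"
      by (rule set_integral_diff(2)[OF i set_integrable_mult_right[OF \<rho>_integrable]])
    then show ?thesis by (simp add: right_diff_distrib mult.commute[of m "\<rho> _"])
  qed
  then have 1: "w\<^sub>0 * (\<eta> 0 - m) + (LBINT x:{0<..}. \<rho> x * (\<eta> x - m)) = Z * ((\<integral>x. \<eta> x \<partial>\<pi>) - m)"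
  proof -
    assume *: "(LBINT x:{0<..}. \<rho> x * (\<eta> x - m)) = (LBINT x:{0<..}. \<rho> x * \<eta> x) - m * (LBINT x:{0<..}. \<rho> x)"
    have "Z * (\<integral>x. \<eta> x \<partial>\<pi>) = w\<^sub>0 * \<eta> 0 + (LBINT x:{0<..}. \<rho> x * \<eta> x)" unfolding \<pi>\<eta> using Z_pos by simp
    then show ?thesis unfolding * by (simp add: Z_def algebra_simps)
  qed
  have 2: "1 / 2 * (\<delta> - 1) * \<beta> * (G' 0)\<^sup>2 * w\<^sub>0 * (\<eta> 0 - m) * (h * \<bar>ln h\<bar>) = Z * (k * (\<eta> 0 - m))"
    unfolding k(1) Ks using Z_pos by simp
  define P where "P = (\<integral>x. \<eta> x \<partial>\<pi>)"
  define e where "e = (P - m) + k * (\<eta> 0 - m)"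
  have "\<bar>Z * e\<bar> \<le> KT * K3 * (h * 2)" using expansion unfolding 1 2 e_def P_def by (simp add: distrib_left)
  then have "Z * \<bar>e\<bar> \<le> KT * K3 * (h * 2)" using Z_pos by (simp add: abs_mult)
  then have e: "\<bar>e\<bar> \<le> E * h" using Z_pos unfolding E_def by (simp add: field_simps)
  have m1: "\<bar>m\<bar> \<le> 1" unfolding m_def by (rule prob_algebra_integral(2)[OF \<nu> \<eta>m]) (rule \<eta>(2))
  have em: "\<bar>k * (\<eta> 0 - m)\<bar> \<le> k * 2"
    unfolding abs_mult using k0 m1 \<eta>(2)[of 0] by (intro mult_mono) auto
  have "\<bar>P - m\<bar> \<le> \<bar>e\<bar> + k * 2" using em unfolding e_def by linarith
  then have "k * \<bar>P - m\<bar> \<le> k * (\<bar>e\<bar> + k * 2)" using k0 by (rule mult_left_mono)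
  also have "\<dots> \<le> 1 * \<bar>e\<bar> + 2 * k\<^sup>2" using mult_right_mono[OF k(2), of "\<bar>e\<bar>"] by (simp add: distrib_left power2_eq_square)
  \<comment> \<open>One factor h is split off; the other absorbs the squared logarithm.\<close>
  also have "k\<^sup>2 \<le> 4 * ?K\<^sup>2 * h"
  proof -
    have "k\<^sup>2 = ?K\<^sup>2 * h * (h * (ln h)\<^sup>2)" unfolding k(1) by (simp add: power_mult_distrib power2_eq_square)
    also have "\<dots> \<le> ?K\<^sup>2 * h * 4" using mult_ln_bounds(1)[OF h] h by (intro mult_left_mono) auto
    finally show ?thesis by simp
  qed
  finally have "k * \<bar>P - m\<bar> \<le> \<bar>e\<bar> + 8 * ?K\<^sup>2 * h" by simp
  moreover have "k * (P - m) \<le> k * \<bar>P - m\<bar>" using k0 by (intro mult_left_mono) auto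
  moreover have "m - ((1 - k) * P + k * \<eta> 0) = - e + k * (P - m)" by (simp add: e_def algebra_simps)
  moreover have "- e \<le> \<bar>e\<bar>" by simp
  ultimately have "m - ((1 - k) * P + k * \<eta> 0) \<le> 2 * \<bar>e\<bar> + 8 * ?K\<^sup>2 * h" by linarith
  also have "\<dots> \<le> 2 * (E * h) + 8 * ?K\<^sup>2 * h" using e by simp
  finally show ?thesis unfolding P_def by (simp add: algebra_simps)
qed

text \<open>Realises \<pi> + k (\<delta>_0 - \<pi>) as a positive measure, which is why k <= 1 is
  asked for. The set function in the theorem thereby becomes a difference of two finite measures, to
  which the total variation lemmas apply.\<close>

lemma (in drift_setting) target_mixture:
  fixes k :: real
  defines "\<pi> \<equiv> target lam \<beta> \<mu> \<delta> G"
  assumes k: "0 \<le> k" "k \<le> 1"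
  obtains \<nu> where "finite_measure \<nu>" "sets \<nu> = sets half_line"
    "\<And>\<eta> C. \<eta> \<in> borel_measurable half_line \<Longrightarrow> (\<And>x. x \<ge> 0 \<Longrightarrow> \<bar>\<eta> x\<bar> \<le> C) \<Longrightarrow>
      (\<integral>x. \<eta> x \<partial>\<nu>) = (1 - k) * (\<integral>x. \<eta> x \<partial>\<pi>) + k * \<eta> 0"
    "\<And>A. A \<in> sets half_line \<Longrightarrow> measure \<nu> A = (1 - k) * measure \<pi> A + k * indicator A 0"
proof -
  define s where "s = (1 - k) / Z"
  have s: "s \<ge> 0" unfolding s_def using k Z_pos by simp
  define \<nu> where "\<nu> = atom_plus_density (s * w\<^sub>0 + k) (\<lambda>x. s * \<rho> x)"
  note mix = mixture_density[OF s k(1), folded \<nu>_def]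
  have int: "(\<integral>x. \<eta> x \<partial>\<nu>) = (1 - k) * (\<integral>x. \<eta> x \<partial>\<pi>) + k * \<eta> 0"
    if "\<eta> \<in> borel_measurable half_line" "\<And>x. x \<ge> 0 \<Longrightarrow> \<bar>\<eta> x\<bar> \<le> C" for \<eta> C
  proof -
    have "(\<integral>x. \<eta> x \<partial>\<nu>) = s * (w\<^sub>0 * \<eta> 0 + (LBINT x:{0<..}. \<rho> x * \<eta> x)) + k * \<eta> 0" by (rule mix(3)[OF that])
    moreover have "(\<integral>x. \<eta> x \<partial>\<pi>) = (w\<^sub>0 * \<eta> 0 + (LBINT x:{0<..}. \<rho> x * \<eta> x)) / Z"
      unfolding \<pi>_def by (rule target_measure(4)[OF that])
    ultimately show ?thesis by (simp add: s_def)
  qed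
  have "measure \<nu> A = (1 - k) * measure \<pi> A + k * indicator A 0" if A: "A \<in> sets half_line" for A
  proof -
    have sp: "space \<nu> = {0..}" "space \<pi> = {0..}"
      using sets_eq_imp_space_eq[OF mix(2)] sets_eq_imp_space_eq[OF target_measure(2)] by (simp_all add: \<pi>_def)
    have "A \<subseteq> {0..}" using sets_half_lineD[OF A] by simp
    then have "A \<inter> {0..} = A" by blast
    moreover have "indicator A \<in> borel_measurable half_line" using A by simp
    ultimately show ?thesis using int[of "indicator A" 1] by (simp add: sp Int_absorb2 indicator_le_1)
  qed
  with that mix(1,2) int show ?thesis by blast
qed

theorem theorem6p9:
  fixes lam \<beta> \<mu> \<delta> :: real
    and G G' :: "real \<Rightarrow> real"
    and \<kappa> :: "real \<Rightarrow> real \<Rightarrow> real"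
    and \<pi>h :: "real \<Rightarrow> real measure"
  assumes "lam > 0" and "\<beta> > 0" and "\<mu> > 0" and "1 < \<delta>" and "\<delta> < 2"
    and deriv_G: "\<forall>x\<ge>0. (G has_real_derivative G' x) (at x within {0..})"
    and "Ckb 2 G'"
    and cutoffs: "(\<exists>x\<ge>0. G' x \<noteq> 0) \<Longrightarrow> \<forall>h>0. cutoff (h * sup_norm G') (\<kappa> h)"
    and moments: "\<exists>M h0. h0 > 0 \<and> (\<forall>u0\<ge>0.
        (SUP h\<in>{0<..h0}. limsup (\<lambda>n.
           \<integral>\<^sup>+y. ennreal (y\<^sup>2) \<partial>kernel_pow (clamped_ULA lam \<beta> \<mu> \<delta> G' \<kappa> h) n u0))
        \<le> ennreal M)"
    and ergodicity: "\<exists>c C h0. c > 0 \<and> h0 > 0 \<and> (\<forall>h\<in>{0<..h0}.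
        stationary (clamped_ULA lam \<beta> \<mu> \<delta> G' \<kappa> h) (\<pi>h h)
        \<and> (\<forall>\<nu>. stationary (clamped_ULA lam \<beta> \<mu> \<delta> G' \<kappa> h) \<nu> \<longrightarrow> \<nu> = \<pi>h h)
        \<and> (\<forall>x\<ge>0. \<forall>n.
             weighted_norm (\<lambda>y. 1 + y\<^sup>2)
               (\<lambda>A. measure (kernel_pow (clamped_ULA lam \<beta> \<mu> \<delta> G' \<kappa> h) n x) A - measure (\<pi>h h) A)
             \<le> ennreal (C * (1 + x\<^sup>2) * (1 - c * h) ^ n)))"
  shows "\<exists>C h1. h1 > 0 \<and> (\<forall>h\<in>{0<..h1}.
      (\<forall>\<eta>. \<eta> \<in> borel_measurable half_line \<and> bounded (\<eta> ` {0..}) \<longrightarrow>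
         \<bar>(\<integral>x. \<eta> x \<partial>\<pi>h h) - (\<integral>x. \<eta> x \<partial>target lam \<beta> \<mu> \<delta> G)
           - K_star lam \<beta> \<mu> \<delta> G G' * (\<eta> 0 - (\<integral>x. \<eta> x \<partial>target lam \<beta> \<mu> \<delta> G)) * (h * \<bar>ln h\<bar>)\<bar>
         \<le> C * (h * sup_norm \<eta>))
      \<and> weighted_norm (\<lambda>_. 1)
          (\<lambda>A. measure (\<pi>h h) A - measure (target lam \<beta> \<mu> \<delta> G) A
             - K_star lam \<beta> \<mu> \<delta> G G' * (h * \<bar>ln h\<bar>)
               * (indicator A 0 - measure (target lam \<beta> \<mu> \<delta> G) A))
        \<le> ennreal (C * h))"
proof -
  define B where "B = sup_norm G'"
  note Gb = Ckb_bounds[OF \<open>Ckb 2 G'\<close>]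
  have B: "\<bar>G' x\<bar> \<le> B" if "x \<ge> 0" for x unfolding B_def by (rule sup_norm_upper[OF Gb(1) that])
  have B0: "B \<ge> 0" using B[of 0] by simp
  obtain B1 where B1: "B1 \<ge> 0" "\<forall>x\<ge>0. \<bar>G' x - G' 0\<bar> \<le> B1 * x" using Gb(3) by blast
  obtain c C0 h0 where c: "c > 0" "h0 > 0" and erg: "\<And>h. h \<in> {0<..h0} \<Longrightarrow>
        stationary (clamped_ULA lam \<beta> \<mu> \<delta> G' \<kappa> h) (\<pi>h h)"
      "\<And>h x n. h \<in> {0<..h0} \<Longrightarrow> x \<ge> 0 \<Longrightarrow> weighted_norm (\<lambda>y. 1 + y\<^sup>2)
         (\<lambda>A. measure (kernel_pow (clamped_ULA lam \<beta> \<mu> \<delta> G' \<kappa> h) n x) A - measure (\<pi>h h) A)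
         \<le> ennreal (C0 * (1 + x\<^sup>2) * (1 - c * h) ^ n)"
    using ergodicity by blast
  define C where "C = \<bar>C0\<bar>"
  \<comment> \<open>The geometric series with ratio 1 - c h sums to C/(c h), which is
    \<open>Cf * 2 / h\<close>; the 2 is the bound on \<open>f - g \<circ> \<phi>\<close>.\<close>
  define Cf where "Cf = C / (2 * c)"
  interpret D: drift_setting lam \<beta> \<mu> \<delta> B B1 Cf G G'
    by unfold_locales (use assms(1-5) deriv_G B0 B B1 Gb(2) c in \<open>auto simp: Cf_def C_def\<close>)
  define \<pi> where "\<pi> = target lam \<beta> \<mu> \<delta> G"
  define Ks where "Ks = K_star lam \<beta> \<mu> \<delta> G G'"
  have Ks0: "Ks \<ge> 0"
    unfolding Ks_def K_star_def using assms(2,4) by (intro mult_nonneg_nonneg) auto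
  define Cfin where "Cfin = \<bar>2 * (D.KT * D.K3 * 2 / D.Z) + 8 * Ks\<^sup>2\<bar>"
  \<comment> \<open>The entries secure, in turn: the estimate of (E), h <= 1 for the logarithm, the
    smallness demanded by \<open>resolvent_instance\<close>, a ratio 1 - c h in [0,1), and 4
    K_star^2 h <= 1, which gives k <= 2 K_star sqrt h <= 1.\<close>
  define h1 where "h1 = min (min h0 1) (min (1 / (5 * B + 1)) (min (1 / (2 * c)) (1 / (4 * Ks\<^sup>2 + 1))))"
  have h1: "h1 > 0" unfolding h1_def using c B0 by (auto simp: add_nonneg_pos)
  have Cfin0: "Cfin \<ge> 0" by (simp add: Cfin_def)
  show ?thesis
  proof (rule exI[of _ Cfin], rule exI[of _ h1], rule conjI[OF h1], rule ballI)
    fix h assume "h \<in> {0<..h1}"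
    then have h: "0 < h" "h \<le> h0" "h \<le> 1" and hB: "h \<le> 1 / (5 * B + 1)" and hc: "h \<le> 1 / (2 * c)"
      and hK: "h \<le> 1 / (4 * Ks\<^sup>2 + 1)"
      by (auto simp: h1_def)
    have hB': "(5 * B + 1) * h \<le> 1" using hB B0 by (simp add: field_simps)
    have hc': "0 \<le> 1 - c * h" "1 - c * h < 1" "2 * (c * h) \<le> 1" using hc h c by (simp_all add: field_simps)
    define k where "k = Ks * (h * \<bar>ln h\<bar>)"
    have k0: "k \<ge> 0" unfolding k_def using Ks0 h by (intro mult_nonneg_nonneg) auto
    have k1: "k \<le> 1"
    proof -
      have "k \<le> Ks * (2 * sqrt h)"
        unfolding k_def using mult_ln_bounds(2)[OF h(1,3)] Ks0 by (intro mult_left_mono) auto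
      also have "\<dots> = sqrt (4 * Ks\<^sup>2 * h)" using Ks0 by (simp add: real_sqrt_mult)
      also have "4 * Ks\<^sup>2 * h \<le> 1"
      proof -
        have "(4 * Ks\<^sup>2 + 1) * h \<le> 1" using hK by (subst (asm) pos_le_divide_eq) (auto simp: add_nonneg_pos mult.commute)
        then show ?thesis using h by (simp add: distrib_right)
      qed
      finally show ?thesis by simp
    qed
    define \<phi> where "\<phi> = clamp G' (\<kappa> h) h"
    have cut: "cutoff (h * B) (\<kappa> h)" if "\<exists>x\<ge>0. G' x \<noteq> 0"
      using cutoffs[OF that] h(1) by (simp add: B_def)
    note \<phi> = clamp_properties[OF h(1) B0 B Gb(2) cut, folded \<phi>_def]
    define K where "K = (\<lambda>x. resolvent_kernel lam \<beta> \<mu> \<delta> h (\<phi> x))"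
    have KU: "clamped_ULA lam \<beta> \<mu> \<delta> G' \<kappa> h = K"
      by (simp add: K_def \<phi>_def clamped_ULA_def fun_eq_iff)
    interpret R: sticky_resolvent lam \<beta> \<mu> \<delta> h
      by unfold_locales (use assms(1-5) h in auto)
    have K: "K \<in> measurable half_line (prob_algebra half_line)"
      unfolding K_def by (rule R.resolvent_compose_measurable[OF \<phi>(5,2)])
    have "h \<in> {0<..h0}" using h by simp
    note erg = erg[OF this, unfolded KU]
    have \<nu>: "\<pi>h h \<in> space (prob_algebra half_line)" using erg(1) by (simp add: stationary_def)
    have fin: "finite_measure M" "sets M = sets half_line" if "M \<in> space (prob_algebra half_line)" for M
      using that by (auto simp: space_prob_algebra prob_space_def)
    have test: "(\<integral>x. \<eta> x \<partial>\<pi>h h) - ((1 - k) * (\<integral>x. \<eta> x \<partial>\<pi>) + k * \<eta> 0) \<le> Cfin * h"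
      if \<eta>: "continuous_on {0..} \<eta>" "\<And>x. x \<ge> 0 \<Longrightarrow> \<bar>\<eta> x\<bar> \<le> 1" for \<eta>
    proof -
      have \<eta>m: "\<eta> \<in> borel_measurable half_line" by (rule half_line_measurable_continuous[OF \<eta>(1)])
      have conv: "\<bar>(markov_op K ^^ n) \<eta> x - (\<integral>x. \<eta> x \<partial>\<pi>h h)\<bar> \<le> C * (1 + x\<^sup>2) * (1 - c * h) ^ n"
        if x: "x \<ge> 0" for x n
      proof -
        note P = kernel_pow_space[OF K x, of n]
        let ?T = "C * (1 + x\<^sup>2) * (1 - c * h) ^ n"
        let ?s = "\<lambda>A. measure (kernel_pow K n x) A - measure (\<pi>h h) A"
        have "weighted_norm (\<lambda>_. 1) ?s \<le> weighted_norm (\<lambda>y. 1 + y\<^sup>2) ?s"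
          by (rule weighted_norm_mono) simp
        also have "\<dots> \<le> ennreal (C0 * (1 + x\<^sup>2) * (1 - c * h) ^ n)" by (rule erg(2)[OF x])
        also have "\<dots> \<le> ennreal ?T"
          unfolding C_def using hc' by (intro ennreal_leI mult_right_mono) auto
        finally have "\<bar>(\<integral>y. \<eta> y \<partial>kernel_pow K n x) - (\<integral>y. \<eta> y \<partial>\<pi>h h)\<bar> \<le> 1 * ?T"
          by (rule integral_diff_le_total_variation[OF fin(1)[OF P] fin(1)[OF \<nu>] fin(2)[OF P] fin(2)[OF \<nu>] _ _ \<eta>m])
            (use hc' \<eta>(2) in \<open>auto simp: C_def\<close>)
        moreover have "(\<integral>y. \<eta> y \<partial>kernel_pow K n x) = (markov_op K ^^ n) \<eta> x"
          by (rule integral_kernel_pow[OF K \<eta>m _ x]) (rule \<eta>(2))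
        ultimately show ?thesis by simp
      qed
      have "C / (1 - (1 - c * h)) \<le> Cf * 2 / h" using c h by (simp add: Cf_def field_simps)
      then have ex: "\<bar>D.w\<^sub>0 * (\<eta> 0 - (\<integral>x. \<eta> x \<partial>\<pi>h h)) + (LBINT x:{0<..}. D.\<rho> x * (\<eta> x - (\<integral>x. \<eta> x \<partial>\<pi>h h)))
         + 1 / 2 * (\<delta> - 1) * \<beta> * (G' 0)\<^sup>2 * D.w\<^sub>0 * (\<eta> 0 - (\<integral>x. \<eta> x \<partial>\<pi>h h)) * (h * \<bar>ln h\<bar>)\<bar> \<le> D.KT * D.K3 * (h * 2)"
        using conv unfolding K_def
        by (intro D.stationary_expansion[OF h(1) hB' \<phi> \<eta> hc'(1,2)]) (auto simp: C_def)
      have "(\<integral>x. \<eta> x \<partial>\<pi>h h) - ((1 - k) * (\<integral>x. \<eta> x \<partial>\<pi>) + k * \<eta> 0)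
          \<le> (2 * (D.KT * D.K3 * 2 / D.Z) + 8 * Ks\<^sup>2) * h"
        using D.continuous_test_estimate[OF h(1,3) k_def[unfolded Ks_def] k1 \<nu> \<eta> ex]
        unfolding Ks_def \<pi>_def .
      also have "\<dots> \<le> Cfin * h" unfolding Cfin_def using h by (intro mult_right_mono) auto
      finally show ?thesis .
    qed
    obtain \<nu>' where \<nu>': "finite_measure \<nu>'" "sets \<nu>' = sets half_line"
      "\<And>\<eta> C. \<eta> \<in> borel_measurable half_line \<Longrightarrow> (\<And>x. x \<ge> 0 \<Longrightarrow> \<bar>\<eta> x\<bar> \<le> C) \<Longrightarrow>
        (\<integral>x. \<eta> x \<partial>\<nu>') = (1 - k) * (\<integral>x. \<eta> x \<partial>\<pi>) + k * \<eta> 0"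
      "\<And>A. A \<in> sets half_line \<Longrightarrow> measure \<nu>' A = (1 - k) * measure \<pi> A + k * indicator A 0"
      using D.target_mixture[OF k0 k1] unfolding \<pi>_def by blast
    \<comment> \<open>Continuous functions bound the total variation, and the total variation then
      bounds the error for all bounded measurable functions, so both claims share one
      constant.\<close>
    have tv: "weighted_norm (\<lambda>_. 1) (\<lambda>A. measure (\<pi>h h) A - measure \<nu>' A) \<le> ennreal (Cfin * h)"
    proof (rule total_variation_le_continuous[OF fin(1)[OF \<nu>] \<nu>'(1) fin(2)[OF \<nu>] \<nu>'(2)])
      fix \<eta> :: "real \<Rightarrow> real" assume \<eta>: "continuous_on UNIV \<eta>" "\<And>x. \<bar>\<eta> x\<bar> \<le> 1"
      have c: "continuous_on {0..} \<eta>" by (rule continuous_on_subset[OF \<eta>(1)]) simp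
      have "(\<integral>x. \<eta> x \<partial>\<nu>') = (1 - k) * (\<integral>x. \<eta> x \<partial>\<pi>) + k * \<eta> 0"
        by (rule \<nu>'(3)[OF half_line_measurable_continuous[OF c]]) (rule \<eta>(2))
      then show "(\<integral>x. \<eta> x \<partial>\<pi>h h) - (\<integral>x. \<eta> x \<partial>\<nu>') \<le> Cfin * h" using test[OF c \<eta>(2)] by simp
    qed
    have "\<bar>(\<integral>x. \<eta> x \<partial>\<pi>h h) - (\<integral>x. \<eta> x \<partial>\<pi>) - Ks * (\<eta> 0 - (\<integral>x. \<eta> x \<partial>\<pi>)) * (h * \<bar>ln h\<bar>)\<bar>
        \<le> Cfin * (h * sup_norm \<eta>)"
      if \<eta>: "\<eta> \<in> borel_measurable half_line" "bounded (\<eta> ` {0..})" for \<eta>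
    proof -
      have b: "\<And>x. x \<ge> 0 \<Longrightarrow> \<bar>\<eta> x\<bar> \<le> sup_norm \<eta>" by (rule sup_norm_upper[OF \<eta>(2)])
      have "\<bar>(\<integral>x. \<eta> x \<partial>\<pi>h h) - (\<integral>x. \<eta> x \<partial>\<nu>')\<bar> \<le> sup_norm \<eta> * (Cfin * h)"
        by (rule integral_diff_le_total_variation[OF fin(1)[OF \<nu>] \<nu>'(1) fin(2)[OF \<nu>] \<nu>'(2) tv _ \<eta>(1) b])
          (use Cfin0 h in auto)
      then show ?thesis using \<nu>'(3)[OF \<eta>(1) b] by (simp add: k_def algebra_simps)
    qed
    moreover have "weighted_norm (\<lambda>_. 1) (\<lambda>A. measure (\<pi>h h) A - measure \<pi> A
        - Ks * (h * \<bar>ln h\<bar>) * (indicator A 0 - measure \<pi> A)) \<le> ennreal (Cfin * h)"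
    proof -
      have "weighted_norm (\<lambda>_. 1) (\<lambda>A. measure (\<pi>h h) A - measure \<pi> A
          - Ks * (h * \<bar>ln h\<bar>) * (indicator A 0 - measure \<pi> A))
        = weighted_norm (\<lambda>_. 1) (\<lambda>A. measure (\<pi>h h) A - measure \<nu>' A)"
        by (rule weighted_norm_cong) (simp add: \<nu>'(4) k_def algebra_simps)
      then show ?thesis using tv by simp
    qed
    ultimately show "(\<forall>\<eta>. \<eta> \<in> borel_measurable half_line \<and> bounded (\<eta> ` {0..}) \<longrightarrow>
         \<bar>(\<integral>x. \<eta> x \<partial>\<pi>h h) - (\<integral>x. \<eta> x \<partial>target lam \<beta> \<mu> \<delta> G)
           - K_star lam \<beta> \<mu> \<delta> G G' * (\<eta> 0 - (\<integral>x. \<eta> x \<partial>target lam \<beta> \<mu> \<delta> G)) * (h * \<bar>ln h\<bar>)\<bar>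
         \<le> Cfin * (h * sup_norm \<eta>))
      \<and> weighted_norm (\<lambda>_. 1)
          (\<lambda>A. measure (\<pi>h h) A - measure (target lam \<beta> \<mu> \<delta> G) A
             - K_star lam \<beta> \<mu> \<delta> G G' * (h * \<bar>ln h\<bar>)
               * (indicator A 0 - measure (target lam \<beta> \<mu> \<delta> G) A))
        \<le> ennreal (Cfin * h)"
      unfolding \<pi>_def Ks_def by blast
  qed
qed

end
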